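(* Suppose a topological group $G$ carries a continuous left-invariant coarsely proper stable écart. Then $G$ admits a coarsely proper continuous affine isometric action on a reflexive Banach space.
   Context: An écart is a pseudometric. An écart $d$ on a set $X$ is stable if for all sequences $(x_n)$ and $(y_m)$ in $X$ one has $\lim_{n\to\infty}\lim_{m\to\infty}d(x_n,y_m)=\lim_{m\to\infty}\lim_{n\to\infty}d(x_n,y_m)$ whenever both limits exist in $\mathbb R$. For an écart $d$ on $G$ let $\mathcal E_d$ be the family of all $A\subseteq G\times G$ with $\sup_{(x,y)\in A}d(x,y)<\infty$. The left-coarse structure of a topological group $G$ is $\mathcal E_L=\bigcap_d\mathcal E_d$, the intersection being over all continuous left-invariant écarts $d$ on $G$. A continuous left-invariant écart $d$ on $G$ is coarsely proper if $\mathcal E_L=\mathcal E_d$. A map $\sigma\colon G\to (Y,\partial)$ into a metric space is a coarse embedding if $\sup_{(x,y)\in A}\partial(\sigma(x),\sigma(y))<\infty$ for every $A\in\mathcal E_L$ and, for every $C<\infty$, the set $\{(x,y): \partial(\sigma(x),\sigma(y))\leqslant C\}$ belongs to $\mathcal E_L$. A continuous affine isometric action of $G$ on a Banach space $E$ has the form $\alpha(g)\xi=\pi(g)\xi+b(g)$, where $\pi$ is a strongly continuous isometric linear representation of $G$ on $E$ and $b\colon G\to E$ is continuous with $b(gf)=\pi(g)b(f)+b(g)$; it is coarsely proper if $b$ is a coarse embedding. *)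

theory Defs
  imports "HOL-Analysis.Analysis" "HOL-Algebra.Algebraic_Closure_Type"
begin

section \<open>Ecarts and the left-coarse structure of a topological group\<close>

text \<open>
  Topological groups are types of class \<^class>\<open>topological_group_add\<close>. The operation is written
  additively, but the class does not assume commutativity (nor any separation axiom).
\<close>

definition ecart :: "('a \<Rightarrow> 'a \<Rightarrow> real) \<Rightarrow> bool" where
  "ecart d \<longleftrightarrow>
     (\<forall>x y. 0 \<le> d x y) \<and> (\<forall>x. d x x = 0) \<and> (\<forall>x y. d x y = d y x) \<and>
     (\<forall>x y z. d x z \<le> d x y + d y z)"

definition stable_ecart :: "('a \<Rightarrow> 'a \<Rightarrow> real) \<Rightarrow> bool" where
  "stable_ecart d \<longleftrightarrow>
     (\<forall>(x :: nat \<Rightarrow> 'a) (y :: nat \<Rightarrow> 'a) u v a b.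
        (\<forall>n. (\<lambda>m. d (x n) (y m)) \<longlonglongrightarrow> u n) \<longrightarrow> u \<longlonglongrightarrow> a \<longrightarrow>
        (\<forall>m. (\<lambda>n. d (x n) (y m)) \<longlonglongrightarrow> v m) \<longrightarrow> v \<longlonglongrightarrow> b \<longrightarrow> a = b)"

definition left_invariant :: "('g::group_add \<Rightarrow> 'g \<Rightarrow> real) \<Rightarrow> bool" where
  "left_invariant d \<longleftrightarrow> (\<forall>g x y. d (g + x) (g + y) = d x y)"

definition continuous_left_invariant_ecart :: "('g::topological_group_add \<Rightarrow> 'g \<Rightarrow> real) \<Rightarrow> bool" where
  "continuous_left_invariant_ecart d \<longleftrightarrow>
     ecart d \<and> left_invariant d \<and> continuous_on UNIV (\<lambda>(x, y). d x y)"

definition ecart_coarse_structure :: "('a \<Rightarrow> 'a \<Rightarrow> real) \<Rightarrow> ('a \<times> 'a) set set" where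
  "ecart_coarse_structure d = {A. bdd_above ((\<lambda>(x, y). d x y) ` A)}"

definition left_coarse_structure :: "('g::topological_group_add \<times> 'g) set set" where
  "left_coarse_structure = \<Inter> (ecart_coarse_structure ` {d. continuous_left_invariant_ecart d})"

definition coarsely_proper_ecart :: "('g::topological_group_add \<Rightarrow> 'g \<Rightarrow> real) \<Rightarrow> bool" where
  "coarsely_proper_ecart d \<longleftrightarrow>
     continuous_left_invariant_ecart d \<and> left_coarse_structure = ecart_coarse_structure d"

definition coarse_embedding ::
    "'y set \<Rightarrow> ('y \<Rightarrow> 'y \<Rightarrow> real) \<Rightarrow> ('g::topological_group_add \<Rightarrow> 'y) \<Rightarrow> bool" where
  "coarse_embedding Y \<delta> \<sigma> \<longleftrightarrow>
     Metric_space Y \<delta> \<and> range \<sigma> \<subseteq> Y \<and>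
     (\<forall>A\<in>left_coarse_structure. bdd_above ((\<lambda>(x, y). \<delta> (\<sigma> x) (\<sigma> y)) ` A)) \<and>
     (\<forall>C. {(x, y). \<delta> (\<sigma> x) (\<sigma> y) \<le> C} \<in> left_coarse_structure)"


section \<open>Reflexive Banach spaces with explicit carrier\<close>

text \<open>
  The class \<^class>\<open>banach\<close> cannot be used for a space whose existence is asserted, since there is no
  existential quantification over types. Real normed spaces are therefore modules over the field of
  real numbers together with a norm. The fields \<^const>\<open>mult\<close> and \<^const>\<open>one\<close> of the record, inherited
  from rings, play no role.
\<close>

record 'e nspace = "(real, 'e) module" +
  nrm :: "'e \<Rightarrow> real"

definition normed_space :: "'e nspace \<Rightarrow> bool" where
  "normed_space E \<longleftrightarrow>
     Module.module (ring_of_type_algebra :: real ring) E \<and>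
     (\<forall>x\<in>carrier E. 0 \<le> nrm E x) \<and>
     (\<forall>x\<in>carrier E. nrm E x = 0 \<longleftrightarrow> x = \<zero>\<^bsub>E\<^esub>) \<and>
     (\<forall>x\<in>carrier E. \<forall>y\<in>carrier E. nrm E (x \<oplus>\<^bsub>E\<^esub> y) \<le> nrm E x + nrm E y) \<and>
     (\<forall>a. \<forall>x\<in>carrier E. nrm E (a \<odot>\<^bsub>E\<^esub> x) = \<bar>a\<bar> * nrm E x)"

text \<open>
  The value 0 outside the carrier is needed because \<^locale>\<open>Metric_space\<close> requires nonnegativity and
  symmetry on the whole type.
\<close>

definition ndist :: "'e nspace \<Rightarrow> 'e \<Rightarrow> 'e \<Rightarrow> real" where
  "ndist E x y = (if x \<in> carrier E \<and> y \<in> carrier E then nrm E (x \<ominus>\<^bsub>E\<^esub> y) else 0)"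

lemma Metric_space_ndist:
  assumes "normed_space E"
  shows "Metric_space (carrier E) (ndist E)"
proof -
  let ?R = "ring_of_type_algebra :: real ring"
  interpret Module.module ?R E
    using assms by (simp add: normed_space_def)
  have R: "carrier ?R = UNIV" "\<one>\<^bsub>?R\<^esub> = 1"
    by (auto simp: ring_of_type_algebra_def)
  have neg1: "\<ominus>\<^bsub>?R\<^esub> \<one>\<^bsub>?R\<^esub> = (-1 :: real)"
    by (rule R.minus_equality) (auto simp: ring_of_type_algebra_def)
  have uminus: "nrm E (\<ominus>\<^bsub>E\<^esub> x) = nrm E x" if x: "x \<in> carrier E" for x
  proof -
    have "\<ominus>\<^bsub>E\<^esub> x = (-1) \<odot>\<^bsub>E\<^esub> x"
      using smult_l_minus[of "\<one>\<^bsub>?R\<^esub>" x] x R neg1 smult_one[OF x] by simp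
    then show ?thesis
      using assms x by (auto simp: normed_space_def)
  qed
  have comm: "nrm E (x \<ominus>\<^bsub>E\<^esub> y) = nrm E (y \<ominus>\<^bsub>E\<^esub> x)" if "x \<in> carrier E" "y \<in> carrier E" for x y
  proof -
    have "\<ominus>\<^bsub>E\<^esub> (y \<ominus>\<^bsub>E\<^esub> x) = x \<ominus>\<^bsub>E\<^esub> y"
      using that by (simp add: a_minus_def M.minus_add M.a_comm)
    then show ?thesis
      using uminus[of "y \<ominus>\<^bsub>E\<^esub> x"] that by simp
  qed
  have tri: "nrm E (x \<ominus>\<^bsub>E\<^esub> z) \<le> nrm E (x \<ominus>\<^bsub>E\<^esub> y) + nrm E (y \<ominus>\<^bsub>E\<^esub> z)"
    if "x \<in> carrier E" "y \<in> carrier E" "z \<in> carrier E" for x y z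
  proof -
    have "(x \<ominus>\<^bsub>E\<^esub> y) \<oplus>\<^bsub>E\<^esub> (y \<ominus>\<^bsub>E\<^esub> z) = x \<ominus>\<^bsub>E\<^esub> z"
      using that by (simp add: a_minus_def M.a_assoc M.r_neg1)
    then show ?thesis
      using assms that unfolding normed_space_def by (metis M.minus_closed)
  qed
  have zero: "nrm E (x \<ominus>\<^bsub>E\<^esub> y) = 0 \<longleftrightarrow> x = y" if "x \<in> carrier E" "y \<in> carrier E" for x y
  proof -
    have "x \<ominus>\<^bsub>E\<^esub> y = \<zero>\<^bsub>E\<^esub> \<longleftrightarrow> x = y"
      using that by (metis M.a_inv_closed M.minus_equality M.minus_minus M.r_neg a_minus_def)
    then show ?thesis
      using assms that by (simp add: normed_space_def)
  qed
  show ?thesis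
    by unfold_locales
      (use assms comm tri zero in \<open>auto simp: ndist_def normed_space_def\<close>)
qed

definition banach_space :: "'e nspace \<Rightarrow> bool" where
  "banach_space E \<longleftrightarrow> normed_space E \<and> Metric_space.mcomplete (carrier E) (ndist E)"

abbreviation norm_topology :: "'e nspace \<Rightarrow> 'e topology" where
  "norm_topology E \<equiv> Metric_space.mtopology (carrier E) (ndist E)"

text \<open>
  Functionals are represented by functions that are \<^const>\<open>undefined\<close> outside the carrier, so that
  equality of functionals is equality of functions.
\<close>

definition bounded_functionals :: "'e nspace \<Rightarrow> ('e \<Rightarrow> real) set" where
  "bounded_functionals E =
     {f \<in> extensional (carrier E).
        (\<forall>x\<in>carrier E. \<forall>y\<in>carrier E. f (x \<oplus>\<^bsub>E\<^esub> y) = f x + f y) \<and>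
        (\<forall>a. \<forall>x\<in>carrier E. f (a \<odot>\<^bsub>E\<^esub> x) = a * f x) \<and>
        (\<exists>K. \<forall>x\<in>carrier E. \<bar>f x\<bar> \<le> K * nrm E x)}"

definition dual_space :: "'e nspace \<Rightarrow> ('e \<Rightarrow> real) nspace" where
  "dual_space E =
     \<lparr>carrier = bounded_functionals E,
      mult = undefined, one = undefined,
      zero = (\<lambda>x\<in>carrier E. 0),
      add = (\<lambda>f g. \<lambda>x\<in>carrier E. f x + g x),
      smult = (\<lambda>a f. \<lambda>x\<in>carrier E. a * f x),
      nrm = (\<lambda>f. SUP x\<in>{x \<in> carrier E. nrm E x \<le> 1}. \<bar>f x\<bar>)\<rparr>"

definition canonical_embedding :: "'e nspace \<Rightarrow> 'e \<Rightarrow> ('e \<Rightarrow> real) \<Rightarrow> real" where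
  "canonical_embedding E x = (\<lambda>f\<in>carrier (dual_space E). f x)"

definition reflexive_space :: "'e nspace \<Rightarrow> bool" where
  "reflexive_space E \<longleftrightarrow>
     canonical_embedding E ` carrier E = carrier (dual_space (dual_space E))"


section \<open>Affine isometric actions\<close>

definition linear_isometric_representation ::
    "'e nspace \<Rightarrow> ('g::group_add \<Rightarrow> 'e \<Rightarrow> 'e) \<Rightarrow> bool" where
  "linear_isometric_representation E \<pi> \<longleftrightarrow>
     (\<forall>g. \<forall>\<xi>\<in>carrier E. \<pi> g \<xi> \<in> carrier E) \<and>
     (\<forall>g. \<forall>\<xi>\<in>carrier E. \<forall>\<eta>\<in>carrier E. \<pi> g (\<xi> \<oplus>\<^bsub>E\<^esub> \<eta>) = \<pi> g \<xi> \<oplus>\<^bsub>E\<^esub> \<pi> g \<eta>) \<and>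
     (\<forall>g a. \<forall>\<xi>\<in>carrier E. \<pi> g (a \<odot>\<^bsub>E\<^esub> \<xi>) = a \<odot>\<^bsub>E\<^esub> \<pi> g \<xi>) \<and>
     (\<forall>g. \<forall>\<xi>\<in>carrier E. nrm E (\<pi> g \<xi>) = nrm E \<xi>) \<and>
     (\<forall>\<xi>\<in>carrier E. \<pi> 0 \<xi> = \<xi>) \<and>
     (\<forall>g f. \<forall>\<xi>\<in>carrier E. \<pi> (g + f) \<xi> = \<pi> g (\<pi> f \<xi>))"

definition strongly_continuous ::
    "'e nspace \<Rightarrow> ('g::topological_space \<Rightarrow> 'e \<Rightarrow> 'e) \<Rightarrow> bool" where
  "strongly_continuous E \<pi> \<longleftrightarrow>
     (\<forall>\<xi>\<in>carrier E. continuous_map euclidean (norm_topology E) (\<lambda>g. \<pi> g \<xi>))"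

definition continuous_cocycle ::
    "'e nspace \<Rightarrow> ('g::topological_group_add \<Rightarrow> 'e \<Rightarrow> 'e) \<Rightarrow> ('g \<Rightarrow> 'e) \<Rightarrow> bool" where
  "continuous_cocycle E \<pi> b \<longleftrightarrow>
     continuous_map euclidean (norm_topology E) b \<and>
     (\<forall>g f. b (g + f) = \<pi> g (b f) \<oplus>\<^bsub>E\<^esub> b g)"

definition continuous_affine_isometric_action ::
    "'e nspace \<Rightarrow> ('g::topological_group_add \<Rightarrow> 'e \<Rightarrow> 'e) \<Rightarrow> ('g \<Rightarrow> 'e \<Rightarrow> 'e) \<Rightarrow> ('g \<Rightarrow> 'e) \<Rightarrow> bool" where
  "continuous_affine_isometric_action E \<alpha> \<pi> b \<longleftrightarrow>
     linear_isometric_representation E \<pi> \<and> strongly_continuous E \<pi> \<and> continuous_cocycle E \<pi> b \<and>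
     (\<forall>g. \<forall>\<xi>\<in>carrier E. \<alpha> g \<xi> = \<pi> g \<xi> \<oplus>\<^bsub>E\<^esub> b g)"

definition coarsely_proper_action ::
    "'e nspace \<Rightarrow> ('g::topological_group_add \<Rightarrow> 'e \<Rightarrow> 'e) \<Rightarrow> bool" where
  "coarsely_proper_action E \<alpha> \<longleftrightarrow>
     (\<exists>\<pi> b. continuous_affine_isometric_action E \<alpha> \<pi> b \<and>
            coarse_embedding (carrier E) (ndist E) b)"

text \<open>
  The type of the vectors of the space has to be fixed in advance. The type below is large enough
  for this to be no restriction: replacing a space by the closed linear span of the range of the
  cocycle, which is invariant under the linear part, one may assume that the space has at most
  as many elements as this type, and then its structure can be transported.
\<close>

type_synonym 'g vectors = "nat \<Rightarrow> 'g \<Rightarrow> real"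

end

theory Submission
  imports Defs "HOL-Library.Diagonal_Subsequence" "HOL-Probability.Discrete_Topology"
begin

text \<open>
  Let \<open>B\<close> be the space of bounded functions on \<open>\<nat> \<times> G\<close> and let \<open>K\<close> consist of the functions
  \<open>(k, y) \<mapsto> 8\<^sup>-\<^sup>k (min (d x y) 16\<^sup>k - min (d x' y) 16\<^sup>k) / sqrt (d x x')\<close>.
  The truncation at \<open>16\<^sup>k\<close>, the weight \<open>8\<^sup>-\<^sup>k\<close> and the square root
  make these quotients tend to 0 whenever \<open>k \<rightarrow> \<infinity>\<close>, \<open>d x x' \<rightarrow> 0\<close> or
  \<open>d x x' \<rightarrow> \<infinity>\<close>, so stability of \<open>d\<close> gives the interchange of double limits
  between \<open>K\<close> and the point evaluations. By Ptak's lemma this passes to convex hulls, and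
  every bounded functional on \<open>B\<close> is, uniformly on \<open>K\<close>, a limit of combinations of
  evaluations. Hence the interpolation space of Davis, Figiel, Johnson and Pelczynski between \<open>B\<close> and
  the convex hull of \<open>K\<close> is reflexive: the evaluations have dense span in its dual, so an element
  of the bidual is a function on \<open>\<nat> \<times> G\<close>.

  Translation in \<open>y\<close> permutes \<open>K\<close>, and the numerator with \<open>x' = 0\<close> is a cocycle \<open>b\<close>.
  Since \<open>b x - b y\<close> is \<open>sqrt (d x y)\<close> times an element of \<open>K\<close>, its norm is at most
  \<open>2 sqrt (d x y)\<close>; evaluating at \<open>(k, y)\<close> bounds it below by \<open>2\<^sup>k\<close> once
  \<open>d x y \<ge> 16\<^sup>k\<close>.
\<close>

section \<open>Ptak's combinatorial lemma\<close>

text \<open>The constants answer two opposite demands. With truncation \<open>R\<close> and weight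
  \<open>c\<close>, division by \<open>sqrt (d x x')\<close> leaves a quotient of size at most
  \<open>c * sqrt R\<close>, which has to tend to 0 so that large \<open>k\<close> cannot disturb
  the interchange of limits, whereas the cocycle is bounded below by \<open>c * R\<close> at distant
  points, which has to be unbounded. The choice \<open>R = 16^k\<close>, \<open>c = (1/8)^k\<close>
  gives \<open>(1/2)^k\<close> and \<open>2^k\<close>. Dividing by \<open>d x x'\<close> instead
  would give no decay for close points, and not dividing at all would give none for distant ones.

  Stability speaks only of double limits that are finite. Truncation also brings unbounded sequences
  under control, because truncated distances to points going to infinity are eventually constant.

  Weak compactness is never formulated: the interchange of limits is used directly, and the averages
  supplied by Ptak's lemma take the place of compactness arguments. One obstacle remains to the end:
  the function attached to an element of the bidual is at first only bounded, so approximations have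
  to be controlled at this function before it is known to lie in the interpolation space.\<close>

definition avg :: "nat list \<Rightarrow> (nat \<Rightarrow> 'a) \<Rightarrow> 'a::real_vector" where
  "avg l f = (1 / real (length l)) *\<^sub>R (\<Sum>i\<leftarrow>l. f i)"

text \<open>Lists with repetitions encode finitely supported rational probability weights. Repeating
  each list as often as the other is long gives both the same total weight, so this is the midpoint
  of two such weights.\<close>

definition midlist :: "nat list \<Rightarrow> nat list \<Rightarrow> nat list" where
  "midlist l l' = concat (replicate (length l') l) @ concat (replicate (length l) l')"

lemma sum_list_concat_replicate:
  "(\<Sum>i\<leftarrow>concat (replicate n l). f i) = real n *\<^sub>R (\<Sum>i\<leftarrow>l. f i :: 'a::real_vector)"
  by (induction n) (auto simp: algebra_simps)

lemma length_concat_replicate: "length (concat (replicate n l)) = n * length l"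
  by (induction n) auto

lemma avg_midlist:
  fixes f :: "nat \<Rightarrow> real"
  assumes "l \<noteq> []" "l' \<noteq> []"
  shows "avg (midlist l l') f = (avg l f + avg l' f) / 2"
proof -
  have "(b * A + a * B) / (b * a + a * b) = (A / a + B / b) / 2" if "0 < a" "0 < b" for a b A B :: real
  proof -
    have "A / a + B / b = (b * A + a * B) / (a * b)"
      using that by (simp add: add_frac_eq mult.commute)
    moreover have "b * a + a * b = 2 * (a * b)"
      by simp
    ultimately show ?thesis
      by simp
  qed
  from this[of "real (length l)" "real (length l')"] show ?thesis
    using assms by (simp add: avg_def midlist_def sum_list_concat_replicate length_concat_replicate)
qed

lemma set_midlist: "l \<noteq> [] \<Longrightarrow> l' \<noteq> [] \<Longrightarrow> set (midlist l l') = set l \<union> set l'"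
  by (auto simp: midlist_def)

lemma midlist_not_Nil: "l \<noteq> [] \<Longrightarrow> l' \<noteq> [] \<Longrightarrow> midlist l l' \<noteq> []"
  using set_midlist by fastforce

lemma avg_mono:
  fixes f g :: "nat \<Rightarrow> real"
  assumes "\<And>i. i \<in> set l \<Longrightarrow> f i \<le> g i"
  shows "avg l f \<le> avg l g"
  unfolding avg_def using assms by (auto intro!: divide_right_mono sum_list_mono)

lemma avg_const: "l \<noteq> [] \<Longrightarrow> avg l (\<lambda>_. c::real) = c"
  by (simp add: avg_def sum_list_triv)

lemma avg_add: "avg l (\<lambda>i. f i + g i) = avg l f + (avg l g)"
  by (simp add: avg_def sum_list_addf algebra_simps)

lemma avg_cmult: "avg l (\<lambda>i. c * f i) = c * (avg l f :: real)"
  by (simp add: avg_def sum_list_const_mult)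

lemma abs_avg_le: "\<bar>avg l f\<bar> \<le> avg l (\<lambda>i. \<bar>f i :: real\<bar>)"
  using sum_list_abs[of "map f l"] by (auto simp: avg_def abs_mult comp_def intro!: divide_right_mono)

text \<open>A stock of averaging lists that is closed under midpoints and still reaches beyond every
  index. Asking for smallness inside an arbitrary stock lets several conditions be imposed one after
  another.\<close>

definition adequate :: "nat list set \<Rightarrow> bool" where
  "adequate D \<longleftrightarrow> (\<forall>l\<in>D. l \<noteq> []) \<and> (\<forall>l\<in>D. \<forall>l'\<in>D. midlist l l' \<in> D) \<and>
     (\<forall>n. \<exists>l\<in>D. \<forall>i\<in>set l. n \<le> i)"

lemma adequateD:
  assumes "adequate D"
  shows adequate_not_Nil: "l \<in> D \<Longrightarrow> l \<noteq> []"
    and adequate_midlist: "l \<in> D \<Longrightarrow> l' \<in> D \<Longrightarrow> midlist l l' \<in> D"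
    and adequate_cofinal: "\<exists>l\<in>D. \<forall>i\<in>set l. n \<le> i"
  using assms by (auto simp: adequate_def)

text \<open>Quantifying over all adequate sets makes this property stable under finite unions.\<close>

definition negligible_family :: "('x \<Rightarrow> nat set) \<Rightarrow> 'x set \<Rightarrow> bool" where
  "negligible_family N U \<longleftrightarrow>
     (\<forall>D e. adequate D \<longrightarrow> 0 < e \<longrightarrow> (\<exists>l\<in>D. \<forall>x\<in>U. avg l (indicat_real (N x)) \<le> e))"

lemma adequate_tail: "adequate D \<Longrightarrow> adequate {l \<in> D. \<forall>i\<in>set l. n \<le> i}"
proof -
  assume D: "adequate D"
  have "\<exists>l. l \<in> D \<and> (\<forall>i\<in>set l. n \<le> i) \<and> (\<forall>i\<in>set l. m \<le> i)" for m
  proof -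
    obtain l where "l \<in> D" "\<forall>i\<in>set l. max m n \<le> i"
      using D unfolding adequate_def by meson
    then show ?thesis by auto
  qed
  then show ?thesis
    using D unfolding adequate_def by (auto simp: set_midlist)
qed

text \<open>Negligibility applied to the tails of \<open>D\<close> yields lists far out, and an
  upper bound on averages survives midpoints. A smallness condition can thus be built into the stock
  before the next one is treated.\<close>

lemma adequate_negligible_family:
  assumes D: "adequate D" and U: "negligible_family N U" and "0 < e"
  shows "adequate {l \<in> D. \<forall>x\<in>U. avg l (indicat_real (N x)) \<le> e}"
proof -
  have "\<exists>l. l \<in> D \<and> (\<forall>x\<in>U. avg l (indicat_real (N x)) \<le> e) \<and> (\<forall>i\<in>set l. n \<le> i)" for n
    using U adequate_tail[OF D, of n] \<open>0 < e\<close> unfolding negligible_family_def by fastforce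
  moreover have "avg (midlist l l') (indicat_real (N x)) \<le> e"
    if "l \<in> D" "l' \<in> D" "x \<in> U" "avg l (indicat_real (N x)) \<le> e" "avg l' (indicat_real (N x)) \<le> e" for l l' x
    using that D by (subst avg_midlist) (auto simp: adequate_def)
  ultimately show ?thesis
    using D unfolding adequate_def by auto
qed

lemma negligible_family_Un:
  assumes "negligible_family N U" "negligible_family N Y"
  shows "negligible_family N (U \<union> Y)"
  unfolding negligible_family_def
proof (intro allI impI)
  fix D and e :: real
  assume "adequate D" "0 < e"
  then have "adequate {l \<in> D. \<forall>x\<in>U. avg l (indicat_real (N x)) \<le> e}"
    using assms by (intro adequate_negligible_family)
  then show "\<exists>l\<in>D. \<forall>x\<in>U \<union> Y. avg l (indicat_real (N x)) \<le> e"
    using assms(2) \<open>0 < e\<close> unfolding negligible_family_def by blast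
qed

lemma negligible_family_empty: "negligible_family N {}"
  unfolding negligible_family_def adequate_def by auto

lemma negligible_family_UN:
  "finite I \<Longrightarrow> (\<And>i. i \<in> I \<Longrightarrow> negligible_family N (U i)) \<Longrightarrow> negligible_family N (\<Union>i\<in>I. U i)"
  by (induction I rule: finite_induct) (auto intro!: negligible_family_Un negligible_family_empty)

text \<open>A halving argument. Given a list \<open>l\<close> with some bound on \<open>U\<close>,
  the points \<open>x\<close> for which \<open>N x\<close> meets \<open>set l\<close> form a finite
  union of negligible families. Choose \<open>l'\<close> small on that union and no worse than
  \<open>l\<close> elsewhere. On the union \<open>l'\<close> is small, off the union
  \<open>l\<close> has average 0, so the midpoint halves the excess over \<open>e/2\<close>
  everywhere.\<close>

lemma negligible_family_step:
  assumes step: "\<And>m. n \<le> m \<Longrightarrow> negligible_family N {x \<in> U. m \<in> N x}"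
  shows "negligible_family N U"
  unfolding negligible_family_def
proof (intro allI impI)
  fix D and e :: real
  assume D: "adequate D" and e: "0 < e"
  have le1: "avg l (indicat_real A) \<le> 1" if "l \<noteq> []" for l A
    using avg_mono[of l "indicat_real A" "\<lambda>_. 1"] avg_const[OF that, of 1] by (simp add: indicator_def)
  have main: "\<exists>l\<in>D. \<forall>x\<in>U. avg l (indicat_real (N x)) \<le> e/2 + (1/2)^k"
    if "adequate D" "\<forall>l\<in>D. \<forall>i\<in>set l. n \<le> i" for k D
    using that
  proof (induction k arbitrary: D)
    case 0
    then obtain l where "l \<in> D" "l \<noteq> []"
      using adequate_not_Nil[of D] adequate_cofinal[of D] by metis
    moreover have "avg l (indicat_real (N x)) \<le> e/2 + (1/2)^0" for x
      using le1[OF \<open>l \<noteq> []\<close>, of "N x"] e by simp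
    ultimately show ?case
      by blast
  next
    case (Suc k)
    obtain l where l: "l \<in> D" "l \<noteq> []" "\<forall>x\<in>U. avg l (indicat_real (N x)) \<le> e/2 + (1/2)^k"
      using Suc.IH[OF Suc.prems] adequate_not_Nil[OF Suc.prems(1)] by metis
    define Y where "Y = (\<Union>m\<in>set l. {x \<in> U. m \<in> N x})"
    define D' where "D' = {l \<in> D. \<forall>x\<in>Y. avg l (indicat_real (N x)) \<le> e/2}"
    have Y: "negligible_family N Y"
      unfolding Y_def using Suc.prems l by (intro negligible_family_UN step) auto
    have "adequate D'"
      unfolding D'_def by (rule adequate_negligible_family[OF Suc.prems(1) Y]) (use e in simp)
    moreover have "\<forall>l\<in>D'. \<forall>i\<in>set l. n \<le> i"
      using Suc.prems(2) unfolding D'_def by blast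
    \<comment> \<open>The induction hypothesis is used a second time, now for \<open>D'\<close>;
      this is why \<open>D\<close> stays arbitrary in the induction.\<close>
    ultimately have "\<exists>l\<in>D'. \<forall>x\<in>U. avg l (indicat_real (N x)) \<le> e/2 + (1/2)^k"
      by (rule Suc.IH)
    then obtain l' where l': "l' \<in> D'" "\<forall>x\<in>U. avg l' (indicat_real (N x)) \<le> e/2 + (1/2)^k" ..
    have ne: "l' \<noteq> []"
      using adequate_not_Nil[OF Suc.prems(1)] l'(1) by (simp add: D'_def)
    have "avg (midlist l l') (indicat_real (N x)) \<le> e/2 + (1/2)^Suc k" if x: "x \<in> U" for x
    proof (cases "x \<in> Y")
      case True
      then have "avg l' (indicat_real (N x)) \<le> e/2"
        using l'(1) by (simp add: D'_def)
      then show ?thesis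
        using bspec[OF l(3) x] avg_midlist[OF l(2) ne, of "indicat_real (N x)"] by simp
    next
      case False
      then have "avg l (indicat_real (N x)) \<le> avg l (\<lambda>_. 0)"
        using x by (intro avg_mono) (auto simp: indicator_def Y_def)
      then show ?thesis
        using bspec[OF l'(2) x] e avg_midlist[OF l(2) ne, of "indicat_real (N x)"] avg_const[OF l(2), of 0]
        by simp
    qed
    moreover have "midlist l l' \<in> D"
      using adequate_midlist[OF Suc.prems(1) l(1)] l'(1) by (simp add: D'_def)
    ultimately show ?case
      by blast
  qed
  obtain k :: nat where "(1/2::real)^k < e/2"
    using real_arch_pow_inv[of "e/2" "1/2"] e by auto
  moreover have "\<exists>l\<in>{l \<in> D. \<forall>i\<in>set l. n \<le> i}. \<forall>x\<in>U. avg l (indicat_real (N x)) \<le> e/2 + (1/2)^k"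
    by (rule main[OF adequate_tail[OF D]]) simp
  ultimately show "\<exists>l\<in>D. \<forall>x\<in>U. avg l (indicat_real (N x)) \<le> e"
    by force
qed

text \<open>If \<open>U\<close> were not negligible, then arbitrarily late indices \<open>m\<close>
  would leave the subfamily of points with \<open>m \<in> N x\<close> not negligible either.
  Iterating this produces an infinite increasing sequence of indices whose initial segments all lie
  in a single \<open>N x\<close>, which \<open>chain\<close> forbids.\<close>

theorem ptak:
  fixes N :: "'x \<Rightarrow> nat set"
  assumes chain: "\<And>(m :: nat \<Rightarrow> nat) (x :: nat \<Rightarrow> 'x). strict_mono m \<Longrightarrow> (\<And>k. x k \<in> U) \<Longrightarrow> (\<And>k i. i < k \<Longrightarrow> m i \<in> N (x k)) \<Longrightarrow> False"
    and "0 < (e::real)"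
  obtains l where "l \<noteq> []" "\<forall>i\<in>set l. n \<le> i" "\<forall>x\<in>U. avg l (indicat_real (N x)) \<le> e"
proof -
  have "negligible_family N U"
  proof (rule ccontr)
    assume not_neg: "\<not> negligible_family N U"
    define bad where "bad t \<longleftrightarrow> \<not> negligible_family N {x \<in> U. set t \<subseteq> N x}" for t
    define ext where "ext t m \<longleftrightarrow> (\<forall>i\<in>set t. i < m) \<and> bad (m # t)" for t m
    have ext_ex: "\<exists>m. ext t m" if t: "bad t" for t
    proof -
      \<comment> \<open>\<open>Suc (sum_list t)\<close> exceeds every entry of \<open>t\<close>, so
        the indices chosen in succession increase strictly.\<close>
      obtain m where m: "Suc (sum_list t) \<le> m" "\<not> negligible_family N {x \<in> {x \<in> U. set t \<subseteq> N x}. m \<in> N x}"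
        using negligible_family_step[of "Suc (sum_list t)" N "{x \<in> U. set t \<subseteq> N x}"] t
        unfolding bad_def by auto
      have "{x \<in> {x \<in> U. set t \<subseteq> N x}. m \<in> N x} = {x \<in> U. set (m # t) \<subseteq> N x}"
        by auto
      then show ?thesis
        unfolding ext_def bad_def using m member_le_sum_list[of _ t] by (intro exI[of _ m]) fastforce
    qed
    define nxt where "nxt t = (SOME m. ext t m)" for t
    define T where "T = rec_nat [] (\<lambda>_ t. nxt t # t)"
    have T: "T 0 = []" "T (Suc k) = nxt (T k) # T k" for k
      by (auto simp: T_def)
    have bad: "bad (T k)" for k
    proof (induction k)
      case 0
      then show ?case using not_neg by (simp add: T bad_def)
    next
      case (Suc k)
      then show ?case
        unfolding T using someI_ex[OF ext_ex[OF Suc]] by (simp add: nxt_def ext_def)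
    qed
    define m where "m k = nxt (T k)" for k
    have lt: "\<forall>i\<in>set (T k). i < m k" for k
      using someI_ex[OF ext_ex[OF bad[of k]]] by (simp add: m_def nxt_def ext_def)
    have set_T: "set (T k) = m ` {..<k}" for k
      by (induction k) (auto simp: T m_def lessThan_Suc)
    have "strict_mono m"
      using lt by (auto simp: strict_mono_Suc_iff set_T)
    \<comment> \<open>The empty family is negligible, so each stage, not being negligible, contains
      a point realising the finite chain chosen so far.\<close>
    moreover have "\<exists>x. x \<in> U \<and> set (T k) \<subseteq> N x" for k
    proof (rule ccontr)
      assume "\<nexists>x. x \<in> U \<and> set (T k) \<subseteq> N x"
      then have "{x \<in> U. set (T k) \<subseteq> N x} = {}"
        by auto
      then show False
        using bad[of k] unfolding bad_def by (metis negligible_family_empty)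
    qed
    then obtain x where "\<And>k. x k \<in> U \<and> set (T k) \<subseteq> N (x k)"
      by metis
    ultimately show False
      using chain[of m x] by (auto simp: set_T)
  qed
  moreover have "adequate {l. l \<noteq> [] \<and> (\<forall>i\<in>set l. n \<le> i)}"
  proof -
    have "\<exists>l. l \<noteq> [] \<and> (\<forall>i\<in>set l. n \<le> i) \<and> (\<forall>i\<in>set l. k \<le> i)" for k
      by (rule exI[of _ "[max n k]"]) simp
    then show ?thesis
      unfolding adequate_def by (simp add: set_midlist midlist_not_Nil ball_Un)
  qed
  ultimately show ?thesis
    using that \<open>0 < e\<close> unfolding negligible_family_def by blast
qed

section \<open>The double limit property\<close>

lemma convergent_subseq_bounded:
  fixes s :: "nat \<Rightarrow> real"
  assumes "\<And>n. \<bar>s n\<bar> \<le> B"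
  obtains r l where "strict_mono r" "(\<lambda>n. s (r n)) \<longlonglongrightarrow> l"
proof -
  have "bounded (range s)"
    unfolding bounded_iff using assms by auto
  from bounded_imp_convergent_subsequence[OF this] show ?thesis
    using that by (auto simp: comp_def)
qed

lemma diagonal_convergent_subseq:
  fixes k :: "nat \<Rightarrow> nat \<Rightarrow> real"
  assumes "\<And>m n. \<bar>k m n\<bar> \<le> B m"
  obtains r where "strict_mono r" "\<And>m. convergent (\<lambda>n. k m (r n))"
proof -
  interpret subseqs "\<lambda>m s. convergent (\<lambda>n. k m (s n))"
  proof
    fix m and s :: "nat \<Rightarrow> nat"
    show "\<exists>r. strict_mono r \<and> convergent (\<lambda>n. k m ((s \<circ> r) n))"
      by (rule convergent_subseq_bounded[of "\<lambda>n. k m (s n)" "B m"]) (auto simp: assms convergent_def)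
  qed
  have "convergent (\<lambda>n. k m ((diagseq \<circ> (+) (Suc m)) n))" for m
    by (rule diagseq_holds) (auto simp: convergent_def comp_def intro: LIMSEQ_subseq_LIMSEQ[unfolded comp_def])
  then have "convergent (\<lambda>n. k m (diagseq (n + Suc m)))" for m
    by (simp add: comp_def add.commute[of _ m])
  then have "convergent (\<lambda>n. k m (diagseq n))" for m
    using convergent_ignore_initial_segment[of "\<lambda>n. k m (diagseq n)" "Suc m"] by simp
  then show ?thesis
    using that subseq_diagseq by blast
qed

text \<open>Four extractions: first the limits in \<open>n\<close> for each fixed \<open>m\<close>,
  then the limit of these, then the limits in \<open>m\<close> for each fixed \<open>n\<close>, then
  the limit of these. Later extractions preserve limits already obtained.\<close>

lemma double_limit_subseq:
  fixes k :: "nat \<Rightarrow> nat \<Rightarrow> real"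
  assumes B: "\<And>m n. \<bar>k m n\<bar> \<le> B"
  obtains r s u v a b where "strict_mono r" "strict_mono s"
    "\<And>n. (\<lambda>m. k (r n) (s m)) \<longlonglongrightarrow> u n" "u \<longlonglongrightarrow> a"
    "\<And>m. (\<lambda>n. k (r n) (s m)) \<longlonglongrightarrow> v m" "v \<longlonglongrightarrow> b"
proof -
  obtain r1 where r1: "strict_mono r1" "\<And>m. convergent (\<lambda>n. k (r1 n) m)"
    using diagonal_convergent_subseq[of "\<lambda>m n. k n m" "\<lambda>_. B"] B by blast
  then obtain v1 where v1: "\<And>m. (\<lambda>n. k (r1 n) m) \<longlonglongrightarrow> v1 m"
    unfolding convergent_def by metis
  have "\<bar>v1 m\<bar> \<le> B" for m
    using B by (intro tendsto_upperbound[OF tendsto_rabs[OF v1[of m]]]) auto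
  then obtain s1 b where s1: "strict_mono s1" "(\<lambda>m. v1 (s1 m)) \<longlonglongrightarrow> b"
    using convergent_subseq_bounded by metis
  obtain s2 where s2: "strict_mono s2" "\<And>n. convergent (\<lambda>m. k (r1 n) (s1 (s2 m)))"
    using diagonal_convergent_subseq[of "\<lambda>n m. k (r1 n) (s1 m)" "\<lambda>_. B"] B by blast
  then obtain u1 where u1: "\<And>n. (\<lambda>m. k (r1 n) (s1 (s2 m))) \<longlonglongrightarrow> u1 n"
    unfolding convergent_def by metis
  have "\<bar>u1 n\<bar> \<le> B" for n
    using B by (intro tendsto_upperbound[OF tendsto_rabs[OF u1[of n]]]) auto
  then obtain r2 a where r2: "strict_mono r2" "(\<lambda>n. u1 (r2 n)) \<longlonglongrightarrow> a"
    using convergent_subseq_bounded by metis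
  show ?thesis
  proof
    show "strict_mono (\<lambda>n. r1 (r2 n))" "strict_mono (\<lambda>n. s1 (s2 n))"
      using r1 r2 s1 s2 by (auto simp: strict_mono_def)
    show "(\<lambda>m. k (r1 (r2 n)) (s1 (s2 m))) \<longlonglongrightarrow> u1 (r2 n)" for n
      by (rule u1)
    show "(\<lambda>n. k (r1 (r2 n)) (s1 (s2 m))) \<longlonglongrightarrow> v1 (s1 (s2 m))" for m
      using LIMSEQ_subseq_LIMSEQ[OF v1 r2(1)] by (simp add: comp_def)
    show "(\<lambda>n. v1 (s1 (s2 n))) \<longlonglongrightarrow> b"
      using LIMSEQ_subseq_LIMSEQ[OF s1(2) s2(1)] by (simp add: comp_def)
  qed (use r2 in auto)
qed

text \<open>Grothendieck's interchange condition for a kernel; it plays the part of relative weak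
  compactness.\<close>

definition double_limit_property :: "('x \<Rightarrow> 'y \<Rightarrow> real) \<Rightarrow> 'x set \<Rightarrow> 'y set \<Rightarrow> bool" where
  "double_limit_property k U Y \<longleftrightarrow>
     (\<forall>(x :: nat \<Rightarrow> 'x) (y :: nat \<Rightarrow> 'y) u v a b.
        (\<forall>n. x n \<in> U) \<longrightarrow> (\<forall>m. y m \<in> Y) \<longrightarrow>
        (\<forall>n. (\<lambda>m. k (x n) (y m)) \<longlonglongrightarrow> u n) \<longrightarrow> u \<longlonglongrightarrow> a \<longrightarrow>
        (\<forall>m. (\<lambda>n. k (x n) (y m)) \<longlonglongrightarrow> v m) \<longrightarrow> v \<longlonglongrightarrow> b \<longrightarrow> a = b)"

lemma double_limit_propertyD:
  assumes "double_limit_property k U Y" "\<And>n. x n \<in> U" "\<And>m. y m \<in> Y"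
    "\<And>n. (\<lambda>m. k (x n) (y m)) \<longlonglongrightarrow> u n" "u \<longlonglongrightarrow> a"
    "\<And>m. (\<lambda>n. k (x n) (y m)) \<longlonglongrightarrow> v m" "v \<longlonglongrightarrow> b"
  shows "a = b"
  using assms unfolding double_limit_property_def by blast

lemma double_limit_property_swap:
  "double_limit_property k U Y \<Longrightarrow> double_limit_property (\<lambda>y x. k x y) Y U"
  unfolding double_limit_property_def by metis

text \<open>Existing limits survive thinning with the same outer values \<open>a\<close> and
  \<open>b\<close>, so their equality may be shown along subsequences chosen to suit the
  argument.\<close>

lemma double_limit_propertyI:
  assumes "\<And>x y u v a b. (\<And>n. x n \<in> U) \<Longrightarrow> (\<And>m. y m \<in> Y) \<Longrightarrow>
      (\<And>n. (\<lambda>m. k (x n) (y m)) \<longlonglongrightarrow> u n) \<Longrightarrow> u \<longlonglongrightarrow> a \<Longrightarrow>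
      (\<And>m. (\<lambda>n. k (x n) (y m)) \<longlonglongrightarrow> v m) \<Longrightarrow> v \<longlonglongrightarrow> b \<Longrightarrow>
      \<exists>r s. strict_mono (r :: nat \<Rightarrow> nat) \<and> strict_mono (s :: nat \<Rightarrow> nat) \<and>
        (\<forall>u v. (\<forall>n. (\<lambda>m. k (x (r n)) (y (s m))) \<longlonglongrightarrow> u n) \<longrightarrow> u \<longlonglongrightarrow> a \<longrightarrow>
           (\<forall>m. (\<lambda>n. k (x (r n)) (y (s m))) \<longlonglongrightarrow> v m) \<longrightarrow> v \<longlonglongrightarrow> b \<longrightarrow> a = b)"
  shows "double_limit_property k U Y"
  unfolding double_limit_property_def
proof (intro allI impI)
  fix x :: "nat \<Rightarrow> 'a" and y :: "nat \<Rightarrow> 'b" and u v a b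
  assume *: "\<forall>n. x n \<in> U" "\<forall>m. y m \<in> Y"
    and u: "\<forall>n. (\<lambda>m. k (x n) (y m)) \<longlonglongrightarrow> u n" "u \<longlonglongrightarrow> a"
    and v: "\<forall>m. (\<lambda>n. k (x n) (y m)) \<longlonglongrightarrow> v m" "v \<longlonglongrightarrow> b"
  obtain r s where rs: "strict_mono (r :: nat \<Rightarrow> nat)" "strict_mono (s :: nat \<Rightarrow> nat)"
    and eq: "\<And>u v. (\<forall>n. (\<lambda>m. k (x (r n)) (y (s m))) \<longlonglongrightarrow> u n) \<Longrightarrow> u \<longlonglongrightarrow> a \<Longrightarrow>
           (\<forall>m. (\<lambda>n. k (x (r n)) (y (s m))) \<longlonglongrightarrow> v m) \<Longrightarrow> v \<longlonglongrightarrow> b \<Longrightarrow> a = b"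
    using assms[of x y u a v b] * u v by blast
  show "a = b"
  proof (rule eq)
    show "\<forall>n. (\<lambda>m. k (x (r n)) (y (s m))) \<longlonglongrightarrow> u (r n)"
      using LIMSEQ_subseq_LIMSEQ[OF _ rs(2)] u(1) by (auto simp: comp_def)
    show "\<forall>m. (\<lambda>n. k (x (r n)) (y (s m))) \<longlonglongrightarrow> v (s m)"
      using LIMSEQ_subseq_LIMSEQ[OF _ rs(1)] v(1) by (auto simp: comp_def)
    show "(\<lambda>n. u (r n)) \<longlonglongrightarrow> a" "(\<lambda>n. v (s n)) \<longlonglongrightarrow> b"
      using LIMSEQ_subseq_LIMSEQ[OF u(2) rs(1)] LIMSEQ_subseq_LIMSEQ[OF v(2) rs(2)] by (auto simp: comp_def)
  qed
qed

lemma subseq_frequently: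
  assumes "frequently P sequentially"
  obtains r where "strict_mono (r :: nat \<Rightarrow> nat)" "\<And>n. P (r n)"
proof -
  have "infinite {n. P n}"
    using assms by (simp add: frequently_sequentially infinite_nat_iff_unbounded_le)
  then show ?thesis
    using infinite_enumerate[of "{n. P n}"] that by auto
qed

lemma double_limit_property_Un_right:
  assumes Y: "double_limit_property k U Y" and Z: "double_limit_property k U Z"
  shows "double_limit_property k U (Y \<union> Z)"
proof (rule double_limit_propertyI)
  fix x :: "nat \<Rightarrow> 'a" and y :: "nat \<Rightarrow> 'b" and u v a b
  assume x: "\<And>n. x n \<in> U" and y: "\<And>m. y m \<in> Y \<union> Z"
  have "(\<exists>\<^sub>F m in sequentially. y m \<in> Y) \<or> (\<exists>\<^sub>F m in sequentially. y m \<in> Z)"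
    unfolding frequently_disj_iff[symmetric] using y by (simp add: frequently_sequentially) blast
  then obtain s where s: "strict_mono (s :: nat \<Rightarrow> nat)" "(\<forall>m. y (s m) \<in> Y) \<or> (\<forall>m. y (s m) \<in> Z)"
    by (metis subseq_frequently)
  have "a = b" if "\<And>n. (\<lambda>m. k (x n) (y (s m))) \<longlonglongrightarrow> u n" "u \<longlonglongrightarrow> a"
    "\<And>m. (\<lambda>n. k (x n) (y (s m))) \<longlonglongrightarrow> v m" "v \<longlonglongrightarrow> b" for u v
    using s(2) double_limit_propertyD[OF Y x _ that] double_limit_propertyD[OF Z x _ that] by blast
  then show "\<exists>r s. strict_mono (r :: nat \<Rightarrow> nat) \<and> strict_mono (s :: nat \<Rightarrow> nat) \<and>
        (\<forall>u v. (\<forall>n. (\<lambda>m. k (x (r n)) (y (s m))) \<longlonglongrightarrow> u n) \<longrightarrow> u \<longlonglongrightarrow> a \<longrightarrow>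
           (\<forall>m. (\<lambda>n. k (x (r n)) (y (s m))) \<longlonglongrightarrow> v m) \<longrightarrow> v \<longlonglongrightarrow> b \<longrightarrow> a = b)"
    using s(1) by (intro exI[of _ "\<lambda>n. n"] exI[of _ s]) (auto simp: strict_mono_def)
qed

lemma double_limit_property_Un_left:
  "double_limit_property k U Z \<Longrightarrow> double_limit_property k Y Z \<Longrightarrow> double_limit_property k (U \<union> Y) Z"
  using double_limit_property_Un_right[of "\<lambda>y x. k x y" Z U Y] double_limit_property_swap[of k U Z]
    double_limit_property_swap[of k Y Z] double_limit_property_swap[of "\<lambda>y x. k x y" Z "U \<union> Y"] by simp

lemma double_limit_property_singleton: "double_limit_property k {x} Y"
  unfolding double_limit_property_def
proof (intro allI impI)
  fix f :: "nat \<Rightarrow> 'a" and y :: "nat \<Rightarrow> 'b" and u v a b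
  assume f: "\<forall>n. f n \<in> {x}"
    and u: "\<forall>n. (\<lambda>m. k (f n) (y m)) \<longlonglongrightarrow> u n" "u \<longlonglongrightarrow> a"
    and v: "\<forall>m. (\<lambda>n. k (f n) (y m)) \<longlonglongrightarrow> v m" "v \<longlonglongrightarrow> b"
  have f': "f = (\<lambda>_. x)"
    using f by auto
  have "v = (\<lambda>m. k x (y m))"
    using v(1) unfolding f' by (auto simp: tendsto_const_iff)
  then have "u n = b" for n
    using u(1)[unfolded f'] v(2) LIMSEQ_unique by blast
  then have "u = (\<lambda>_. b)"
    by auto
  then show "a = b"
    using u(2) by (simp add: LIMSEQ_const_iff)
qed

text \<open>This is where Ptak's lemma turns pointwise information into uniform information.\<close>

lemma small_averages:
  fixes f :: "nat \<Rightarrow> 'x \<Rightarrow> real"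
  assumes B: "\<And>m x. x \<in> U \<Longrightarrow> \<bar>f m x\<bar> \<le> B"
    and lim: "\<And>s x v c. strict_mono s \<Longrightarrow> (\<And>k. x k \<in> U) \<Longrightarrow>
        (\<And>m. (\<lambda>k. f (s m) (x k)) \<longlonglongrightarrow> v m) \<Longrightarrow> v \<longlonglongrightarrow> c \<Longrightarrow> c = 0"
    and "0 < e"
  obtains l where "l \<noteq> []" "\<forall>i\<in>set l. n \<le> i" "\<forall>x\<in>U. \<bar>avg l (\<lambda>i. f i x)\<bar> \<le> e"
proof -
  define N where "N x = {m. e/2 \<le> \<bar>f m x\<bar>}" for x
  define C where "C = \<bar>B\<bar> + 1"
  have C: "C > 0" "\<And>m x. x \<in> U \<Longrightarrow> \<bar>f m x\<bar> \<le> C"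
  proof -
    show "\<bar>f m x\<bar> \<le> C" if "x \<in> U" for m x
      using B[OF that, of m] by (simp add: C_def)
  qed (simp add: C_def)
  \<comment> \<open>A chain gives \<open>e/2 \<le> \<bar>f (m i) (x k)\<bar>\<close> whenever
    \<open>i < k\<close>. After extraction all inner limits in \<open>k\<close> have absolute value
    at least \<open>e/2\<close>, which contradicts the vanishing iterated limit.\<close>
  have chain: False if m: "strict_mono m" and x: "\<And>k. x k \<in> U" and N: "\<And>k i. i < k \<Longrightarrow> m i \<in> N (x k)"
    for m :: "nat \<Rightarrow> nat" and x
  proof -
    obtain r where r: "strict_mono r" "\<And>i. convergent (\<lambda>n. f (m i) (x (r n)))"
      using diagonal_convergent_subseq[of "\<lambda>i n. f (m i) (x n)" "\<lambda>_. C"] C x by blast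
    then obtain v where v: "\<And>i. (\<lambda>n. f (m i) (x (r n))) \<longlonglongrightarrow> v i"
      unfolding convergent_def by metis
    have "\<bar>v i\<bar> \<le> C" for i
      using C x by (intro tendsto_upperbound[OF tendsto_rabs[OF v[of i]]]) auto
    then obtain s c where s: "strict_mono s" "(\<lambda>i. v (s i)) \<longlonglongrightarrow> c"
      using convergent_subseq_bounded by metis
    have "e/2 \<le> \<bar>v i\<bar>" for i
    proof (rule tendsto_lowerbound[OF tendsto_rabs[OF v[of i]]])
      show "\<forall>\<^sub>F n in sequentially. e/2 \<le> \<bar>f (m i) (x (r n))\<bar>"
        using eventually_gt_at_top[of i]
      proof eventually_elim
        case (elim n)
        then have "i < r n"
          using seq_suble[OF r(1), of n] by simp
        then show ?case
          using N[of i "r n"] by (simp add: N_def)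
      qed
    qed auto
    then have "e/2 \<le> \<bar>c\<bar>"
      by (intro tendsto_lowerbound[OF tendsto_rabs[OF s(2)]]) auto
    moreover have "c = 0"
      using m s(1) by (intro lim[of "\<lambda>i. m (s i)" "\<lambda>n. x (r n)", OF _ x v s(2)]) (auto simp: strict_mono_def)
    ultimately show False
      using \<open>0 < e\<close> by simp
  qed
  \<comment> \<open>Terms outside \<open>N x\<close> contribute at most \<open>e/2\<close>; those in
    \<open>N x\<close> are bounded by \<open>C\<close>, so a share of \<open>e/(2*C)\<close> of them
    adds at most another \<open>e/2\<close>.\<close>
  obtain l where l: "l \<noteq> []" "\<forall>i\<in>set l. n \<le> i" "\<forall>x\<in>U. avg l (indicat_real (N x)) \<le> e/(2*C)"
    by (rule ptak[of U N "e/(2*C)" n, OF chain]) (use C(1) \<open>0 < e\<close> in auto)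
  have "\<bar>avg l (\<lambda>i. f i x)\<bar> \<le> e" if "x \<in> U" for x
  proof -
    have "\<bar>avg l (\<lambda>i. f i x)\<bar> \<le> avg l (\<lambda>i. \<bar>f i x\<bar>)"
      by (rule abs_avg_le)
    also have "\<dots> \<le> avg l (\<lambda>i. e/2 + C * indicat_real (N x) i)"
      using C(2)[OF that] C(1) \<open>0 < e\<close> by (intro avg_mono) (auto simp: N_def indicator_def add_increasing)
    also have "\<dots> = e/2 + C * avg l (indicat_real (N x))"
      by (simp only: avg_add avg_cmult avg_const[OF l(1)])
    also have "\<dots> \<le> e/2 + C * (e/(2*C))"
      using l(3) that C by (intro add_left_mono mult_left_mono) auto
    finally show ?thesis
      using C by (simp add: field_simps)
  qed
  then show ?thesis
    using l that by blast
qed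

section \<open>Double limits under convex hulls, and uniform approximation by convex
  combinations\<close>

abbreviation dlp :: "'a::real_normed_vector set \<Rightarrow> ('a \<Rightarrow>\<^sub>L real) set \<Rightarrow> bool" where
  "dlp \<equiv> double_limit_property (\<lambda>x h. blinfun_apply h x)"

lemma avg_in_convex:
  assumes "convex A" "l \<noteq> []" "\<And>i. i \<in> set l \<Longrightarrow> f i \<in> A"
  shows "avg l f \<in> A"
proof -
  have "avg l f = (\<Sum>j<length l. (1 / real (length l)) *\<^sub>R f (l ! j))"
    by (simp add: avg_def sum_list_sum_nth scaleR_right.sum atLeast0LessThan)
  also have "\<dots> \<in> A"
    using assms by (intro convex_sum) auto
  finally show ?thesis .
qed

lemma blinfun_apply_avg: "blinfun_apply (avg l h) x = avg l (\<lambda>i. blinfun_apply (h i) x)"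
proof -
  have "blinfun_apply (\<Sum>i\<leftarrow>l. h i) x = (\<Sum>i\<leftarrow>l. blinfun_apply (h i) x)"
    by (induction l) (auto simp: blinfun.add_left)
  then show ?thesis
    by (simp add: avg_def blinfun.scaleR_left)
qed

lemma avg_cong: "(\<And>i. i \<in> set l \<Longrightarrow> f i = g i) \<Longrightarrow> avg l f = avg l g"
  unfolding avg_def by (metis map_cong)

lemma avg_diff_const: "l \<noteq> [] \<Longrightarrow> avg l (\<lambda>i. f i - c) = avg l f - (c::real)"
  using avg_add[of l f "\<lambda>_. - c"] avg_const[of l "- c"] by simp

lemma tendsto_avg:
  assumes "\<And>i. (\<lambda>m. F m i) \<longlonglongrightarrow> (G i :: real)"
  shows "(\<lambda>m. avg l (F m)) \<longlonglongrightarrow> avg l G"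
proof -
  have "(\<lambda>m. \<Sum>i\<leftarrow>l. F m i) \<longlonglongrightarrow> (\<Sum>i\<leftarrow>l. G i)"
    by (induction l) (auto intro!: tendsto_intros assms)
  then show ?thesis
    unfolding avg_def by (intro tendsto_intros)
qed

text \<open>Thin \<open>x\<close> so that each relevant \<open>g \<in> Y\<close> has a limit
  \<open>L g\<close> along it. Ptak averages of the values \<open>g (x' i)\<close> are then close to
  \<open>L g\<close> uniformly in \<open>g\<close>. Closeness to the limit is a convex condition on
  \<open>g\<close>, so it passes to every \<open>h m\<close>; letting \<open>m\<close> tend to
  infinity puts one fixed average of the numbers \<open>u (r i)\<close> near both \<open>a\<close>
  and \<open>b\<close>.\<close>

lemma double_limit_property_convex_hull:
  fixes U :: "'a::real_normed_vector set"
  assumes dl: "dlp U Y" and B: "\<And>x h. x \<in> U \<Longrightarrow> h \<in> Y \<Longrightarrow> \<bar>blinfun_apply h x\<bar> \<le> B"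
  shows "dlp U (convex hull Y)"
  unfolding double_limit_property_def
proof (intro allI impI)
  fix x :: "nat \<Rightarrow> 'a" and h :: "nat \<Rightarrow> 'a \<Rightarrow>\<^sub>L real" and u v a b
  assume x: "\<forall>n. x n \<in> U" and h: "\<forall>m. h m \<in> convex hull Y"
    and u: "\<forall>n. (\<lambda>m. h m (x n)) \<longlonglongrightarrow> u n" "u \<longlonglongrightarrow> a"
    and v: "\<forall>m. (\<lambda>n. h m (x n)) \<longlonglongrightarrow> v m" "v \<longlonglongrightarrow> b"
  \<comment> \<open>Each \<open>h m\<close> involves finitely many elements of \<open>Y\<close>, so
    a countable \<open>Y0\<close> serves the whole sequence; the diagonal extraction requires
    this.\<close>
  have "\<exists>S. finite S \<and> S \<subseteq> Y \<and> S \<noteq> {} \<and> h m \<in> convex hull S" for m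
  proof -
    have "h m \<in> convex hull Y"
      using h by simp
    then obtain S t where S: "finite S" "S \<subseteq> Y" "\<forall>x\<in>S. 0 \<le> t x" "sum t S = 1" "(\<Sum>v\<in>S. t v *\<^sub>R v) = h m"
      unfolding convex_hull_explicit by blast
    moreover have "S \<noteq> {}"
      using S(4) by auto
    moreover have "h m \<in> convex hull S"
      unfolding convex_hull_finite[OF S(1)] using S by blast
    ultimately show ?thesis
      by blast
  qed
  then obtain S where S: "\<And>m. finite (S m)" "\<And>m. S m \<subseteq> Y" "\<And>m. S m \<noteq> {}" "\<And>m. h m \<in> convex hull S m"
    by metis
  define Y0 where "Y0 = (\<Union>m. S m)"
  have Y0: "countable Y0" "Y0 \<noteq> {}" "Y0 \<subseteq> Y"
    using S by (auto simp: Y0_def countable_finite)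
  have h0: "h m \<in> convex hull Y0" for m
    using S(4)[of m] hull_mono[of "S m" Y0 convex] by (auto simp: Y0_def)
  obtain r where r: "strict_mono r" "\<And>j. convergent (\<lambda>n. from_nat_into Y0 j (x (r n)))"
    using diagonal_convergent_subseq[of "\<lambda>j n. from_nat_into Y0 j (x n)" "\<lambda>_. B"]
      B x from_nat_into[OF Y0(2)] Y0(3) by (metis subsetD)
  define x' where "x' n = x (r n)" for n
  define L where "L g = lim (\<lambda>n. blinfun_apply g (x' n))" for g :: "'a \<Rightarrow>\<^sub>L real"
  have L: "(\<lambda>n. blinfun_apply g (x' n)) \<longlonglongrightarrow> L g" if "g \<in> Y0" for g
    using r(2)[of "to_nat_on Y0 g"] that Y0(1) by (simp add: L_def x'_def convergent_LIMSEQ_iff)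
  have L_eqI: "L g = c" if "(\<lambda>n. blinfun_apply g (x' n)) \<longlonglongrightarrow> c" for g c
    using that by (simp add: L_def limI)
  have L_bound: "\<bar>L g\<bar> \<le> B" if "g \<in> Y0" for g
    using B x Y0(3) that by (intro tendsto_upperbound[OF tendsto_rabs[OF L]]) (auto simp: x'_def)
  have close: "\<bar>a - b\<bar> \<le> 2 * e" if "0 < e" for e
  proof -
    have "(\<lambda>i. u (r i)) \<longlonglongrightarrow> a"
      using LIMSEQ_subseq_LIMSEQ[OF u(2) r(1)] by (simp add: comp_def)
    then obtain n0 where n0: "\<And>i. n0 \<le> i \<Longrightarrow> \<bar>u (r i) - a\<bar> \<le> e"
      using \<open>0 < e\<close> by (metis LIMSEQ_iff less_imp_le real_norm_def)
    have "\<bar>blinfun_apply g (x' i) - L g\<bar> \<le> B + B" if "g \<in> Y0" for i g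
      using B[of "x' i" g] x L_bound[OF that] that Y0(3) unfolding x'_def by fastforce
    \<comment> \<open>Along a subsequence where \<open>L (g k)\<close> tends to some
      \<open>p\<close>, the two iterated limits of \<open>g k (x' (s m))\<close> are
      \<open>c + p\<close> and \<open>p\<close>, and the interchange on \<open>Y\<close> equates
      them.\<close>
    moreover have "c = 0"
      if s: "strict_mono s" and g: "\<And>k. g k \<in> Y0" 
        and w: "\<And>m. (\<lambda>k. blinfun_apply (g k) (x' (s m)) - L (g k)) \<longlonglongrightarrow> w m" "w \<longlonglongrightarrow> c"
      for s :: "nat \<Rightarrow> nat" and g :: "nat \<Rightarrow> 'a \<Rightarrow>\<^sub>L real" and w c
    proof -
      obtain t p where t: "strict_mono t" "(\<lambda>k. L (g (t k))) \<longlonglongrightarrow> p"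
        using convergent_subseq_bounded[of "\<lambda>k. L (g k)" B] L_bound g by blast
      have "c + p = p"
      proof (rule double_limit_propertyD[OF dl, of "\<lambda>n. x' (s n)" "\<lambda>k. g (t k)"])
        show "x' (s n) \<in> U" "g (t n) \<in> Y" for n
          using x g Y0 by (auto simp: x'_def)
        show "(\<lambda>m. g (t m) (x' (s n))) \<longlonglongrightarrow> w n + p" for n
          using tendsto_add[OF LIMSEQ_subseq_LIMSEQ[OF w(1) t(1)] t(2)] by (simp add: comp_def)
        show "(\<lambda>n. w n + p) \<longlonglongrightarrow> c + p"
          using w(2) by (intro tendsto_intros)
        show "(\<lambda>n. g (t m) (x' (s n))) \<longlonglongrightarrow> L (g (t m))" for m
          using LIMSEQ_subseq_LIMSEQ[OF L[OF g] s] by (simp add: comp_def)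
      qed (rule t)
      then show ?thesis by simp
    qed
    ultimately obtain l where l: "l \<noteq> []" "\<forall>i\<in>set l. n0 \<le> i"
      "\<forall>g\<in>Y0. \<bar>avg l (\<lambda>i. blinfun_apply g (x' i) - L g)\<bar> \<le> e"
      using small_averages[of Y0 "\<lambda>i g. blinfun_apply g (x' i) - L g" "B + B" e n0] \<open>0 < e\<close> by blast
    \<comment> \<open>Convergence is part of \<open>Z\<close> because \<open>L\<close> is defined by
      \<open>lim\<close>, and its additivity is available only where limits exist.\<close>
    define Z where "Z = {g. (\<lambda>n. blinfun_apply g (x' n)) \<longlonglongrightarrow> L g \<and> \<bar>avg l (\<lambda>i. blinfun_apply g (x' i)) - L g\<bar> \<le> e}"
    have "convex Z"
    proof (rule convexI)
      fix g1 g2 and c1 c2 :: real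
      assume g: "g1 \<in> Z" "g2 \<in> Z" and c: "0 \<le> c1" "0 \<le> c2" "c1 + c2 = 1"
      let ?g = "c1 *\<^sub>R g1 + c2 *\<^sub>R g2"
      have app: "blinfun_apply ?g y = c1 * blinfun_apply g1 y + c2 * blinfun_apply g2 y" for y
        by (simp add: blinfun.add_left blinfun.scaleR_left)
      have lim: "(\<lambda>n. blinfun_apply ?g (x' n)) \<longlonglongrightarrow> c1 * L g1 + c2 * L g2"
        unfolding app using g by (intro tendsto_intros) (auto simp: Z_def)
      have "avg l (\<lambda>i. blinfun_apply ?g (x' i)) - L ?g =
          c1 * (avg l (\<lambda>i. blinfun_apply g1 (x' i)) - L g1) + c2 * (avg l (\<lambda>i. blinfun_apply g2 (x' i)) - L g2)"
        unfolding L_eqI[OF lim] unfolding app avg_add avg_cmult by (simp add: algebra_simps)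
      also have "\<bar>\<dots>\<bar> \<le> c1 * e + c2 * e"
        using g c by (intro order_trans[OF abs_triangle_ineq] add_mono) (auto simp: Z_def abs_mult intro: mult_left_mono)
      finally show "?g \<in> Z"
        using lim L_eqI[OF lim] c by (simp add: Z_def distrib_right[symmetric])
    qed
    moreover have "Y0 \<subseteq> Z"
      using l L by (auto simp: Z_def avg_diff_const)
    ultimately have "h m \<in> Z" for m
      using h0[of m] hull_minimal[of Y0 Z convex] by auto
    moreover have "L (h m) = v m" for m
      using LIMSEQ_subseq_LIMSEQ[OF spec[OF v(1)] r(1)] by (intro L_eqI) (simp add: comp_def x'_def)
    ultimately have hm: "\<bar>avg l (\<lambda>i. h m (x' i)) - v m\<bar> \<le> e" for m
      by (simp add: Z_def)
    have "(\<lambda>m. avg l (\<lambda>i. h m (x' i)) - v m) \<longlonglongrightarrow> avg l (\<lambda>i. u (r i)) - b"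
      using u(1) by (intro tendsto_intros tendsto_avg v) (simp add: x'_def)
    then have 1: "\<bar>avg l (\<lambda>i. u (r i)) - b\<bar> \<le> e"
      using hm by (intro tendsto_upperbound[OF tendsto_rabs]) auto
    have "\<bar>avg l (\<lambda>i. u (r i) - a)\<bar> \<le> avg l (\<lambda>i. \<bar>u (r i) - a\<bar>)"
      by (rule abs_avg_le)
    also have "\<dots> \<le> avg l (\<lambda>_. e)"
      using n0 l(2) by (intro avg_mono) auto
    finally have 2: "\<bar>avg l (\<lambda>i. u (r i)) - a\<bar> \<le> e"
      by (simp add: avg_const[OF l(1)] avg_diff_const[OF l(1)])
    show ?thesis
      using 1 2 by linarith
  qed
  show "a = b"
  proof (rule ccontr)
    assume "a \<noteq> b"
    then show False
      using close[of "\<bar>a - b\<bar> / 4"] by simp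
  qed
qed

text \<open>Suppose every \<open>h \<in> A\<close> has a witness \<open>w h\<close> where it misses
  \<open>\<phi>\<close> by more than \<open>e\<close>. Choose a sequence in \<open>A\<close> whose
  members approximate \<open>\<phi>\<close> at the witnesses of all averages of earlier members. It
  converges to \<open>\<phi>\<close> at each witness of its averages, so Ptak's lemma yields one
  average that is uniformly close to \<open>\<phi>\<close> on all these witnesses, its own
  included.\<close>

lemma double_limit_property_uniform_approximation:
  fixes U :: "'a::real_normed_vector set"
  assumes A: "convex A" and dl: "dlp U A"
    and B: "\<And>x h. x \<in> U \<Longrightarrow> h \<in> A \<Longrightarrow> \<bar>blinfun_apply h x\<bar> \<le> B"
    and \<phi>: "\<And>S e. finite S \<Longrightarrow> S \<subseteq> U \<Longrightarrow> 0 < e \<Longrightarrow> \<exists>h\<in>A. \<forall>x\<in>S. \<bar>blinfun_apply h x - \<phi> x\<bar> < e"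
    and "0 < e"
  shows "\<exists>h\<in>A. \<forall>x\<in>U. \<bar>blinfun_apply h x - \<phi> x\<bar> \<le> e"
proof (rule ccontr)
  assume "\<not> ?thesis"
  then obtain w where w: "\<And>h. h \<in> A \<Longrightarrow> w h \<in> U \<and> e < \<bar>blinfun_apply h (w h) - \<phi> (w h)\<bar>"
    by (metis not_le)
  \<comment> \<open>Each \<open>LL n\<close> is finite, yet every nonempty list of indices lies in
    \<open>LL n\<close> for all large \<open>n\<close>; so every average of the sequence is
    eventually taken into account.\<close>
  define LL where "LL n = {l. set l \<subseteq> {..<n} \<and> length l \<le> n} - {[] :: nat list}" for n
  have LL: "finite (LL n)" for n
    unfolding LL_def by (intro finite_Diff finite_lists_length_le) simp
  define P where "P f n r \<longleftrightarrow> r \<in> A \<and> (\<forall>l\<in>LL n. \<bar>blinfun_apply r (w (avg l f)) - \<phi> (w (avg l f))\<bar> < inverse (real (Suc n)))" for f n r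
  have "\<exists>h. \<forall>n. P h n (h n)"
  proof (rule dependent_wellorder_choice)
    fix r and f g :: "nat \<Rightarrow> 'a \<Rightarrow>\<^sub>L real" and n
    assume "\<And>k. k < n \<Longrightarrow> f k = g k"
    then have "avg l f = avg l g" if "l \<in> LL n" for l
      using that by (intro avg_cong) (auto simp: LL_def)
    then show "P f n r = P g n r"
      unfolding P_def by auto
  next
    fix n and f :: "nat \<Rightarrow> 'a \<Rightarrow>\<^sub>L real"
    assume f: "\<And>k. k < n \<Longrightarrow> P f k (f k)"
    have "avg l f \<in> A" if "l \<in> LL n" for l
      using that f by (intro avg_in_convex A) (auto simp: LL_def P_def)
    then show "\<exists>r. P f n r"
      using \<phi>[of "(\<lambda>l. w (avg l f)) ` LL n" "inverse (real (Suc n))"] LL[of n] w unfolding P_def by auto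
  qed
  then obtain h where h: "\<And>n. P h n (h n)"
    by blast
  then have hA: "h n \<in> A" for n
    by (simp add: P_def)
  define X0 where "X0 = (\<lambda>l. w (avg l h)) ` {l. l \<noteq> []}"
  have X0: "X0 \<subseteq> U"
    using w avg_in_convex[OF A] hA by (auto simp: X0_def)
  have lim: "(\<lambda>n. h n x) \<longlonglongrightarrow> \<phi> x" if x0: "x \<in> X0" for x
  proof -
    obtain l where l: "l \<noteq> []" "x = w (avg l h)"
      using x0 by (auto simp: X0_def)
    define n0 where "n0 = max (length l) (Suc (sum_list l))"
    have "l \<in> LL n" if "n0 \<le> n" for n
      using that l(1) member_le_sum_list[of _ l] by (fastforce simp: LL_def n0_def)
    then have "\<bar>h n x - \<phi> x\<bar> < inverse (real (Suc n))" if "n0 \<le> n" for n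
      using h[of n] that unfolding P_def l(2) by blast
    then have "\<forall>\<^sub>F n in sequentially. norm (h n x - \<phi> x) \<le> inverse (real (Suc n))"
      using eventually_sequentially by (auto intro: less_imp_le)
    then show ?thesis
      by (intro LIM_zero_cancel[OF Lim_null_comparison[OF _ LIMSEQ_inverse_real_of_nat]])
  qed
  have \<phi>_bound: "\<bar>\<phi> x\<bar> \<le> B" if "x \<in> X0" for x
    using B X0 hA that by (intro tendsto_upperbound[OF tendsto_rabs[OF lim]]) auto
  have bound: "\<bar>h n x - \<phi> x\<bar> \<le> B + B" if "x \<in> X0" for n x
    using B[of x "h n"] hA X0 \<phi>_bound[OF that] that by fastforce
  have null: "c = 0"
    if s: "strict_mono s" and x: "\<And>k. x k \<in> X0"
      and v: "\<And>m. (\<lambda>k. h (s m) (x k) - \<phi> (x k)) \<longlonglongrightarrow> v m" "v \<longlonglongrightarrow> c"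
    for s :: "nat \<Rightarrow> nat" and x :: "nat \<Rightarrow> 'a" and v c
  proof -
    obtain t p where t: "strict_mono t" "(\<lambda>k. \<phi> (x (t k))) \<longlonglongrightarrow> p"
      using convergent_subseq_bounded[of "\<lambda>k. \<phi> (x k)" B] \<phi>_bound x by blast
    have "p = c + p"
    proof (rule double_limit_propertyD[OF dl, of "\<lambda>k. x (t k)" "\<lambda>m. h (s m)"])
      show "x (t n) \<in> U" "h (s n) \<in> A" for n
        using x X0 hA by auto
      show "(\<lambda>m. h (s m) (x (t n))) \<longlonglongrightarrow> \<phi> (x (t n))" for n
        using LIMSEQ_subseq_LIMSEQ[OF lim[OF x] s] by (simp add: comp_def)
      show "(\<lambda>n. h (s m) (x (t n))) \<longlonglongrightarrow> v m + p" for m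
        using tendsto_add[OF LIMSEQ_subseq_LIMSEQ[OF v(1) t(1)] t(2)] by (simp add: comp_def)
      show "(\<lambda>n. v n + p) \<longlonglongrightarrow> c + p"
        using v(2) by (intro tendsto_intros)
    qed (rule t)
    then show ?thesis by simp
  qed
  obtain l where l: "l \<noteq> []" "\<forall>x\<in>X0. \<bar>avg l (\<lambda>i. h i x - \<phi> x)\<bar> \<le> e"
    by (rule small_averages[of X0 "\<lambda>i x. h i x - \<phi> x" "B + B" e 0, OF bound null \<open>0 < e\<close>])
  have "avg l h \<in> A"
    using hA l(1) by (intro avg_in_convex A)
  moreover have "w (avg l h) \<in> X0"
    using l(1) by (auto simp: X0_def)
  ultimately show False
    using w[of "avg l h"] l by (fastforce simp: blinfun_apply_avg avg_diff_const)
qed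

section \<open>The Hahn-Banach theorem\<close>

text \<open>
  Linear functionals dominated by \<open>p\<close> are treated as linear subspaces of \<open>'v \<times> real\<close>
  on which \<open>r \<le> p x\<close>; such a subspace is automatically single-valued.
\<close>

theorem hahn_banach:
  fixes p f :: "'v::real_vector \<Rightarrow> real"
  assumes S: "subspace S" and T: "subspace T" and "S \<subseteq> T"
    and p_add: "\<And>x y. x \<in> T \<Longrightarrow> y \<in> T \<Longrightarrow> p (x + y) \<le> p x + p y"
    and p_scale: "\<And>c x. 0 < c \<Longrightarrow> x \<in> T \<Longrightarrow> p (c *\<^sub>R x) = c * p x"
    and f_add: "\<And>x y. x \<in> S \<Longrightarrow> y \<in> S \<Longrightarrow> f (x + y) = f x + f y"
    and f_scale: "\<And>c x. x \<in> S \<Longrightarrow> f (c *\<^sub>R x) = c * f x"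
    and f_le: "\<And>x. x \<in> S \<Longrightarrow> f x \<le> p x"
  obtains F where "\<And>x y. x \<in> T \<Longrightarrow> y \<in> T \<Longrightarrow> F (x + y) = F x + F y"
    "\<And>c x. x \<in> T \<Longrightarrow> F (c *\<^sub>R x) = c * F x"
    "\<And>x. x \<in> S \<Longrightarrow> F x = f x" "\<And>x. x \<in> T \<Longrightarrow> F x \<le> p x"
proof -
  define \<A> where "\<A> = {g :: ('v \<times> real) set. subspace g \<and> (\<lambda>x. (x, f x)) ` S \<subseteq> g \<and> (\<forall>(x, r)\<in>g. x \<in> T \<and> r \<le> p x)}"
  have "subspace ((\<lambda>x. (x, f x)) ` S)"
  proof (rule subspaceI)
    have "f 0 = 0"
      using f_scale[OF subspace_0[OF S], of 0] by simp
    then show "0 \<in> (\<lambda>x. (x, f x)) ` S"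
      using subspace_0[OF S] by (auto simp: zero_prod_def intro!: image_eqI)
  next
    fix u v
    assume "u \<in> (\<lambda>x. (x, f x)) ` S" "v \<in> (\<lambda>x. (x, f x)) ` S"
    then show "u + v \<in> (\<lambda>x. (x, f x)) ` S"
      using subspace_add[OF S] f_add by (auto intro!: image_eqI)
  next
    fix u and c :: real
    assume "u \<in> (\<lambda>x. (x, f x)) ` S"
    then show "c *\<^sub>R u \<in> (\<lambda>x. (x, f x)) ` S"
      using subspace_scale[OF S] f_scale by (auto intro!: image_eqI)
  qed
  then have "(\<lambda>x. (x, f x)) ` S \<in> \<A>"
    using f_le \<open>S \<subseteq> T\<close> by (auto simp: \<A>_def)
  moreover have "\<Union>\<C> \<in> \<A>" if ne: "\<C> \<noteq> {}" and chain: "subset.chain \<A> \<C>" for \<C>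
  proof -
    have sub: "\<C> \<subseteq> \<A>"
      using chain by (auto simp: subset.chain_def)
    have "subspace (\<Union>\<C>)"
    proof (rule subspaceI)
      show "0 \<in> \<Union>\<C>"
        using ne sub subspace_0 unfolding \<A>_def by blast
    next
      fix u v
      assume "u \<in> \<Union>\<C>" "v \<in> \<Union>\<C>"
      then obtain A B where "A \<in> \<C>" "B \<in> \<C>" "u \<in> A" "v \<in> B"
        by blast
      then have "\<exists>D\<in>\<C>. u \<in> D \<and> v \<in> D"
        using chain unfolding subset.chain_def by blast
      then show "u + v \<in> \<Union>\<C>"
        using sub subspace_add unfolding \<A>_def by blast
    next
      fix u and c :: real
      assume "u \<in> \<Union>\<C>"
      then show "c *\<^sub>R u \<in> \<Union>\<C>"
        using sub subspace_scale unfolding \<A>_def by blast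
    qed
    then show ?thesis
      using ne sub unfolding \<A>_def by blast
  qed
  ultimately obtain M where M: "M \<in> \<A>" and max: "\<And>U. U \<in> \<A> \<Longrightarrow> M \<subseteq> U \<Longrightarrow> U = M"
    using subset_Zorn_nonempty[of \<A>] by blast
  have sM: "subspace M" and fM: "\<And>x. x \<in> S \<Longrightarrow> (x, f x) \<in> M"
    and MT: "\<And>x r. (x, r) \<in> M \<Longrightarrow> x \<in> T" and Mp: "\<And>x r. (x, r) \<in> M \<Longrightarrow> r \<le> p x"
    using M by (auto simp: \<A>_def)
  have M_scale: "(c *\<^sub>R x, c * r) \<in> M" if "(x, r) \<in> M" for c x r
    using subspace_scale[OF sM that, of c] by simp
  have M_add: "(x + y, r + s) \<in> M" if "(x, r) \<in> M" "(y, s) \<in> M" for x y r s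
    using subspace_add[OF sM that] by simp
  \<comment> \<open>Single-valuedness: \<open>r\<close> and \<open>- r\<close> both lie over 0, and
    \<open>p 0\<close> vanishes by positive homogeneity.\<close>
  have M_zero: "r = 0" if "(0, r) \<in> M" for r
  proof -
    have "p 0 = 0"
      using p_scale[of 2 0] subspace_0[OF T] by simp
    then show ?thesis
      using Mp[OF that] Mp[OF M_scale[OF that, of "-1"]] by simp
  qed
  have total: "\<exists>r. (z, r) \<in> M" if z: "z \<in> T" for z
  proof (rule ccontr)
    assume none: "\<nexists>r. (z, r) \<in> M"
    define L where "L = (\<lambda>(y, s). s - p (y - z)) ` M"
    have bound: "s - p (y - z) \<le> p (y' + z) - s'" if "(y, s) \<in> M" "(y', s') \<in> M" for y s y' s'
    proof -
      have "s + s' \<le> p ((y - z) + (y' + z))"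
        using Mp[OF M_add[OF that]] by simp
      also have "\<dots> \<le> p (y - z) + p (y' + z)"
        using that MT z T by (intro p_add) (auto intro: subspace_diff subspace_add)
      finally show ?thesis by simp
    qed
    have M0: "(0, 0) \<in> M"
      using subspace_0[OF sM] by (simp add: zero_prod_def)
    \<comment> \<open>A value at \<open>z\<close> is admissible if it lies above all
      \<open>s - p (y - z)\<close> and below all \<open>p (y + z) - s\<close>; by
      \<open>bound\<close> the supremum of the lower bounds qualifies.\<close>
    define a where "a = Sup L"
    have bdd: "bdd_above L"
      using bound[OF _ M0] by (auto simp: L_def intro!: bdd_aboveI2)
    have a1: "s - p (y - z) \<le> a" if "(y, s) \<in> M" for y s
      unfolding a_def using that by (intro cSup_upper bdd) (auto simp: L_def image_iff intro!: bexI[of _ "(y, s)"])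
    have a2: "a \<le> p (y + z) - s" if "(y, s) \<in> M" for y s
      unfolding a_def using M0 bound[OF _ that] by (intro cSup_least) (auto simp: L_def)
    define M' where "M' = span (insert (z, a) M)"
    have "x \<in> T \<and> t \<le> p x" if xt: "(x, t) \<in> M'" for x t
    proof -
      obtain k where k: "(x - k *\<^sub>R z, t - k * a) \<in> M"
        using xt span_breakdown_eq[of "(x, t)" "(z, a)" M] span_eq_iff[THEN iffD2, OF sM] by (auto simp: M'_def)
      have xT: "x \<in> T"
        using subspace_add[OF T MT[OF k] subspace_scale[OF T z, of k]] by simp
      have "t \<le> p x"
      proof (cases k "0 :: real" rule: linorder_cases)
        case equal
        then show ?thesis using Mp[OF k] by simp
      next
        case greater
        let ?y = "(1/k) *\<^sub>R (x - k *\<^sub>R z)"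
        have "k * (a + (1/k) * (t - k * a)) \<le> k * p (?y + z)"
          using a2[OF M_scale[OF k, of "1/k"]] greater by (intro mult_left_mono) auto
        also have "k * p (?y + z) = p (k *\<^sub>R (?y + z))"
          using greater MT[OF M_scale[OF k, of "1/k"]] z T by (intro p_scale[symmetric]) (auto intro: subspace_add)
        finally show ?thesis
          using greater by (simp add: algebra_simps)
      next
        case less
        let ?y = "(1/(-k)) *\<^sub>R (x - k *\<^sub>R z)"
        have "(-k) * ((1/(-k)) * (t - k * a) - a) \<le> (-k) * p (?y - z)"
          using a1[OF M_scale[OF k, of "1/(-k)"]] less by (intro mult_left_mono) auto
        also have "(-k) * p (?y - z) = p ((-k) *\<^sub>R (?y - z))"
          using less MT[OF M_scale[OF k, of "1/(-k)"]] z T by (intro p_scale[symmetric]) (auto intro: subspace_diff)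
        finally show ?thesis
          using less by (simp add: algebra_simps)
      qed
      then show ?thesis
        using xT by blast
    qed
    moreover have "M \<subseteq> M'" "(z, a) \<in> M'"
      unfolding M'_def by (auto intro: span_base)
    ultimately have "M' \<in> \<A>"
      using M by (auto simp: \<A>_def M'_def)
    then show False
      using max[of M'] \<open>M \<subseteq> M'\<close> \<open>(z, a) \<in> M'\<close> none by auto
  qed
  have unique: "r = s" if "(x, r) \<in> M" "(x, s) \<in> M" for x r s
    using M_zero[of "r - s"] subspace_diff[OF sM that] by simp
  define F where "F x = (THE r. (x, r) \<in> M)" for x
  have F_eq: "F x = r" if "(x, r) \<in> M" for x r
    unfolding F_def using that unique by blast
  have F: "(x, F x) \<in> M" if "x \<in> T" for x
    using total[OF that] F_eq by blast
  show ?thesis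
  proof
    show "F (x + y) = F x + F y" if "x \<in> T" "y \<in> T" for x y
      by (intro F_eq M_add F that)
    show "F (c *\<^sub>R x) = c * F x" if "x \<in> T" for c x
      by (intro F_eq M_scale F that)
    show "F x = f x" if "x \<in> S" for x
      by (intro F_eq fM that)
    show "F x \<le> p x" if "x \<in> T" for x
      by (rule Mp[OF F[OF that]])
  qed
qed

section \<open>Square-summable sequences\<close>

definition l2 :: "(nat \<Rightarrow> real) \<Rightarrow> real" where
  "l2 a = sqrt (\<Sum>n. (a n)\<^sup>2)"

lemma l2_nonneg: "summable (\<lambda>n. (a n)\<^sup>2) \<Longrightarrow> 0 \<le> l2 a"
  by (simp add: l2_def suminf_nonneg)

lemma l2_power2: "summable (\<lambda>n. (a n)\<^sup>2) \<Longrightarrow> (l2 a)\<^sup>2 = (\<Sum>n. (a n)\<^sup>2)"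
  by (simp add: l2_def suminf_nonneg)

lemma L2_set_le_l2:
  assumes "summable (\<lambda>n. (a n)\<^sup>2)" "finite I"
  shows "L2_set a I \<le> l2 a"
  using assms unfolding L2_set_def l2_def by (intro real_sqrt_le_mono sum_le_suminf) auto

lemma l2_leI:
  assumes "\<And>N. L2_set a {..<N} \<le> C"
  shows "summable (\<lambda>n. (a n)\<^sup>2)" "l2 a \<le> C"
proof -
  have "0 \<le> C"
    using assms[of 0] by simp
  have le: "(\<Sum>n<N. (a n)\<^sup>2) \<le> C\<^sup>2" for N
    using assms[of N] \<open>0 \<le> C\<close> real_sqrt_le_iff[of "\<Sum>n<N. (a n)\<^sup>2" "C\<^sup>2"] by (simp add: L2_set_def)
  then show sm: "summable (\<lambda>n. (a n)\<^sup>2)"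
    by (intro summableI_nonneg_bounded[of _ "C\<^sup>2"]) auto
  show "l2 a \<le> C"
    unfolding l2_def using suminf_le_const[OF sm le] \<open>0 \<le> C\<close> by (intro real_le_lsqrt) (auto intro: suminf_nonneg sm)
qed

lemma l2_triangle:
  assumes "summable (\<lambda>n. (a n)\<^sup>2)" "summable (\<lambda>n. (b n)\<^sup>2)" "\<And>n. 0 \<le> c n" "\<And>n. c n \<le> a n + b n"
  shows "summable (\<lambda>n. (c n)\<^sup>2)" "l2 c \<le> l2 a + l2 b"
proof -
  have "L2_set c {..<N} \<le> l2 a + l2 b" for N
  proof -
    have "L2_set c {..<N} \<le> L2_set (\<lambda>n. a n + b n) {..<N}"
      using assms by (intro L2_set_mono) auto
    also have "\<dots> \<le> L2_set a {..<N} + L2_set b {..<N}"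
      by (rule L2_set_triangle_ineq)
    also have "\<dots> \<le> l2 a + l2 b"
      using assms by (intro add_mono L2_set_le_l2) auto
    finally show ?thesis .
  qed
  then show "summable (\<lambda>n. (c n)\<^sup>2)" "l2 c \<le> l2 a + l2 b"
    by (rule l2_leI)+
qed

lemma l2_mono:
  assumes "summable (\<lambda>n. (a n)\<^sup>2)" "\<And>n. 0 \<le> c n" "\<And>n. c n \<le> a n"
  shows "summable (\<lambda>n. (c n)\<^sup>2)" "l2 c \<le> l2 a"
  using l2_triangle[of a "\<lambda>_. 0" c] assms by (auto simp: l2_def)

lemma l2_cmult: "summable (\<lambda>n. (a n)\<^sup>2) \<Longrightarrow> l2 (\<lambda>n. c * a n) = \<bar>c\<bar> * l2 a"
  by (simp add: l2_def power_mult_distrib suminf_mult real_sqrt_mult)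

lemma l2_split:
  assumes "summable (\<lambda>n. (a n)\<^sup>2)"
  shows "(l2 a)\<^sup>2 = (L2_set a {..<N})\<^sup>2 + (l2 (\<lambda>n. a (n + N)))\<^sup>2"
  using suminf_split_initial_segment[OF assms, of N] assms
    l2_power2[OF summable_ignore_initial_segment[OF assms, of N]]
  by (simp add: l2_power2 L2_set_def sum_nonneg)

lemma l2_tail:
  assumes "summable (\<lambda>n. (a n)\<^sup>2)"
  shows "(\<lambda>N. l2 (\<lambda>n. a (n + N))) \<longlonglongrightarrow> 0"
  using tendsto_real_sqrt[OF suminf_exist_split2[OF assms]] by (simp add: l2_def)

text \<open>The squares sum to \<open>4/3\<close>; 2 is a rounded bound for the root and becomes the
  factor in the norm estimate for multiples of elements of \<open>W\<close>.\<close>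

lemma half_powers_l2: "summable (\<lambda>n. ((1/2)^n)\<^sup>2 :: real)" "l2 (\<lambda>n. (1/2)^n) \<le> 2"
proof -
  have "(\<lambda>n. ((1/2)^n)\<^sup>2 :: real) = (\<lambda>n. (1/4)^n)"
    by (auto simp: power2_eq_square simp flip: power_mult_distrib)
  then have "(\<lambda>n. ((1/2)^n)\<^sup>2 :: real) sums (4/3)"
    using geometric_sums[of "1/4 :: real"] by simp
  then show "summable (\<lambda>n. ((1/2)^n)\<^sup>2 :: real)" "l2 (\<lambda>n. (1/2)^n) \<le> 2"
    unfolding l2_def by (auto simp: sums_iff intro!: real_le_lsqrt)
qed

section \<open>The interpolation space of Davis, Figiel, Johnson and Pelczynski\<close>

locale interpolation =
  fixes W :: "'a::banach set"
  assumes convex_W: "convex W" and uminus_W: "w \<in> W \<Longrightarrow> - w \<in> W" and zero_W: "0 \<in> W"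
    and norm_W: "w \<in> W \<Longrightarrow> norm w \<le> 1"
begin

text \<open>Up to a factor of 2, \<open>kfun n\<close> is the gauge of \<open>2\<^sup>n W + 2\<^sup>-\<^sup>n B\<close>, where \<open>B\<close> is the unit ball.\<close>

definition kfun :: "nat \<Rightarrow> 'a \<Rightarrow> real" where
  "kfun n f = Inf {t / 2^n + 2^n * norm (f - t *\<^sub>R w) |t w. 0 \<le> t \<and> w \<in> W}"

lemma kfun_bdd: "bdd_below {t / 2^n + 2^n * norm (f - t *\<^sub>R w) |t w. 0 \<le> t \<and> w \<in> W}"
  by (rule bdd_belowI[of _ 0]) auto

lemma kfun_le: "0 \<le> t \<Longrightarrow> w \<in> W \<Longrightarrow> kfun n f \<le> t / 2^n + 2^n * norm (f - t *\<^sub>R w)"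
  unfolding kfun_def by (rule cInf_lower[OF _ kfun_bdd]) auto

lemma kfun_lessE:
  assumes "kfun n f < c"
  obtains t w where "0 \<le> t" "w \<in> W" "t / 2^n + 2^n * norm (f - t *\<^sub>R w) < c"
proof -
  have "{t / 2^n + 2^n * norm (f - t *\<^sub>R w) |t w. 0 \<le> t \<and> w \<in> W} \<noteq> {}"
    using zero_W by auto
  from cInf_lessD[OF this assms[unfolded kfun_def]] show ?thesis
    using that by auto
qed

lemma kfun_geI:
  assumes "\<And>t w. 0 \<le> t \<Longrightarrow> w \<in> W \<Longrightarrow> c \<le> t / 2^n + 2^n * norm (f - t *\<^sub>R w)"
  shows "c \<le> kfun n f"
proof (rule ccontr)
  assume "\<not> c \<le> kfun n f"
  then have "kfun n f < c"
    by simp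
  then obtain t w where "0 \<le> t" "w \<in> W" "t / 2^n + 2^n * norm (f - t *\<^sub>R w) < c"
    by (rule kfun_lessE)
  then show False
    using assms[of t w] by simp
qed

lemma kfun_nonneg: "0 \<le> kfun n f"
  by (rule kfun_geI) simp

lemma kfun_le_norm: "kfun n f \<le> 2^n * norm f"
  using kfun_le[of 0 0 n f] zero_W by simp

lemma kfun_zero [simp]: "kfun n 0 = 0"
  using kfun_le_norm[of n 0] kfun_nonneg[of n 0] by simp

text \<open>Nearly optimal decompositions of \<open>f\<close> and \<open>g\<close> add up: by
  convexity \<open>t *\<^sub>R w + s *\<^sub>R v\<close> is again \<open>t + s\<close> times an
  element of \<open>W\<close>.\<close>

lemma kfun_triangle: "kfun n (f + g) \<le> kfun n f + kfun n g"
proof (rule field_le_epsilon)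
  fix e :: real
  assume "0 < e"
  obtain t w where t: "0 \<le> t" "w \<in> W" "t / 2^n + 2^n * norm (f - t *\<^sub>R w) < kfun n f + e/2"
    by (rule kfun_lessE[of n f "kfun n f + e/2"]) (use \<open>0 < e\<close> in auto)
  obtain s v where s: "0 \<le> s" "v \<in> W" "s / 2^n + 2^n * norm (g - s *\<^sub>R v) < kfun n g + e/2"
    by (rule kfun_lessE[of n g "kfun n g + e/2"]) (use \<open>0 < e\<close> in auto)
  have "\<exists>x\<in>W. t *\<^sub>R w + s *\<^sub>R v = (t + s) *\<^sub>R x"
  proof (cases "t + s = 0")
    case True
    then show ?thesis
      using t s zero_W by (intro bexI[of _ 0]) (auto simp: add_nonneg_eq_0_iff)
  next
    case False
    have "(t / (t + s)) *\<^sub>R w + (s / (t + s)) *\<^sub>R v \<in> W"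
      using t s False by (intro convexD[OF convex_W]) (auto simp: add_divide_distrib[symmetric])
    then show ?thesis
      using False by (intro bexI) (auto simp: scaleR_add_right)
  qed
  then obtain x where x: "x \<in> W" "t *\<^sub>R w + s *\<^sub>R v = (t + s) *\<^sub>R x" ..
  have "kfun n (f + g) \<le> (t + s) / 2^n + 2^n * norm (f + g - (t + s) *\<^sub>R x)"
    using t s x by (intro kfun_le) auto
  also have "norm (f + g - (t + s) *\<^sub>R x) \<le> norm (f - t *\<^sub>R w) + norm (g - s *\<^sub>R v)"
    unfolding x(2)[symmetric] using norm_triangle_ineq[of "f - t *\<^sub>R w" "g - s *\<^sub>R v"] by (simp add: algebra_simps)
  finally show "kfun n (f + g) \<le> kfun n f + kfun n g + e"
    using t(3) s(3) by (simp add: distrib_left add_divide_distrib)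
qed

lemma kfun_scale: "kfun n (c *\<^sub>R f) = \<bar>c\<bar> * kfun n f"
proof -
  have le: "kfun n (c *\<^sub>R f) \<le> \<bar>c\<bar> * kfun n f" if "c \<noteq> 0" for c f
  proof -
    have "kfun n (c *\<^sub>R f) / \<bar>c\<bar> \<le> kfun n f"
    proof (rule kfun_geI)
      fix t w
      assume t: "0 \<le> (t::real)" "w \<in> W"
      have "sgn c *\<^sub>R w \<in> W"
        using t uminus_W that by (cases "0 < c") auto
      then have "kfun n (c *\<^sub>R f) \<le> (\<bar>c\<bar> * t) / 2^n + 2^n * norm (c *\<^sub>R f - (\<bar>c\<bar> * t) *\<^sub>R (sgn c *\<^sub>R w))"
        using t by (intro kfun_le) auto
      also have "c *\<^sub>R f - (\<bar>c\<bar> * t) *\<^sub>R (sgn c *\<^sub>R w) = c *\<^sub>R (f - t *\<^sub>R w)"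
        by (simp add: algebra_simps abs_sgn)
      also have "norm \<dots> = \<bar>c\<bar> * norm (f - t *\<^sub>R w)"
        by simp
      finally show "kfun n (c *\<^sub>R f) / \<bar>c\<bar> \<le> t / 2^n + 2^n * norm (f - t *\<^sub>R w)"
        using that by (simp add: pos_divide_le_eq algebra_simps)
    qed
    then show ?thesis
      using that by (simp add: field_simps)
  qed
  show ?thesis
  proof (cases "c = 0")
    case False
    have "\<bar>c\<bar> * kfun n f \<le> kfun n (c *\<^sub>R f)"
      using le[of "inverse c" "c *\<^sub>R f"] False by (simp add: abs_inverse field_simps)
    then show ?thesis
      using le[OF False, of f] by simp
  qed simp
qed

lemma norm_le_kfun: "norm f \<le> kfun 0 f"
proof (rule kfun_geI)
  fix t w
  assume "0 \<le> (t::real)" "w \<in> W"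
  then have "norm (t *\<^sub>R w) \<le> t"
    using norm_W[of w] by (simp add: mult_left_le)
  then show "norm f \<le> t / 2^0 + 2^0 * norm (f - t *\<^sub>R w)"
    using norm_triangle_ineq2[of f "t *\<^sub>R w"] by simp
qed

lemma kfun_W: "w \<in> W \<Longrightarrow> 0 \<le> t \<Longrightarrow> kfun n (t *\<^sub>R w) \<le> t * (1/2)^n"
  using kfun_le[of t w n "t *\<^sub>R w"] by (simp add: power_one_over divide_simps)

definition E :: "'a set" where
  "E = {f. summable (\<lambda>n. (kfun n f)\<^sup>2)}"

definition Enorm :: "'a \<Rightarrow> real" where
  "Enorm f = l2 (\<lambda>n. kfun n f)"

text \<open>Splits the square sum defining \<open>Enorm\<close>. \<open>head N\<close> is a seminorm
  on the whole ambient space, continuous for its norm, while \<open>tail N\<close> tends to 0 at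
  each element of \<open>E\<close>.\<close>

definition head :: "nat \<Rightarrow> 'a \<Rightarrow> real" where
  "head N f = L2_set (\<lambda>n. kfun n f) {..<N}"

definition tail :: "nat \<Rightarrow> 'a \<Rightarrow> real" where
  "tail N f = l2 (\<lambda>n. kfun (n + N) f)"

lemma E_summable: "f \<in> E \<Longrightarrow> summable (\<lambda>n. (kfun n f)\<^sup>2)"
  by (simp add: E_def)

lemma E_summable_tail: "f \<in> E \<Longrightarrow> summable (\<lambda>n. (kfun (n + N) f)\<^sup>2)"
  by (simp add: E_def summable_iff_shift[of "\<lambda>n. (kfun n f)\<^sup>2"])

lemma E_zero [simp]: "0 \<in> E"
  by (simp add: E_def)

lemma E_scale: "f \<in> E \<Longrightarrow> c *\<^sub>R f \<in> E"
  by (simp add: E_def kfun_scale power_mult_distrib summable_mult)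

lemma E_add: "f \<in> E \<Longrightarrow> g \<in> E \<Longrightarrow> f + g \<in> E"
  unfolding E_def using l2_triangle(1)[of "\<lambda>n. kfun n f" "\<lambda>n. kfun n g" "\<lambda>n. kfun n (f + g)"]
  by (auto simp: kfun_nonneg kfun_triangle)

lemma subspace_E: "subspace E"
  by (intro subspaceI E_zero E_add E_scale)

lemma E_diff: "f \<in> E \<Longrightarrow> g \<in> E \<Longrightarrow> f - g \<in> E"
  by (rule subspace_diff[OF subspace_E])

lemma Enorm_nonneg: "f \<in> E \<Longrightarrow> 0 \<le> Enorm f"
  by (simp add: Enorm_def l2_nonneg E_summable)

lemma Enorm_zero [simp]: "Enorm 0 = 0"
  by (simp add: Enorm_def l2_def)

lemma Enorm_triangle: "f \<in> E \<Longrightarrow> g \<in> E \<Longrightarrow> Enorm (f + g) \<le> Enorm f + Enorm g"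
  unfolding Enorm_def
  by (rule l2_triangle(2)[of "\<lambda>n. kfun n f" "\<lambda>n. kfun n g"]) (simp_all add: E_summable kfun_nonneg kfun_triangle)

lemma Enorm_scale: "f \<in> E \<Longrightarrow> Enorm (c *\<^sub>R f) = \<bar>c\<bar> * Enorm f"
  unfolding Enorm_def kfun_scale by (subst l2_cmult) (auto simp: E_summable)

lemma Enorm_uminus: "f \<in> E \<Longrightarrow> Enorm (- f) = Enorm f"
  using Enorm_scale[of f "-1"] by simp

lemma Enorm_diff_commute: "f \<in> E \<Longrightarrow> g \<in> E \<Longrightarrow> Enorm (f - g) = Enorm (g - f)"
  using Enorm_uminus[of "f - g"] E_diff by simp

lemma head_nonneg: "0 \<le> head N f"
  by (simp add: head_def)

lemma head_triangle: "head N (f + g) \<le> head N f + head N g"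
  unfolding head_def
  by (rule order_trans[OF L2_set_mono L2_set_triangle_ineq]) (auto simp: kfun_triangle kfun_nonneg)

lemma head_scale: "head N (c *\<^sub>R f) = \<bar>c\<bar> * head N f"
  by (simp add: head_def kfun_scale L2_set_right_distrib)

lemma head_le_norm: "head N f \<le> (\<Sum>n<N. 2^n) * norm f"
proof -
  have "head N f \<le> (\<Sum>n<N. \<bar>kfun n f\<bar>)"
    unfolding head_def by (rule L2_set_le_sum_abs)
  also have "\<dots> \<le> (\<Sum>n<N. 2^n * norm f)"
    using kfun_le_norm by (intro sum_mono) (auto simp: kfun_nonneg)
  finally show ?thesis
    by (simp add: sum_distrib_right)
qed

lemma tail_nonneg: "f \<in> E \<Longrightarrow> 0 \<le> tail N f"
  by (simp add: tail_def l2_nonneg E_summable_tail)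

lemma tail_triangle: "f \<in> E \<Longrightarrow> g \<in> E \<Longrightarrow> tail N (f + g) \<le> tail N f + tail N g"
  unfolding tail_def
  by (rule l2_triangle(2)[of "\<lambda>n. kfun (n + N) f" "\<lambda>n. kfun (n + N) g"])
    (simp_all add: E_summable_tail kfun_nonneg kfun_triangle)

lemma tail_scale: "f \<in> E \<Longrightarrow> tail N (c *\<^sub>R f) = \<bar>c\<bar> * tail N f"
  unfolding tail_def kfun_scale by (subst l2_cmult) (auto simp: E_summable_tail)

lemma tail_tendsto: "f \<in> E \<Longrightarrow> (\<lambda>N. tail N f) \<longlonglongrightarrow> 0"
  unfolding tail_def using l2_tail[OF E_summable] .

lemma Enorm_split: "f \<in> E \<Longrightarrow> (Enorm f)\<^sup>2 = (head N f)\<^sup>2 + (tail N f)\<^sup>2"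
  unfolding Enorm_def head_def tail_def by (rule l2_split) (rule E_summable)

lemma head_le_Enorm: "f \<in> E \<Longrightarrow> head N f \<le> Enorm f"
  unfolding head_def Enorm_def by (intro L2_set_le_l2 E_summable) auto

lemma tail_le_Enorm: "f \<in> E \<Longrightarrow> tail N f \<le> Enorm f"
  using Enorm_split[of f N] Enorm_nonneg[of f] power2_le_imp_le[of "tail N f" "Enorm f"] by simp

lemma Enorm_le: "f \<in> E \<Longrightarrow> Enorm f \<le> head N f + tail N f"
  using Enorm_split[of f N] head_nonneg[of N f] tail_nonneg[of f N]
    power2_le_imp_le[of "Enorm f" "head N f + tail N f"] by (simp add: power2_sum)

text \<open>Membership in \<open>E\<close> and the norm bound are both read off from seminorms that
  are continuous on the ambient space. This is how ambient limits and functionals lead back into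
  \<open>E\<close>.\<close>

lemma E_bounded_head: "(\<And>N. head N f \<le> C) \<Longrightarrow> f \<in> E \<and> Enorm f \<le> C"
  unfolding head_def E_def Enorm_def using l2_leI[of "\<lambda>n. kfun n f" C] by auto

lemma kfun_le_Enorm:
  assumes "f \<in> E"
  shows "kfun n f \<le> Enorm f"
proof -
  have "kfun n f \<le> L2_set (\<lambda>n. kfun n f) {..n}"
    by (rule member_le_L2_set) auto
  also have "\<dots> \<le> Enorm f"
    unfolding Enorm_def using assms by (intro L2_set_le_l2 E_summable) auto
  finally show ?thesis .
qed

lemma norm_le_Enorm: "f \<in> E \<Longrightarrow> norm f \<le> Enorm f"
  using norm_le_kfun[of f] kfun_le_Enorm[of f 0] by simp

lemma Enorm_eq_0_iff: "f \<in> E \<Longrightarrow> Enorm f = 0 \<longleftrightarrow> f = 0"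
  using norm_le_Enorm[of f] by auto

lemma scaled_W_in_E: 
  assumes "w \<in> W" "0 \<le> t"
  shows "t *\<^sub>R w \<in> E" "Enorm (t *\<^sub>R w) \<le> 2 * t"
proof -
  have sm: "summable (\<lambda>n. (t * (1/2)^n)\<^sup>2)"
    using half_powers_l2(1) by (simp add: power_mult_distrib summable_mult)
  show "t *\<^sub>R w \<in> E"
    using l2_mono(1)[OF sm kfun_nonneg kfun_W[OF assms]] by (simp add: E_def)
  have "Enorm (t *\<^sub>R w) \<le> l2 (\<lambda>n. t * (1/2)^n)"
    unfolding Enorm_def by (rule l2_mono(2)[OF sm kfun_nonneg kfun_W[OF assms]])
  also have "\<dots> = t * l2 (\<lambda>n. (1/2)^n)"
    using assms by (simp add: l2_cmult[OF half_powers_l2(1)])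
  also have "\<dots> \<le> t * 2"
    using assms half_powers_l2(2) by (intro mult_left_mono) auto
  finally show "Enorm (t *\<^sub>R w) \<le> 2 * t"
    by simp
qed

text \<open>A Cauchy sequence of \<open>E\<close> converges in the ambient norm. For each
  \<open>N\<close> the Cauchy estimate for \<open>head N\<close> passes to that limit, with a bound
  that does not depend on \<open>N\<close>.\<close>

lemma E_complete:
  assumes U: "\<And>k. U k \<in> E"
    and cauchy: "\<And>e. 0 < e \<Longrightarrow> \<exists>K. \<forall>j\<ge>K. \<forall>k\<ge>K. Enorm (U j - U k) < e"
  obtains f where "f \<in> E" "(\<lambda>k. Enorm (U k - f)) \<longlonglongrightarrow> 0"
proof -
  have "Cauchy U"
    unfolding Cauchy_iff using cauchy norm_le_Enorm E_diff U by (meson le_less_trans)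
  then obtain f where f: "U \<longlonglongrightarrow> f"
    using convergent_eq_Cauchy[of U] convergent_def by blast
  have head_lim: "(\<lambda>k. head N (U j - U k)) \<longlonglongrightarrow> head N (U j - f)" for N j
  proof -
    have bound: "\<bar>head N (U j - U k) - head N (U j - f)\<bar> \<le> (\<Sum>n<N. 2^n) * norm (U k - f)" for k
    proof -
      have "head N (U j - U k) \<le> head N (U j - f) + head N (f - U k)"
        using head_triangle[of N "U j - f" "f - U k"] by simp
      moreover have "head N (U j - f) \<le> head N (U j - U k) + head N (U k - f)"
        using head_triangle[of N "U j - U k" "U k - f"] by simp
      ultimately show ?thesis
        using head_le_norm[of N "U k - f"] head_le_norm[of N "f - U k"] by (auto simp: norm_minus_commute)
    qed
    have "(\<lambda>k. (\<Sum>n<N. 2^n) * norm (U k - f)) \<longlonglongrightarrow> 0"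
      using f by (intro tendsto_mult_right_zero tendsto_norm_zero) (simp add: LIM_zero_iff)
    then have "(\<lambda>k. head N (U j - U k) - head N (U j - f)) \<longlonglongrightarrow> 0"
      by (rule Lim_null_comparison[rotated]) (simp add: bound)
    then show ?thesis
      by (rule LIM_zero_cancel)
  qed
  have key: "\<exists>K. \<forall>j\<ge>K. U j - f \<in> E \<and> Enorm (U j - f) \<le> e" if "0 < e" for e
  proof -
    obtain K where K: "\<forall>j\<ge>K. \<forall>k\<ge>K. Enorm (U j - U k) < e"
      using cauchy \<open>0 < e\<close> by blast
    have "head N (U j - f) \<le> e" if "K \<le> j" for j N
    proof (rule tendsto_upperbound[OF head_lim])
      show "\<forall>\<^sub>F k in sequentially. head N (U j - U k) \<le> e"
        using eventually_ge_at_top[of K]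
      proof eventually_elim
        case (elim k)
        then have "Enorm (U j - U k) < e"
          using K that by blast
        then show ?case
          using head_le_Enorm[OF E_diff[OF U U], of N j k] by linarith
      qed
    qed simp
    then show ?thesis
      using E_bounded_head by blast
  qed
  obtain j where "U j - f \<in> E"
    using key[of 1] by auto
  then have "f \<in> E"
    using E_diff[OF U[of j]] by fastforce
  moreover have "(\<lambda>k. Enorm (U k - f)) \<longlonglongrightarrow> 0"
  proof (rule LIMSEQ_I)
    fix e :: real
    assume "0 < e"
    then obtain K where "\<forall>j\<ge>K. U j - f \<in> E \<and> Enorm (U j - f) \<le> e/2"
      using key[of "e/2"] by auto
    then show "\<exists>K. \<forall>k\<ge>K. norm (Enorm (U k - f) - 0) < e"
      using \<open>0 < e\<close> Enorm_nonneg by (intro exI[of _ K]) fastforce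
  qed
  ultimately show ?thesis
    using that by blast
qed

text \<open>Take a nearly optimal decomposition at a late level \<open>n\<close>. Then
  \<open>2^n * norm (f - t *\<^sub>R w)\<close> controls the head of the difference,
  \<open>t / 2^n\<close> controls the tail of \<open>t *\<^sub>R w\<close>, and the tail of
  \<open>f\<close> is small already. Continuity of the action then only has to be checked on
  generators.\<close>

lemma W_dense:
  assumes f: "f \<in> E" and "0 < e"
  obtains t w where "0 \<le> t" "w \<in> W" "Enorm (f - t *\<^sub>R w) < e"
proof -
  have "\<forall>\<^sub>F n in sequentially. kfun n f < e/8"
  proof -
    have "(\<lambda>n. (kfun n f)\<^sup>2) \<longlonglongrightarrow> 0"
      using summable_LIMSEQ_zero[OF E_summable[OF f]] .
    from tendsto_real_sqrt[OF this] have "(\<lambda>n. kfun n f) \<longlonglongrightarrow> 0"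
      by (simp add: kfun_nonneg)
    then show ?thesis
      using \<open>0 < e\<close> by (intro order_tendstoD) auto
  qed
  moreover have "\<forall>\<^sub>F n in sequentially. tail n f < e/8"
    using tail_tendsto[OF f] \<open>0 < e\<close> by (intro order_tendstoD) auto
  ultimately obtain n where n: "kfun n f < e/8" "tail n f < e/8"
    using eventually_happens'[OF sequentially_bot] eventually_conj by blast
  \<comment> \<open>The head costs \<open>q\<close>, the tail of \<open>t *\<^sub>R w\<close> costs
    \<open>2 * q\<close> and that of \<open>f\<close> less than \<open>q\<close>, altogether less
    than \<open>e/2\<close>.\<close>
  define q where "q = e/8"
  obtain t w where tw: "0 \<le> t" "w \<in> W" "t / 2^n + 2^n * norm (f - t *\<^sub>R w) < q"
    using n(1) unfolding q_def by (rule kfun_lessE)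
  have t: "t \<le> 2^n * q" and nrm: "2^n * norm (f - t *\<^sub>R w) \<le> q"
  proof -
    have "0 \<le> 2^n * norm (f - t *\<^sub>R w)" "0 \<le> t / 2^n"
      using tw by auto
    then have "t / 2^n \<le> q" "2^n * norm (f - t *\<^sub>R w) \<le> q"
      using tw by linarith+
    then show "t \<le> 2^n * q" "2^n * norm (f - t *\<^sub>R w) \<le> q"
      by (auto simp: field_simps)
  qed
  let ?g = "f - t *\<^sub>R w"
  have tE: "t *\<^sub>R w \<in> E"
    using scaled_W_in_E tw by blast
  have "head n ?g \<le> (\<Sum>m<n. 2^m) * norm ?g"
    by (rule head_le_norm)
  also have "(\<Sum>m<n. 2^m) \<le> (2::real)^n"
    by (induction n) auto
  finally have head: "head n ?g \<le> q"
    using nrm by (smt (verit) mult_right_mono norm_ge_zero)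
  have sm: "summable (\<lambda>m. (q * (1/2)^m)\<^sup>2)"
    using half_powers_l2(1) by (simp add: power_mult_distrib summable_mult)
  have "tail n (t *\<^sub>R w) \<le> l2 (\<lambda>m. q * (1/2)^m)"
    unfolding tail_def
  proof (rule l2_mono(2)[OF sm kfun_nonneg])
    fix m
    have "kfun (m + n) (t *\<^sub>R w) \<le> t * (1/2)^(m + n)"
      by (rule kfun_W[OF tw(2,1)])
    also have "\<dots> \<le> (2^n * q) * (1/2)^(m + n)"
      using t by (intro mult_right_mono) auto
    also have "\<dots> = q * (1/2)^m"
      by (simp add: power_add power_one_over field_simps)
    finally show "kfun (m + n) (t *\<^sub>R w) \<le> q * (1/2)^m" .
  qed
  also have "\<dots> = q * l2 (\<lambda>n. (1/2)^n)"
    using \<open>0 < e\<close> l2_cmult[OF half_powers_l2(1), of q] by (simp add: q_def)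
  also have "\<dots> \<le> q * 2"
    using half_powers_l2(2) \<open>0 < e\<close> by (intro mult_left_mono) (auto simp: q_def)
  finally have "tail n ?g \<le> tail n f + 2 * q"
    using tail_triangle[OF f E_scale[OF tE], of n "-1"] tail_scale[OF tE, of n "-1"] by simp
  then have "Enorm ?g < e"
    using Enorm_le[OF E_diff[OF f tE], of n] head n \<open>0 < e\<close> unfolding q_def by linarith
  then show ?thesis
    using that tw by blast
qed

end

section \<open>Functionals on the interpolation space\<close>

context interpolation
begin

text \<open>The functionals are functions on the whole ambient space whose values outside
  \<open>E\<close> are arbitrary, so ambient functionals belong to \<open>Edual\<close> as they
  stand.\<close>

definition Edual :: "('a \<Rightarrow> real) set" where
  "Edual = {F. (\<forall>f\<in>E. \<forall>g\<in>E. F (f + g) = F f + F g) \<and> (\<forall>c. \<forall>f\<in>E. F (c *\<^sub>R f) = c * F f) \<and>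
     (\<exists>C. \<forall>f\<in>E. \<bar>F f\<bar> \<le> C * Enorm f)}"

lemma blinfun_in_Edual: "blinfun_apply H \<in> Edual"
proof -
  have "\<bar>H f\<bar> \<le> norm H * Enorm f" if "f \<in> E" for f
    using norm_blinfun[of H f] mult_left_mono[OF norm_le_Enorm[OF that] norm_ge_zero[of H]] by simp
  then show ?thesis
    by (auto simp: Edual_def blinfun.add_right blinfun.scaleR_right)
qed

text \<open>Hahn-Banach for the seminorm \<open>head N\<close> on the ambient space, starting from
  the line through \<open>f0\<close>. The extension is bounded for the ambient norm because
  \<open>head N\<close> is dominated by a multiple of it.\<close>

lemma norming_functional:
  obtains H :: "'a \<Rightarrow>\<^sub>L real" where "H f0 = head N f0" "\<And>f. \<bar>H f\<bar> \<le> head N f"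
proof -
  \<comment> \<open>The coordinate is ambiguous only for \<open>f0 = 0\<close>, and then the factor
    \<open>head N f0\<close> vanishes.\<close>
  define \<phi> where "\<phi> x = head N f0 * (SOME c. x = c *\<^sub>R f0)" for x
  have \<phi>: "\<phi> (c *\<^sub>R f0) = head N f0 * c" for c
  proof (cases "f0 = 0")
    case True
    then show ?thesis
      by (simp add: \<phi>_def head_def L2_set_def)
  next
    case False
    then have "(SOME c'. c *\<^sub>R f0 = c' *\<^sub>R f0) = c"
      by auto
    then show ?thesis
      by (simp add: \<phi>_def)
  qed
  obtain F where F: "\<And>x y. F (x + y) = F x + F y" "\<And>c x. F (c *\<^sub>R x) = c * F x"
    "\<And>x. x \<in> range (\<lambda>c. c *\<^sub>R f0) \<Longrightarrow> F x = \<phi> x" "\<And>x. F x \<le> head N x"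
  proof (rule hahn_banach[of "range (\<lambda>c. c *\<^sub>R f0)" UNIV "head N" \<phi>])
    show "subspace (range (\<lambda>c. c *\<^sub>R f0))"
      by (rule linear_subspace_image[OF _ subspace_UNIV]) (simp add: linear_scale_left linearI algebra_simps)
    show "\<phi> (x + y) = \<phi> x + \<phi> y" if "x \<in> range (\<lambda>c. c *\<^sub>R f0)" "y \<in> range (\<lambda>c. c *\<^sub>R f0)" for x y
      using that by (auto simp: \<phi> algebra_simps simp flip: scaleR_add_left)
    show "\<phi> (c *\<^sub>R x) = c * \<phi> x" if "x \<in> range (\<lambda>c. c *\<^sub>R f0)" for c x
      using that by (auto simp: \<phi>)
    show "\<phi> x \<le> head N x" if "x \<in> range (\<lambda>c. c *\<^sub>R f0)" for x
      using that by (auto simp: \<phi> head_scale mult.commute[of _ "head N f0"] intro!: mult_left_mono head_nonneg)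
  qed (auto simp: head_triangle head_scale)
  have abs: "\<bar>F x\<bar> \<le> head N x" for x
    using F(4)[of x] F(4)[of "- x"] F(2)[of "-1" x] head_scale[of N "-1" x] by simp
  have "bounded_linear F"
  proof (rule bounded_linear_intro)
    show "norm (F x) \<le> norm x * (\<Sum>n<N. 2^n)" for x
      using abs[of x] head_le_norm[of N x] by (simp add: mult.commute)
  qed (simp_all add: F)
  moreover have "F f0 = head N f0"
    using F(3)[OF rangeI, of 1] \<phi>[of 1] by simp
  ultimately show ?thesis
    using that[of "Blinfun F"] abs by (simp add: bounded_linear_Blinfun_apply)
qed

text \<open>The functionals norming the heads at \<open>f0\<close> are dominated by
  \<open>Enorm\<close> on \<open>E\<close>, so the hypothesis bounds every head of
  \<open>f0\<close>. Here \<open>f0\<close> is any vector of the ambient space, and ambient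
  functionals suffice to detect that it lies in \<open>E\<close>.\<close>

lemma E_norming_functional:
  assumes "\<And>H :: 'a \<Rightarrow>\<^sub>L real. (\<And>f. f \<in> E \<Longrightarrow> \<bar>H f\<bar> \<le> Enorm f) \<Longrightarrow> H f0 \<le> C"
  shows "f0 \<in> E"
proof -
  have "head N f0 \<le> C" for N
  proof (rule norming_functional[of f0 N])
    fix H :: "'a \<Rightarrow>\<^sub>L real"
    assume H: "H f0 = head N f0" "\<And>f. \<bar>H f\<bar> \<le> head N f"
    show ?thesis
      using assms[of H] H order_trans[OF H(2) head_le_Enorm] by simp
  qed
  then show ?thesis
    using E_bounded_head by blast
qed

text \<open>
  On \<open>(u, t)\<close> the functional is dominated by \<open>s\<close> times the Euclidean norm of \<open>(head N u, tail N t)\<close>.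
  If \<open>F f0\<close> is almost \<open>s\<close> and \<open>tail N f0\<close> is small, uniform convexity of that norm makes
  the part of the extended functional that depends on \<open>t\<close> small.
\<close>

lemma Edual_approx_by_blinfun:
  assumes F: "F \<in> Edual" and e: "0 < e"
  obtains G :: "'a \<Rightarrow>\<^sub>L real" where "\<And>f. f \<in> E \<Longrightarrow> \<bar>F f - G f\<bar> \<le> e * Enorm f"
proof -
  have F_add: "\<And>f g. f \<in> E \<Longrightarrow> g \<in> E \<Longrightarrow> F (f + g) = F f + F g"
    and F_scale: "\<And>c f. f \<in> E \<Longrightarrow> F (c *\<^sub>R f) = c * F f"
    using F by (auto simp: Edual_def)
  obtain C where C: "\<forall>f\<in>E. \<bar>F f\<bar> \<le> C * Enorm f"
    using F unfolding Edual_def by blast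
  define U where "U = {f \<in> E. Enorm f \<le> 1}"
  define s where "s = Sup (F ` U)"
  have F_zero: "F 0 = 0"
    using F_scale[of 0 0] by simp
  have "F f \<le> \<bar>C\<bar>" if "f \<in> U" for f
  proof -
    have "F f \<le> C * Enorm f"
      using bspec[OF C, of f] that by (simp add: U_def)
    also have "\<dots> \<le> \<bar>C\<bar> * 1"
      using that by (intro mult_mono) (auto simp: U_def Enorm_nonneg)
    finally show ?thesis by simp
  qed
  then have bdd: "bdd_above (F ` U)"
    by (intro bdd_aboveI2)
  have "0 \<in> U"
    by (simp add: U_def)
  then have s: "0 \<le> s"
    using cSup_upper[OF _ bdd, of 0] F_zero by (force simp: s_def)
  have F_le: "F f \<le> s * Enorm f" if f: "f \<in> E" for f
  proof (cases "f = 0")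
    case False
    then have pos: "0 < Enorm f"
      using Enorm_eq_0_iff[OF f] Enorm_nonneg[OF f] by simp
    then have "(1 / Enorm f) *\<^sub>R f \<in> U"
      using f by (simp add: U_def E_scale Enorm_scale)
    then have "F ((1 / Enorm f) *\<^sub>R f) \<le> s"
      unfolding s_def by (intro cSup_upper bdd imageI)
    then show ?thesis
      using pos F_scale[OF f] by (simp add: divide_le_eq)
  qed (simp add: F_zero)
  \<comment> \<open>The estimate at the end is \<open>\<tau> * R t \<le> s * \<tau>\<^sup>2 / 2 + (s
    + 1) * \<delta>\<close>; these choices make each summand at most
    \<open>\<tau> * (e / 2)\<close>. The denominators use \<open>s + 1\<close> because
    \<open>s\<close> may be 0.\<close>
  define \<tau> where "\<tau> = e / (s + 1)"
  define \<delta> where "\<delta> = e * \<tau> / (2 * (s + 1))"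
  have \<tau>: "0 < \<tau>" "0 < \<delta>"
    using e s by (auto simp: \<tau>_def \<delta>_def)
  obtain f0 where f0: "f0 \<in> U" "s - \<delta> < F f0"
    using less_cSup_iff[OF _ bdd, of "s - \<delta>"] \<tau> \<open>0 \<in> U\<close> by (auto simp: s_def)
  have f0E: "f0 \<in> E" and f0_le: "Enorm f0 \<le> 1"
    using f0 by (auto simp: U_def)
  have "\<forall>\<^sub>F N in sequentially. tail N f0 < \<delta>"
    using tail_tendsto[OF f0E] \<tau> by (intro order_tendstoD) auto
  then obtain N where N: "tail N f0 < \<delta>"
    using eventually_happens'[OF sequentially_bot] by blast
  \<comment> \<open>On the diagonal copy of \<open>E\<close>, \<open>p\<close> equals
    \<open>s * Enorm f\<close>. Extending from there to \<open>UNIV \<times> E\<close> splits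
    \<open>F\<close> into a part \<open>G\<close> that is defined and bounded on the ambient space
    and a remainder \<open>R\<close> on \<open>E\<close>.\<close>
  define p where "p = (\<lambda>(u, t). s * sqrt ((head N u)\<^sup>2 + (tail N t)\<^sup>2))"
  obtain F' where F': "\<And>x y. x \<in> UNIV \<times> E \<Longrightarrow> y \<in> UNIV \<times> E \<Longrightarrow> F' (x + y) = F' x + F' y"
    "\<And>c x. x \<in> UNIV \<times> E \<Longrightarrow> F' (c *\<^sub>R x) = c * F' x"
    "\<And>x. x \<in> (\<lambda>f. (f, f)) ` E \<Longrightarrow> F' x = F (snd x)" "\<And>x. x \<in> UNIV \<times> E \<Longrightarrow> F' x \<le> p x"
  proof (rule hahn_banach[of "(\<lambda>f. (f, f)) ` E" "UNIV \<times> E" p "\<lambda>x. F (snd x)"])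
    show "subspace ((\<lambda>f. (f, f)) ` E)"
      by (rule linear_subspace_image[OF _ subspace_E]) (simp add: linearI)
    show "subspace ((UNIV :: 'a set) \<times> E)"
      by (intro subspace_Times subspace_UNIV subspace_E)
    show "p (x + y) \<le> p x + p y" if in_E: "x \<in> UNIV \<times> E" "y \<in> UNIV \<times> E" for x y
    proof -
      obtain u t v r where xy: "x = (u, t)" "y = (v, r)" "t \<in> E" "r \<in> E"
        using in_E by auto
      have "sqrt ((head N (u + v))\<^sup>2 + (tail N (t + r))\<^sup>2) \<le> sqrt ((head N u + head N v)\<^sup>2 + (tail N t + tail N r)\<^sup>2)"
        using xy by (intro real_sqrt_le_mono add_mono power_mono head_triangle tail_triangle head_nonneg tail_nonneg E_add)
      also have "\<dots> \<le> sqrt ((head N u)\<^sup>2 + (tail N t)\<^sup>2) + sqrt ((head N v)\<^sup>2 + (tail N r)\<^sup>2)"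
        by (rule real_sqrt_sum_squares_triangle_ineq)
      finally show ?thesis
        using mult_left_mono[OF _ s] by (simp add: p_def xy flip: distrib_left)
    qed
    show "p (c *\<^sub>R x) = c * p x" if c: "0 < c" "x \<in> UNIV \<times> E" for c x
    proof -
      obtain u t where x: "x = (u, t)" "t \<in> E"
        using c by auto
      have "sqrt ((c * head N u)\<^sup>2 + (c * tail N t)\<^sup>2) = sqrt (c\<^sup>2 * ((head N u)\<^sup>2 + (tail N t)\<^sup>2))"
        by (simp add: power_mult_distrib distrib_left)
      also have "\<dots> = c * sqrt ((head N u)\<^sup>2 + (tail N t)\<^sup>2)"
        using c by (simp add: real_sqrt_mult)
      finally show ?thesis
        using x c by (simp add: p_def head_scale tail_scale)
    qed
    show "F (snd x) \<le> p x" if diag: "x \<in> (\<lambda>f. (f, f)) ` E" for x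
    proof -
      obtain f where x: "x = (f, f)" "f \<in> E"
        using diag by auto
      have "sqrt ((head N f)\<^sup>2 + (tail N f)\<^sup>2) = Enorm f"
        using x Enorm_split[of f N] Enorm_nonneg[of f] by (metis real_sqrt_unique)
      then show ?thesis
        using F_le[OF x(2)] by (simp add: p_def x)
    qed
  qed (auto simp: F_add F_scale)
  define G where "G u = F' (u, 0)" for u
  define R where "R t = F' (0, t)" for t
  have F_eq: "F f = G f + R f" if "f \<in> E" for f
    using F'(3)[of "(f, f)"] F'(1)[of "(f, 0)" "(0, f)"] that by (simp add: G_def R_def)
  have G_le: "G u \<le> s * head N u" for u
    using F'(4)[of "(u, 0)"] head_nonneg[of N u] by (simp add: G_def p_def tail_def l2_def)
  have G_scale: "G (c *\<^sub>R u) = c * G u" for c u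
    using F'(2)[of "(u, 0)" c] by (simp add: G_def)
  have "bounded_linear G"
  proof (rule bounded_linear_intro)
    show "G (x + y) = G x + G y" for x y
      using F'(1)[of "(x, 0)" "(y, 0)"] by (simp add: G_def)
    fix x
    have "\<bar>G x\<bar> \<le> s * head N x"
      using G_le[of x] G_le[of "- x"] G_scale[of "-1" x] head_scale[of N "-1" x] by simp
    also have "\<dots> \<le> s * ((\<Sum>n<N. 2^n) * norm x)"
      using s by (intro mult_left_mono head_le_norm)
    finally show "norm (G x) \<le> norm x * (s * (\<Sum>n<N. 2^n))"
      by (simp add: mult_ac)
  qed (simp add: G_scale)
  have R_le: "R t \<le> s * tail N t" if "t \<in> E" for t
    using F'(4)[of "(0, t)"] tail_nonneg[OF that, of N] that by (simp add: R_def p_def head_def L2_set_def)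
  have R_scale: "R (c *\<^sub>R t) = c * R t" if "t \<in> E" for c t
    using F'(2)[of "(0, t)" c] that by (simp add: R_def)
  have G_f0: "s - \<delta> - s * \<delta> \<le> G f0"
  proof -
    have "R f0 \<le> s * \<delta>"
      using R_le[OF f0E] mult_left_mono[OF less_imp_le[OF N] s] by linarith
    then show ?thesis
      using F_eq[OF f0E] f0(2) by linarith
  qed
  have R_small: "R t \<le> e" if t: "t \<in> E" "Enorm t \<le> 1" for t
  proof -
    \<comment> \<open>Perturb \<open>f0\<close> in the second coordinate only: \<open>G f0\<close>
      is nearly the maximal value \<open>s\<close>, while the Euclidean norm grows only to second
      order in \<open>\<tau>\<close>.\<close>
    have "G f0 + \<tau> * R t = F' (f0, \<tau> *\<^sub>R t)"
      using F'(1)[of "(f0, 0)" "(0, \<tau> *\<^sub>R t)"] R_scale[OF t(1), of \<tau>] t by (simp add: G_def R_def E_scale)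
    also have "\<dots> \<le> s * sqrt ((head N f0)\<^sup>2 + (tail N (\<tau> *\<^sub>R t))\<^sup>2)"
      using F'(4)[of "(f0, \<tau> *\<^sub>R t)"] t by (simp add: p_def E_scale)
    also have "\<dots> \<le> s * (1 + \<tau>\<^sup>2 / 2)"
    proof (intro mult_left_mono s real_le_lsqrt)
      have "head N f0 \<le> 1" "tail N t \<le> 1"
        using head_le_Enorm[OF f0E, of N] tail_le_Enorm[OF t(1), of N] f0_le t by linarith+
      then have "(head N f0)\<^sup>2 \<le> 1" "(tail N t)\<^sup>2 \<le> 1"
        using head_nonneg tail_nonneg[OF t(1)] by (simp_all add: power_le_one)
      then have "(head N f0)\<^sup>2 + (tail N (\<tau> *\<^sub>R t))\<^sup>2 \<le> 1 + \<tau>\<^sup>2 * 1"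
        using \<tau> unfolding tail_scale[OF t(1)] power_mult_distrib by (intro add_mono mult_mono) auto
      also have "\<dots> \<le> (1 + \<tau>\<^sup>2 / 2)\<^sup>2"
        by (simp add: power2_sum)
      finally show "(head N f0)\<^sup>2 + (tail N (\<tau> *\<^sub>R t))\<^sup>2 \<le> (1 + \<tau>\<^sup>2 / 2)\<^sup>2" .
    qed simp_all
    finally have "\<tau> * R t \<le> s * \<tau>\<^sup>2 / 2 + (s + 1) * \<delta>"
      using G_f0 by (simp add: algebra_simps)
    also have "(s + 1) * \<delta> = \<tau> * (e / 2)"
    proof -
      have "x * (y / (2 * x)) = y / 2" if "x \<noteq> 0" for x y :: real
        using that by simp
      from this[of "s + 1" "e * \<tau>"] have "(s + 1) * (e * \<tau> / (2 * (s + 1))) = e * \<tau> / 2"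
        using s by linarith
      then show ?thesis
        by (simp add: \<delta>_def mult.commute)
    qed
    also have "s * \<tau>\<^sup>2 / 2 \<le> \<tau> * (e / 2)"
    proof -
      have "s * \<tau> \<le> e"
        using s e by (simp add: \<tau>_def field_simps)
      then have "\<tau> * (s * \<tau>) \<le> \<tau> * e"
        using \<tau> by (intro mult_left_mono) auto
      then show ?thesis
        by (simp add: power2_eq_square mult_ac)
    qed
    finally have "\<tau> * R t \<le> \<tau> * e"
      by (simp flip: distrib_left)
    then show ?thesis
      using \<tau> by simp
  qed
  have R_le': "R t \<le> e * Enorm t" if t: "t \<in> E" for t
  proof (cases "t = 0")
    case True
    then show ?thesis
      using R_scale[of 0 0] by simp
  next
    case False
    then have pos: "0 < Enorm t"
      using Enorm_eq_0_iff[OF t] Enorm_nonneg[OF t] by simp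
    have "R ((1 / Enorm t) *\<^sub>R t) \<le> e"
      using t pos by (intro R_small E_scale) (auto simp: Enorm_scale)
    then show ?thesis
      using pos R_scale[OF t] by (simp add: divide_le_eq)
  qed
  show ?thesis
  proof (rule that[of "Blinfun G"])
    fix f
    assume f: "f \<in> E"
    have "\<bar>R f\<bar> \<le> e * Enorm f"
      using R_le'[OF f] R_le'[of "- f"] R_scale[OF f, of "-1"] Enorm_uminus[OF f] E_scale[OF f, of "-1"] by simp
    then show "\<bar>F f - blinfun_apply (Blinfun G) f\<bar> \<le> e * Enorm f"
      using F_eq[OF f] \<open>bounded_linear G\<close> by (simp add: bounded_linear_Blinfun_apply)
  qed
qed

end

text \<open>
  \<open>'a\<close> plays the role of the space of all bounded functions on \<open>'y\<close>, with point evaluations \<open>ev\<close>.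
\<close>

locale bounded_function_space =
  fixes ev :: "'y \<Rightarrow> 'a::banach \<Rightarrow>\<^sub>L real"
  assumes ev_le_norm: "\<bar>ev y f\<bar> \<le> norm f"
    and norm_leI: "(\<And>y. \<bar>ev y f\<bar> \<le> c) \<Longrightarrow> norm f \<le> c"
    and ev_surj: "(\<And>y. \<bar>\<phi> y\<bar> \<le> c) \<Longrightarrow> \<exists>f. \<forall>y. ev y f = \<phi> y"
begin

definition eval_hull :: "('a \<Rightarrow>\<^sub>L real) set" where
  "eval_hull = convex hull (range ev \<union> uminus ` range ev)"

lemma ev_in_eval_hull: "ev y \<in> eval_hull" "- ev y \<in> eval_hull"
  unfolding eval_hull_def by (auto intro: hull_inc)

lemma convex_eval_hull: "convex eval_hull"
  by (simp add: eval_hull_def)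

lemma zero_in_eval_hull: "0 \<in> eval_hull"
  using convexD[OF convex_eval_hull ev_in_eval_hull(1) ev_in_eval_hull(2), of "1/2" "1/2" undefined undefined] by simp

lemma norm_eval_hull: "h \<in> eval_hull \<Longrightarrow> norm h \<le> 1"
proof -
  have "norm (ev y) \<le> 1" for y
    using ev_le_norm by (intro norm_blinfun_bound) auto
  then have "range ev \<union> uminus ` range ev \<subseteq> cball 0 1"
    by auto
  then have "eval_hull \<subseteq> cball 0 1"
    unfolding eval_hull_def by (intro hull_minimal) auto
  then show "h \<in> eval_hull \<Longrightarrow> norm h \<le> 1"
    by auto
qed

lemma eval_hull_subset_span: "eval_hull \<subseteq> span (range ev)"
  unfolding eval_hull_def
  by (intro hull_minimal subspace_imp_convex subspace_span) (auto intro: span_base span_neg)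

section \<open>Approximating functionals by combinations of evaluations on finite sets\<close>

lemma subconvex_sum:
  fixes D :: "'v::real_vector set"
  assumes "convex D" "0 \<in> D" "finite I" "\<And>i. i \<in> I \<Longrightarrow> 0 \<le> a i" "\<And>i. i \<in> I \<Longrightarrow> x i \<in> D" "sum a I \<le> 1"
  shows "(\<Sum>i\<in>I. a i *\<^sub>R x i) \<in> D"
proof (cases "sum a I = 0")
  case True
  then have "\<forall>i\<in>I. a i = 0"
    using assms by (simp add: sum_nonneg_eq_0_iff)
  then show ?thesis
    using assms by simp
next
  case False
  then have pos: "0 < sum a I"
    using assms by (simp add: sum_nonneg order_less_le)
  have "(\<Sum>i\<in>I. (a i / sum a I) *\<^sub>R x i) \<in> D"
    using assms pos by (intro convex_sum) (auto simp flip: sum_divide_distrib)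
  then have "sum a I *\<^sub>R (\<Sum>i\<in>I. (a i / sum a I) *\<^sub>R x i) + (1 - sum a I) *\<^sub>R 0 \<in> D"
    using assms pos by (intro convexD) auto
  then show ?thesis
    using pos by (simp add: scaleR_right.sum)
qed

text \<open>Cut the index set into finitely many cells on which every \<open>w \<in> S\<close> is
  almost constant. Replacing \<open>w\<close> by a step function turns \<open>H\<close> into a
  combination of evaluations at one point \<open>z c\<close> per cell, with coefficients
  \<open>\<alpha> c = H (ind c)\<close> of total size at most 1.\<close>

lemma weak_approximation:
  fixes H :: "'a \<Rightarrow>\<^sub>L real"
  assumes H: "norm H \<le> 1" and S: "finite S" and e: "0 < e"
  shows "\<exists>h\<in>eval_hull. \<forall>w\<in>S. \<bar>blinfun_apply h w - blinfun_apply H w\<bar> < e"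
proof -
  \<comment> \<open>\<open>q y\<close> records the values at \<open>y\<close> of all
    \<open>w \<in> S\<close>, rounded down in units of \<open>e/2\<close>. Its range is finite, and
    two points with the same record differ by less than \<open>e/2\<close> under each
    \<open>w\<close>.\<close>
  define q where "q y = restrict (\<lambda>w. \<lfloor>ev y w / (e/2)\<rfloor>) S" for y
  have "range q \<subseteq> PiE S (\<lambda>w. {\<lfloor>- norm w / (e/2)\<rfloor>..\<lfloor>norm w / (e/2)\<rfloor>})"
  proof (rule image_subsetI, rule PiE_I)
    fix y w
    assume "w \<in> S"
    have "- norm w \<le> ev y w" "ev y w \<le> norm w"
      using ev_le_norm[of y w] by linarith+
    then have "- norm w / (e/2) \<le> ev y w / (e/2) \<and> ev y w / (e/2) \<le> norm w / (e/2)"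
      using e by (intro conjI divide_right_mono) auto
    from this[THEN conjunct1, THEN floor_mono] this[THEN conjunct2, THEN floor_mono] show "q y w \<in> {\<lfloor>- norm w / (e/2)\<rfloor>..\<lfloor>norm w / (e/2)\<rfloor>}"
      using \<open>w \<in> S\<close> by (simp add: q_def)
  qed (simp add: q_def)
  then have fin: "finite (range q)"
    by (rule finite_subset) (intro finite_PiE S finite_atLeastAtMost_int)
  define z where "z c = inv_into UNIV q c" for c
  have z: "q (z (q y)) = q y" for y
    by (simp add: z_def f_inv_into_f)
  have "\<exists>f. \<forall>y. ev y f = (if q y = c then 1 else 0)" for c
    by (rule ev_surj[of _ 1]) auto
  then obtain ind where ind: "\<And>c y. ev y (ind c) = (if q y = c then 1 else 0)"
    by metis
  have ev_sum: "ev y (\<Sum>c\<in>range q. a c *\<^sub>R ind c) = a (q y)" for a y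
    using fin by (simp add: blinfun.sum_right blinfun.scaleR_right ind if_distrib[of "\<lambda>x. _ * x"] sum.delta' cong: if_cong)
  define \<alpha> where "\<alpha> c = H (ind c)" for c
  \<comment> \<open>Testing \<open>H\<close> on the step function with value
    \<open>sgn (\<alpha> c)\<close> on the cell \<open>c\<close>, whose norm is at most 1, bounds
    the sum of the coefficients.\<close>
  have "(\<Sum>c\<in>range q. \<bar>\<alpha> c\<bar>) = H (\<Sum>c\<in>range q. sgn (\<alpha> c) *\<^sub>R ind c)"
    by (simp add: blinfun.sum_right blinfun.scaleR_right \<alpha>_def[symmetric] abs_sgn mult.commute)
  also have "\<dots> \<le> norm H * norm (\<Sum>c\<in>range q. sgn (\<alpha> c) *\<^sub>R ind c)"
    using norm_blinfun[of H "\<Sum>c\<in>range q. sgn (\<alpha> c) *\<^sub>R ind c"] by simp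
  also have "\<dots> \<le> 1 * 1"
    using H by (intro mult_mono norm_leI) (auto simp: ev_sum abs_sgn_eq)
  finally have sum_le: "(\<Sum>c\<in>range q. \<bar>\<alpha> c\<bar>) \<le> 1"
    by simp
  define h where "h = (\<Sum>c\<in>range q. \<bar>\<alpha> c\<bar> *\<^sub>R (sgn (\<alpha> c) *\<^sub>R ev (z c)))"
  have "h \<in> eval_hull"
    unfolding h_def
  proof (rule subconvex_sum[OF convex_eval_hull zero_in_eval_hull fin])
    show "sgn (\<alpha> c) *\<^sub>R ev (z c) \<in> eval_hull" for c
      using zero_in_eval_hull ev_in_eval_hull by (cases "\<alpha> c" "0 :: real" rule: linorder_cases) auto
  qed (use sum_le in auto)
  moreover have "\<bar>h w - H w\<bar> < e" if w: "w \<in> S" for w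
  proof -
    define v where "v = (\<Sum>c\<in>range q. ev (z c) w *\<^sub>R ind c)"
    have "norm (v - w) \<le> e/2"
    proof (rule norm_leI)
      fix y
      have "q (z (q y)) w = q y w"
        by (simp add: z)
      then have "\<lfloor>ev (z (q y)) w / (e/2)\<rfloor> = \<lfloor>ev y w / (e/2)\<rfloor>"
        using w by (simp add: q_def)
      then have "\<bar>ev (z (q y)) w / (e/2) - ev y w / (e/2)\<bar> < 1"
        by linarith
      then have "\<bar>(ev (z (q y)) w - ev y w) / (e/2)\<bar> < 1"
        by (simp only: diff_divide_distrib)
      then have "\<bar>ev (z (q y)) w - ev y w\<bar> < e/2"
        using e unfolding abs_divide by (simp add: pos_divide_less_eq)
      then show "\<bar>ev y (v - w)\<bar> \<le> e/2"
        by (simp add: v_def blinfun.diff_right ev_sum)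
    qed
    moreover have "h = (\<Sum>c\<in>range q. \<alpha> c *\<^sub>R ev (z c))"
      unfolding h_def by (intro sum.cong) (auto simp: sgn_if)
    then have "h w = H v"
      by (simp add: v_def blinfun.sum_left blinfun.sum_right blinfun.scaleR_left blinfun.scaleR_right
        mult.commute flip: \<alpha>_def)
    ultimately have "\<bar>h w - H w\<bar> \<le> norm H * (e/2)"
      using norm_blinfun[of H "v - w"] mult_left_mono[of "norm (v - w)" "e/2" "norm H"] by (simp add: blinfun.diff_right)
    also have "\<dots> \<le> 1 * (e/2)"
      using H e by (intro mult_right_mono) auto
    finally show ?thesis
      using e by simp
  qed
  ultimately show ?thesis
    by blast
qed

end

section \<open>Reflexivity from the interchange of double limits\<close>

locale reflexive_interpolation = bounded_function_space ev + interpolation "convex hull K"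
  for ev :: "'y \<Rightarrow> 'a::banach \<Rightarrow>\<^sub>L real" and K :: "'a set" +
  assumes dlp_K: "dlp K (range ev)"
begin

lemma dlp_uminus:
  fixes U :: "'a set"
  shows "dlp U Y \<Longrightarrow> dlp U (uminus ` Y)"
  unfolding double_limit_property_def
proof (intro allI impI)
  fix x :: "nat \<Rightarrow> 'a" and h :: "nat \<Rightarrow> 'a \<Rightarrow>\<^sub>L real" and u v a b
  assume dl: "\<forall>x h u v a b. (\<forall>n. x n \<in> U) \<longrightarrow> (\<forall>m. h m \<in> Y) \<longrightarrow>
      (\<forall>n. (\<lambda>m. blinfun_apply (h m) (x n)) \<longlonglongrightarrow> u n) \<longrightarrow> u \<longlonglongrightarrow> a \<longrightarrow>
      (\<forall>m. (\<lambda>n. blinfun_apply (h m) (x n)) \<longlonglongrightarrow> v m) \<longrightarrow> v \<longlonglongrightarrow> b \<longrightarrow> a = b"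
    and x: "\<forall>n. x n \<in> U" and h: "\<forall>m. h m \<in> uminus ` Y"
    and u: "\<forall>n. (\<lambda>m. h m (x n)) \<longlonglongrightarrow> u n" "u \<longlonglongrightarrow> a"
    and v: "\<forall>m. (\<lambda>n. h m (x n)) \<longlonglongrightarrow> v m" "v \<longlonglongrightarrow> b"
  have "\<forall>m. - h m \<in> Y"
    using h by (metis imageE minus_minus)
  moreover have "\<forall>n. (\<lambda>m. (- h m) (x n)) \<longlonglongrightarrow> - u n" "\<forall>m. (\<lambda>n. (- h m) (x n)) \<longlonglongrightarrow> - v m"
    using u(1) v(1) by (auto simp: blinfun.minus_left intro!: tendsto_minus)
  ultimately have "- a = - b"
    using dl x tendsto_minus[OF u(2)] tendsto_minus[OF v(2)] by meson
  then show "a = b"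
    by simp
qed

text \<open>A single point never violates the interchange, so \<open>f0\<close> may be adjoined to
  \<open>K\<close>. Approximations then hold at \<open>f0\<close> as well, although
  \<open>f0\<close> need not lie in \<open>E\<close>.\<close>

lemma dlp_eval_hull: "dlp (insert f0 K) eval_hull"
proof -
  have "dlp ({f0} \<union> K) (range ev \<union> uminus ` range ev)"
    by (intro double_limit_property_Un_left double_limit_property_singleton double_limit_property_Un_right
        dlp_uminus dlp_K)
  moreover have "\<bar>blinfun_apply h x\<bar> \<le> max 1 (norm f0)"
    if "x \<in> {f0} \<union> K" "h \<in> range ev \<union> uminus ` range ev" for x h
  proof -
    have "\<bar>blinfun_apply h x\<bar> \<le> norm x"
      using that(2) ev_le_norm by (auto simp: blinfun.minus_left)
    also have "norm x \<le> max 1 (norm f0)"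
      using that(1) norm_W[of x] hull_subset[of K convex] by auto
    finally show ?thesis .
  qed
  ultimately show ?thesis
    unfolding eval_hull_def insert_is_Un[of f0 K] by (rule double_limit_property_convex_hull)
qed

text \<open>Closeness on finite sets becomes uniform on \<open>insert f0 K\<close> and, being a
  convex condition, uniform on the hull of \<open>K\<close>. For \<open>f \<in> E\<close> a
  decomposition at level \<open>n\<close> splits \<open>f\<close> into a multiple of a hull element
  and a remainder of small ambient norm.\<close>

lemma unit_functional_approx:
  fixes H :: "'a \<Rightarrow>\<^sub>L real"
  assumes H: "norm H \<le> 1" and e: "0 < e"
  shows "\<exists>h\<in>eval_hull. (\<forall>f\<in>E. \<bar>H f - h f\<bar> \<le> e * Enorm f) \<and> \<bar>H f0 - h f0\<bar> \<le> e"
proof -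
  \<comment> \<open>The level \<open>n\<close> is fixed first, so that the remainder contributes at
    most \<open>e/2\<close> times \<open>Enorm f\<close>. The accuracy \<open>\<eta>\<close> on the
    hull then has to beat the factor \<open>2^n\<close> in the size of the multiple.\<close>
  obtain n :: nat where n: "(1/2::real)^n < e/8"
    using real_arch_pow_inv[of "e/8" "1/2"] e by auto
  define \<eta> where "\<eta> = min e (e / (4 * 2^n))"
  have \<eta>: "0 < \<eta>" "\<eta> \<le> e" "2^n * (2 * \<eta>) \<le> e/2"
  proof -
    show "0 < \<eta>" "\<eta> \<le> e"
      using e by (simp_all add: \<eta>_def)
    have "2^n * (2 * \<eta>) \<le> 2^n * (2 * (e / (4 * 2^n)))"
      by (intro mult_left_mono) (auto simp: \<eta>_def)
    then show "2^n * (2 * \<eta>) \<le> e/2"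
      by (simp add: field_simps)
  qed
  have B: "\<bar>blinfun_apply h x\<bar> \<le> max 1 (norm f0)" if "x \<in> insert f0 K" "h \<in> eval_hull" for x h
  proof -
    have "\<bar>blinfun_apply h x\<bar> \<le> norm h * norm x"
      using norm_blinfun[of h x] by simp
    also have "\<dots> \<le> 1 * norm x"
      using norm_eval_hull that(2) by (intro mult_right_mono) auto
    also have "1 * norm x \<le> max 1 (norm f0)"
      using that(1) norm_W[of x] hull_subset[of K convex] by auto
    finally show ?thesis .
  qed
  have "\<exists>h\<in>eval_hull. \<forall>x\<in>insert f0 K. \<bar>blinfun_apply h x - blinfun_apply H x\<bar> \<le> \<eta>"
    by (rule double_limit_property_uniform_approximation[OF convex_eval_hull dlp_eval_hull B])
      (use weak_approximation[OF H] \<eta> in auto)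
  then obtain h where h: "h \<in> eval_hull" "\<And>x. x \<in> insert f0 K \<Longrightarrow> \<bar>h x - H x\<bar> \<le> \<eta>"
    by blast
  have W: "\<bar>h w - H w\<bar> \<le> \<eta>" if "w \<in> convex hull K" for w
  proof -
    have "convex {w. \<bar>(h - H) w\<bar> \<le> \<eta>}"
    proof -
      have "{w. \<bar>(h - H) w\<bar> \<le> \<eta>} = blinfun_apply (h - H) -` {-\<eta>..\<eta>}"
        by auto
      then show ?thesis
        by (simp add: convex_linear_vimage blinfun.bounded_linear_right bounded_linear.linear)
    qed
    moreover have "K \<subseteq> {w. \<bar>(h - H) w\<bar> \<le> \<eta>}"
      using h(2) by (auto simp: blinfun.diff_left)
    ultimately have "convex hull K \<subseteq> {w. \<bar>(h - H) w\<bar> \<le> \<eta>}"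
      by (intro hull_minimal)
    then show ?thesis
      using that by (auto simp: blinfun.diff_left)
  qed
  have "\<bar>H f - h f\<bar> \<le> e * Enorm f" if f: "f \<in> E" for f
  proof (cases "f = 0")
    case False
    define c where "c = Enorm f"
    have c: "0 < c"
      using False Enorm_eq_0_iff[OF f] Enorm_nonneg[OF f] by (simp add: c_def)
    have "kfun n f < 2 * c"
      using kfun_le_Enorm[OF f, of n] c by (simp add: c_def)
    then obtain t w where tw: "0 \<le> t" "w \<in> convex hull K" "t / 2^n + 2^n * norm (f - t *\<^sub>R w) < 2 * c"
      by (rule kfun_lessE)
    have "0 \<le> 2^n * norm (f - t *\<^sub>R w)" "0 \<le> t / 2^n"
      using tw by auto
    then have "t / 2^n \<le> 2 * c" "2^n * norm (f - t *\<^sub>R w) \<le> 2 * c"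
      using tw by linarith+
    then have t: "t \<le> 2^n * (2 * c)" and d: "norm (f - t *\<^sub>R w) \<le> (1/2)^n * (2 * c)"
      by (auto simp: field_simps power_one_over)
    have "\<bar>(h - H) f\<bar> \<le> \<bar>(h - H) (t *\<^sub>R w)\<bar> + \<bar>(h - H) (f - t *\<^sub>R w)\<bar>"
      by (simp add: blinfun.diff_right)
    also have "\<bar>(h - H) (t *\<^sub>R w)\<bar> \<le> t * \<eta>"
      using W[OF tw(2)] tw(1) by (auto simp: blinfun.diff_left blinfun.scaleR_right abs_mult mult_left_mono simp flip: right_diff_distrib)
    also have "t * \<eta> \<le> 2^n * (2 * c) * \<eta>"
      using t \<eta> by (intro mult_right_mono) auto
    also have "\<dots> = 2^n * (2 * \<eta>) * c"
      by simp
    also have "\<dots> \<le> e/2 * c"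
      using \<eta>(3) c by (intro mult_right_mono) auto
    also have "\<bar>(h - H) (f - t *\<^sub>R w)\<bar> \<le> norm (h - H) * norm (f - t *\<^sub>R w)"
      using norm_blinfun[of "h - H" "f - t *\<^sub>R w"] by simp
    also have "\<dots> \<le> 2 * ((1/2)^n * (2 * c))"
      using norm_triangle_ineq4[of h H] norm_eval_hull[OF h(1)] H by (intro mult_mono d) auto
    also have "\<dots> \<le> 2 * (e/8 * (2 * c))"
      using n c by (intro mult_left_mono mult_right_mono) auto
    finally show ?thesis
      by (simp add: c_def blinfun.diff_left abs_minus_commute)
  qed simp
  moreover have "\<bar>H f0 - h f0\<bar> \<le> e"
    using h(2)[of f0] \<eta>(2) by simp
  ultimately show ?thesis
    using h(1) by blast
qed

lemma functional_approx:
  fixes H :: "'a \<Rightarrow>\<^sub>L real"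
  assumes "0 < e"
  shows "\<exists>\<mu>\<in>span (range ev). (\<forall>f\<in>E. \<bar>H f - blinfun_apply \<mu> f\<bar> \<le> e * Enorm f) \<and>
    \<bar>H f0 - blinfun_apply \<mu> f0\<bar> \<le> e"
proof -
  define c where "c = norm H + 1"
  have c: "0 < c"
    by (simp add: c_def add_nonneg_pos)
  have "norm ((1/c) *\<^sub>R H) \<le> 1"
    using c by (simp add: c_def divide_le_eq)
  moreover have "0 < e/c"
    using assms c by simp
  ultimately obtain h where h: "h \<in> eval_hull" "\<forall>f\<in>E. \<bar>((1/c) *\<^sub>R H) f - h f\<bar> \<le> e/c * Enorm f"
      "\<bar>((1/c) *\<^sub>R H) f0 - h f0\<bar> \<le> e/c"
    using unit_functional_approx[of "(1/c) *\<^sub>R H" "e/c" f0] by blast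
  have eq: "\<bar>H f - (c *\<^sub>R h) f\<bar> = c * \<bar>((1/c) *\<^sub>R H) f - h f\<bar>" for f
  proof -
    have "H f - (c *\<^sub>R h) f = c * (((1/c) *\<^sub>R H) f - h f)"
      using c by (simp add: blinfun.scaleR_left right_diff_distrib)
    then show ?thesis
      using c by (simp add: abs_mult)
  qed
  show ?thesis
  proof (intro bexI[of _ "c *\<^sub>R h"] conjI ballI)
    show "c *\<^sub>R h \<in> span (range ev)"
      using h(1) eval_hull_subset_span by (intro span_scale) auto
    show "\<bar>H f - (c *\<^sub>R h) f\<bar> \<le> e * Enorm f" if "f \<in> E" for f
      unfolding eq using mult_left_mono[OF bspec[OF h(2) that] less_imp_le[OF c]] c by simp
    show "\<bar>H f0 - (c *\<^sub>R h) f0\<bar> \<le> e"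
      unfolding eq using mult_left_mono[OF h(3) less_imp_le[OF c]] c by simp
  qed
qed

lemma Edual_add: "F \<in> Edual \<Longrightarrow> G \<in> Edual \<Longrightarrow> (\<lambda>f. F f + G f) \<in> Edual"
proof -
  assume F: "F \<in> Edual" and G: "G \<in> Edual"
  obtain C where C: "\<forall>f\<in>E. \<bar>F f\<bar> \<le> C * Enorm f"
    using F unfolding Edual_def by blast
  obtain D where D: "\<forall>f\<in>E. \<bar>G f\<bar> \<le> D * Enorm f"
    using G unfolding Edual_def by blast
  have "\<bar>F f + G f\<bar> \<le> (C + D) * Enorm f" if "f \<in> E" for f
    using bspec[OF C that] bspec[OF D that] by (simp add: distrib_right)
  then have "\<exists>C. \<forall>f\<in>E. \<bar>F f + G f\<bar> \<le> C * Enorm f"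
    by blast
  then show ?thesis
    using F G by (simp add: Edual_def distrib_left)
qed

lemma Edual_scale: "F \<in> Edual \<Longrightarrow> (\<lambda>f. c * F f) \<in> Edual"
proof -
  assume F: "F \<in> Edual"
  obtain C where C: "\<forall>f\<in>E. \<bar>F f\<bar> \<le> C * Enorm f"
    using F unfolding Edual_def by blast
  have "\<bar>c * F f\<bar> \<le> (\<bar>c\<bar> * C) * Enorm f" if "f \<in> E" for f
    using mult_left_mono[OF bspec[OF C that], of "\<bar>c\<bar>"] by (simp add: abs_mult mult.assoc)
  then have "\<exists>C. \<forall>f\<in>E. \<bar>c * F f\<bar> \<le> C * Enorm f"
    by blast
  then show ?thesis
    using F by (simp add: Edual_def distrib_left)
qed

text \<open>The vector is read off from the evaluations: \<open>f0\<close> has the value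
  \<open>\<Psi> (ev y)\<close> at \<open>y\<close>. Agreement extends from evaluations to their
  span, and by \<open>functional_approx\<close> to all ambient functionals. This bounds those
  dominated by \<open>Enorm\<close> at \<open>f0\<close> and so places \<open>f0\<close> in
  \<open>E\<close>; only then does the density of ambient functionals in \<open>Edual\<close>
  apply.\<close>

theorem bidual_representation:
  assumes add: "\<And>F G. F \<in> Edual \<Longrightarrow> G \<in> Edual \<Longrightarrow> \<Psi> (\<lambda>f. F f + G f) = \<Psi> F + \<Psi> G"
    and scale: "\<And>c F. F \<in> Edual \<Longrightarrow> \<Psi> (\<lambda>f. c * F f) = c * \<Psi> F"
    and bound: "\<And>C F. F \<in> Edual \<Longrightarrow> 0 \<le> C \<Longrightarrow> (\<And>f. f \<in> E \<Longrightarrow> \<bar>F f\<bar> \<le> C * Enorm f) \<Longrightarrow> \<bar>\<Psi> F\<bar> \<le> M * C"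
  shows "\<exists>f0\<in>E. \<forall>F\<in>Edual. \<Psi> F = F f0"
proof -
  have M: "0 \<le> M"
    using bound[of "blinfun_apply 0" 1] blinfun_in_Edual[of 0] Enorm_nonneg by fastforce
  have \<Psi>_diff: "\<bar>\<Psi> F - \<Psi> G\<bar> \<le> M * e"
    if F: "F \<in> Edual" and G: "G \<in> Edual" and "0 \<le> e" "\<And>f. f \<in> E \<Longrightarrow> \<bar>F f - G f\<bar> \<le> e * Enorm f" for F G e
  proof -
    have "\<Psi> (\<lambda>f. F f + - 1 * G f) = \<Psi> F - \<Psi> G"
      using add[OF F Edual_scale[OF G, of "-1"]] scale[OF G, of "-1"] by simp
    moreover have "\<bar>\<Psi> (\<lambda>f. F f + - 1 * G f)\<bar> \<le> M * e"
      using that by (intro bound Edual_add Edual_scale) auto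
    ultimately show ?thesis
      by simp
  qed
  have "\<bar>\<Psi> (ev y)\<bar> \<le> M" for y
  proof -
    have "\<bar>\<Psi> (ev y)\<bar> \<le> M * 1"
      using order_trans[OF ev_le_norm norm_le_Enorm] by (intro bound blinfun_in_Edual) auto
    then show ?thesis by simp
  qed
  then obtain f0 where f0: "\<And>y. ev y f0 = \<Psi> (ev y)"
    using ev_surj[of "\<lambda>y. \<Psi> (ev y)" M] by blast
  have span: "\<Psi> \<mu> = \<mu> f0" if "\<mu> \<in> span (range ev)" for \<mu>
    using that
  proof (induction rule: span_induct)
    case base
    have "\<Psi> (blinfun_apply 0) = 0"
      using scale[OF blinfun_in_Edual[of 0], of 0] by (simp add: zero_blinfun.rep_eq)
    moreover have "\<Psi> (blinfun_apply (\<mu> + \<nu>)) = \<Psi> \<mu> + \<Psi> \<nu>" for \<mu> \<nu> :: "'a \<Rightarrow>\<^sub>L real"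
      using add[OF blinfun_in_Edual blinfun_in_Edual] by (simp add: plus_blinfun.rep_eq)
    moreover have "\<Psi> (blinfun_apply (c *\<^sub>R \<mu>)) = c * \<Psi> \<mu>" for c and \<mu> :: "'a \<Rightarrow>\<^sub>L real"
      using scale[OF blinfun_in_Edual] by (simp add: scaleR_blinfun.rep_eq)
    ultimately show ?case
      by (intro subspaceI) (auto simp: blinfun.add_left blinfun.scaleR_left)
  next
    case (step \<mu>)
    then show ?case
      using f0 by auto
  qed
  have \<Psi>_blinfun: "\<Psi> H = H f0" for H :: "'a \<Rightarrow>\<^sub>L real"
  proof -
    have "\<bar>\<Psi> H - H f0\<bar> \<le> 0 + e" if "0 < e" for e
    proof -
      have "0 < e / (M + 1)"
        using that M by simp
      then obtain \<mu> where \<mu>: "\<mu> \<in> span (range ev)" "\<forall>f\<in>E. \<bar>H f - blinfun_apply \<mu> f\<bar> \<le> e / (M + 1) * Enorm f"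
        "\<bar>H f0 - blinfun_apply \<mu> f0\<bar> \<le> e / (M + 1)"
        using functional_approx by blast
      have "\<bar>\<Psi> H - \<Psi> \<mu>\<bar> \<le> M * (e / (M + 1))"
        using M that \<mu>(2) by (intro \<Psi>_diff blinfun_in_Edual) auto
      then have "\<bar>\<Psi> H - H f0\<bar> \<le> M * (e / (M + 1)) + e / (M + 1)"
        using \<mu>(3) span[OF \<mu>(1)] by linarith
      also have "\<dots> = (M + 1) * (e / (M + 1))"
        by (simp add: algebra_simps add_divide_distrib)
      finally show ?thesis
        using M by simp
    qed
    then show ?thesis
      using field_le_epsilon[of "\<bar>\<Psi> H - H f0\<bar>" 0] by simp
  qed
  have f0_E: "f0 \<in> E"
  proof (rule E_norming_functional)
    fix H :: "'a \<Rightarrow>\<^sub>L real"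
    assume "\<And>f. f \<in> E \<Longrightarrow> \<bar>H f\<bar> \<le> Enorm f"
    then have "\<bar>\<Psi> H\<bar> \<le> M * 1"
      by (intro bound blinfun_in_Edual) auto
    then show "H f0 \<le> M"
      by (simp add: \<Psi>_blinfun)
  qed
  have "\<Psi> F = F f0" if F: "F \<in> Edual" for F
  proof -
    have "\<bar>\<Psi> F - F f0\<bar> \<le> 0 + e" if "0 < e" for e
    proof -
      define c where "c = M + Enorm f0 + 1"
      have c: "0 < c"
        using M Enorm_nonneg[OF f0_E] by (simp add: c_def)
      then have "0 < e / c"
        using that by simp
      then obtain G :: "'a \<Rightarrow>\<^sub>L real" where G: "\<And>f. f \<in> E \<Longrightarrow> \<bar>F f - G f\<bar> \<le> e / c * Enorm f"
        by (rule Edual_approx_by_blinfun[OF F]) auto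
      have "\<bar>\<Psi> F - \<Psi> G\<bar> \<le> M * (e / c)"
        using c that by (intro \<Psi>_diff blinfun_in_Edual G F) auto
      then have "\<bar>\<Psi> F - F f0\<bar> \<le> M * (e / c) + e / c * Enorm f0"
        using G[OF f0_E] \<Psi>_blinfun[of G] by linarith
      also have "\<dots> = (M + Enorm f0) * (e / c)"
        by (metis distrib_right mult.commute)
      also have "\<dots> \<le> c * (e / c)"
        using c that by (intro mult_right_mono) (auto simp: c_def)
      finally show ?thesis
        using c by simp
    qed
    then show ?thesis
      using field_le_epsilon[of "\<bar>\<Psi> F - F f0\<bar>" 0] by simp
  qed
  then show ?thesis
    using f0_E by blast
qed

end

section \<open>Double limits of stable ecarts\<close>

text \<open>Keeps the two iterated limits as separate values, so that limit arithmetic is available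
  before they are known to agree.\<close>

definition double_limits :: "(nat \<Rightarrow> nat \<Rightarrow> real) \<Rightarrow> real \<Rightarrow> real \<Rightarrow> bool" where
  "double_limits k a b \<longleftrightarrow> (\<exists>u v. (\<forall>n. (\<lambda>m. k n m) \<longlonglongrightarrow> u n) \<and> u \<longlonglongrightarrow> a \<and> (\<forall>m. (\<lambda>n. k n m) \<longlonglongrightarrow> v m) \<and> v \<longlonglongrightarrow> b)"

lemma double_limitsI:
  "(\<And>n. (\<lambda>m. k n m) \<longlonglongrightarrow> u n) \<Longrightarrow> u \<longlonglongrightarrow> a \<Longrightarrow> (\<And>m. (\<lambda>n. k n m) \<longlonglongrightarrow> v m) \<Longrightarrow> v \<longlonglongrightarrow> b \<Longrightarrow>
    double_limits k a b"
  unfolding double_limits_def by blast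

lemma double_limit_property_iff:
  "double_limit_property k U Y \<longleftrightarrow>
     (\<forall>x y a b. (\<forall>n. x n \<in> U) \<longrightarrow> (\<forall>m. y m \<in> Y) \<longrightarrow> double_limits (\<lambda>n m. k (x n) (y m)) a b \<longrightarrow> a = b)"
  unfolding double_limit_property_def double_limits_def by blast

lemma double_limits_unique: "double_limits k a b \<Longrightarrow> double_limits k a' b' \<Longrightarrow> a = a' \<and> b = b'"
proof -
  assume k: "double_limits k a b" "double_limits k a' b'"
  obtain u v where uv: "\<And>n. (\<lambda>m. k n m) \<longlonglongrightarrow> u n" "u \<longlonglongrightarrow> a" "\<And>m. (\<lambda>n. k n m) \<longlonglongrightarrow> v m" "v \<longlonglongrightarrow> b"
    using k(1) unfolding double_limits_def by auto
  obtain u' v' where uv': "\<And>n. (\<lambda>m. k n m) \<longlonglongrightarrow> u' n" "u' \<longlonglongrightarrow> a'" "\<And>m. (\<lambda>n. k n m) \<longlonglongrightarrow> v' m" "v' \<longlonglongrightarrow> b'"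
    using k(2) unfolding double_limits_def by auto
  have "u' = u" "v' = v"
    using LIMSEQ_unique uv uv' by blast+
  then show ?thesis
    using uv(2,4) uv'(2,4) LIMSEQ_unique by blast
qed

lemma double_limits_subseq:
  assumes "double_limits k a b" "strict_mono r" "strict_mono s"
  shows "double_limits (\<lambda>n m. k (r n) (s m)) a b"
proof -
  obtain u v where uv: "\<And>n. (\<lambda>m. k n m) \<longlonglongrightarrow> u n" "u \<longlonglongrightarrow> a" "\<And>m. (\<lambda>n. k n m) \<longlonglongrightarrow> v m" "v \<longlonglongrightarrow> b"
    using assms(1) unfolding double_limits_def by auto
  show ?thesis
  proof (rule double_limitsI[where u = "\<lambda>n. u (r n)" and v = "\<lambda>m. v (s m)"])
    show "(\<lambda>m. k (r n) (s m)) \<longlonglongrightarrow> u (r n)" for n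
      using LIMSEQ_subseq_LIMSEQ[OF uv(1) assms(3)] by (simp add: comp_def)
    show "(\<lambda>n. k (r n) (s m)) \<longlonglongrightarrow> v (s m)" for m
      using LIMSEQ_subseq_LIMSEQ[OF uv(3) assms(2)] by (simp add: comp_def)
    show "(\<lambda>n. u (r n)) \<longlonglongrightarrow> a" "(\<lambda>n. v (s n)) \<longlonglongrightarrow> b"
      using LIMSEQ_subseq_LIMSEQ[OF uv(2) assms(2)] LIMSEQ_subseq_LIMSEQ[OF uv(4) assms(3)] by (simp_all add: comp_def)
  qed
qed

lemma double_limits_swap: "double_limits k a b \<Longrightarrow> double_limits (\<lambda>m n. k n m) b a"
  unfolding double_limits_def by blast

lemma double_limits_diff:
  assumes "double_limits k a b" "double_limits k' a' b'"
  shows "double_limits (\<lambda>n m. k n m - k' n m) (a - a') (b - b')"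
proof -
  obtain u v where uv: "\<And>n. (\<lambda>m. k n m) \<longlonglongrightarrow> u n" "u \<longlonglongrightarrow> a" "\<And>m. (\<lambda>n. k n m) \<longlonglongrightarrow> v m" "v \<longlonglongrightarrow> b"
    using assms(1) unfolding double_limits_def by auto
  obtain u' v' where uv': "\<And>n. (\<lambda>m. k' n m) \<longlonglongrightarrow> u' n" "u' \<longlonglongrightarrow> a'" "\<And>m. (\<lambda>n. k' n m) \<longlonglongrightarrow> v' m" "v' \<longlonglongrightarrow> b'"
    using assms(2) unfolding double_limits_def by auto
  show ?thesis
    by (rule double_limitsI[where u = "\<lambda>n. u n - u' n" and v = "\<lambda>m. v m - v' m"]) (intro tendsto_diff uv uv')+
qed

lemma double_limits_min:
  assumes "double_limits k a b"
  shows "double_limits (\<lambda>n m. min (k n m) R) (min a R) (min b R)"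
proof -
  obtain u v where uv: "\<And>n. (\<lambda>m. k n m) \<longlonglongrightarrow> u n" "u \<longlonglongrightarrow> a" "\<And>m. (\<lambda>n. k n m) \<longlonglongrightarrow> v m" "v \<longlonglongrightarrow> b"
    using assms unfolding double_limits_def by auto
  show ?thesis
    by (rule double_limitsI[where u = "\<lambda>n. min (u n) R" and v = "\<lambda>m. min (v m) R"]) (intro tendsto_min tendsto_const uv)+
qed

lemma double_limits_mult_row:
  assumes "double_limits k a b" and c: "c \<longlonglongrightarrow> l"
  shows "double_limits (\<lambda>n m. c n * k n m) (l * a) (l * b)"
proof -
  obtain u v where uv: "\<And>n. (\<lambda>m. k n m) \<longlonglongrightarrow> u n" "u \<longlonglongrightarrow> a" "\<And>m. (\<lambda>n. k n m) \<longlonglongrightarrow> v m" "v \<longlonglongrightarrow> b"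
    using assms(1) unfolding double_limits_def by auto
  show ?thesis
    by (rule double_limitsI[where u = "\<lambda>n. c n * u n" and v = "\<lambda>m. l * v m"]) (intro tendsto_mult tendsto_const uv c)+
qed

lemma double_limits_subseq_exist:
  fixes k :: "nat \<Rightarrow> nat \<Rightarrow> real"
  assumes "\<And>n m. \<bar>k n m\<bar> \<le> B"
  obtains r s a b where "strict_mono r" "strict_mono s" "double_limits (\<lambda>n m. k (r n) (s m)) a b"
proof (rule double_limit_subseq[where k = k, OF assms])
  fix r s u v a b
  assume *: "strict_mono r" "strict_mono s"
    "\<And>n. (\<lambda>m. k (r n) (s m)) \<longlonglongrightarrow> u n" "u \<longlonglongrightarrow> a"
    "\<And>m. (\<lambda>n. k (r n) (s m)) \<longlonglongrightarrow> v m" "v \<longlonglongrightarrow> b"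
  show thesis
    by (rule that[OF *(1,2) double_limitsI[OF *(3-6)]])
qed

text \<open>Handles the degenerate regimes of the kernel: a bound that is uniform in
  \<open>m\<close> and tends to 0 with \<open>n\<close> annihilates both iterated limits.\<close>

lemma double_limits_null:
  assumes k: "double_limits k a b" and le: "\<And>n m. \<bar>k n m\<bar> \<le> \<rho> n" and \<rho>: "\<rho> \<longlonglongrightarrow> 0"
  shows "a = 0" "b = 0"
proof -
  obtain u v where uv: "\<And>n. (\<lambda>m. k n m) \<longlonglongrightarrow> u n" "u \<longlonglongrightarrow> a" "\<And>m. (\<lambda>n. k n m) \<longlonglongrightarrow> v m" "v \<longlonglongrightarrow> b"
    using k unfolding double_limits_def by auto
  have "norm (u n) \<le> \<rho> n" for n
    using le by (intro tendsto_upperbound[OF tendsto_norm[OF uv(1)]]) auto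
  then have "u \<longlonglongrightarrow> 0"
    by (intro Lim_null_comparison[OF _ \<rho>]) simp
  then show "a = 0"
    using uv(2) LIMSEQ_unique by blast
  have "(\<lambda>n. k n m) \<longlonglongrightarrow> 0" for m
    using le by (intro Lim_null_comparison[OF _ \<rho>]) simp
  then have "v = (\<lambda>_. 0)"
    using uv(3) LIMSEQ_unique by blast
  then show "b = 0"
    using uv(4) by (simp add: LIMSEQ_const_iff)
qed

lemma bounded_or_subseq_at_top:
  fixes s :: "nat \<Rightarrow> real"
  obtains B where "\<And>n. s n \<le> B" | r where "strict_mono r" "filterlim (\<lambda>n. s (r n)) at_top sequentially"
proof (cases "\<exists>B. \<forall>n. s n \<le> B")
  case False
  have freq: "\<exists>n>N. B < s n" for N B
  proof (rule ccontr)
    assume "\<not> ?thesis"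
    then have "s n \<le> max B (Max (s ` {..N}))" for n
      by (cases "n \<le> N") (auto simp: le_max_iff_disj not_less intro!: Max_ge)
    then show False
      using False by blast
  qed
  have "\<exists>r. \<forall>n. real n < s (r n) \<and> r n < r (Suc n)"
    by (rule dependent_nat_choice[where P = "\<lambda>n x. real n < s x" and Q = "\<lambda>n x y. x < y"]) (use freq in auto)
  then obtain r where r: "\<And>n. real n < s (r n)" "\<And>n. r n < r (Suc n)"
    by blast
  have "filterlim (\<lambda>n. s (r n)) at_top sequentially"
    by (rule filterlim_at_top_mono[OF filterlim_real_sequentially]) (simp add: less_imp_le[OF r(1)])
  then show ?thesis
    using that(2) r(2) by (auto simp: strict_mono_Suc_iff)
qed (use that in blast)

definition truncated_diff :: "('x \<Rightarrow> 'x \<Rightarrow> real) \<Rightarrow> 'x \<Rightarrow> 'x \<Rightarrow> nat \<times> 'x \<Rightarrow> real" where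
  "truncated_diff d x x' p = (1/8)^fst p * (min (d x (snd p)) (16^fst p) - min (d x' (snd p)) (16^fst p))"

context
  fixes d :: "'x \<Rightarrow> 'x \<Rightarrow> real"
  assumes d: "ecart d"
begin

lemma ecartD:
  shows ecart_nonneg: "0 \<le> d x y" and ecart_refl: "d x x = 0" and ecart_sym: "d x y = d y x"
    and ecart_triangle: "d x z \<le> d x y + d y z"
  using d by (auto simp: ecart_def)

lemma ecart_triangle_abs: "\<bar>d x z - d y z\<bar> \<le> d x y"
  using ecart_triangle[of x z y] ecart_triangle[of y z x] ecart_sym[of x y] by auto

text \<open>Truncated distances from \<open>x n\<close> to a fixed point are eventually
  \<open>R\<close>, so \<open>b = R\<close>. For the other order, either \<open>y\<close> is bounded
  and the distances become large uniformly in \<open>m\<close>, or a subsequence of \<open>y\<close>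
  goes to infinity and the same observation applies to it.\<close>

lemma double_limits_truncated_unbounded:
  assumes x: "filterlim (\<lambda>n. d (x n) o') at_top sequentially"
    and k: "double_limits (\<lambda>n m. min (d (x n) (y m)) R) a b"
  shows "a = b"
proof -
  obtain u v where uv: "\<And>n. (\<lambda>m. min (d (x n) (y m)) R) \<longlonglongrightarrow> u n" "u \<longlonglongrightarrow> a"
    "\<And>m. (\<lambda>n. min (d (x n) (y m)) R) \<longlonglongrightarrow> v m" "v \<longlonglongrightarrow> b"
    using k unfolding double_limits_def by auto
  have limR: "(\<lambda>n. min (d (z n) w) R) \<longlonglongrightarrow> R" if z: "filterlim (\<lambda>n. d (z n) o') at_top sequentially" for z w
  proof (rule tendsto_eventually)
    have "\<forall>\<^sub>F n in sequentially. R + d w o' \<le> d (z n) o'"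
      using z unfolding filterlim_at_top by blast
    then show "\<forall>\<^sub>F n in sequentially. min (d (z n) w) R = R"
    proof eventually_elim
      case (elim n)
      then show ?case
        using ecart_triangle[of "z n" o' w] by simp
    qed
  qed
  have "v = (\<lambda>_. R)"
    using uv(3) limR[OF x] LIMSEQ_unique by blast
  then have b: "b = R"
    using uv(4) by (simp add: LIMSEQ_const_iff)
  have "a = R"
  proof (rule bounded_or_subseq_at_top[of "\<lambda>m. d (y m) o'"])
    fix B
    assume B: "\<And>m. d (y m) o' \<le> B"
    have u_ge: "min (d (x n) o' - B) R \<le> u n" for n
    proof (rule tendsto_lowerbound[OF uv(1)])
      have "min (d (x n) o' - B) R \<le> min (d (x n) (y m)) R" for m
        using ecart_triangle[of "x n" o' "y m"] B[of m] by linarith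
      then show "\<forall>\<^sub>F m in sequentially. min (d (x n) o' - B) R \<le> min (d (x n) (y m)) R"
        by simp
    qed simp
    have u_le: "u n \<le> R" for n
      by (rule tendsto_upperbound[OF uv(1)]) auto
    have "\<forall>\<^sub>F n in sequentially. R + B \<le> d (x n) o'"
      using x unfolding filterlim_at_top by blast
    then have "\<forall>\<^sub>F n in sequentially. u n = R"
    proof eventually_elim
      case (elim n)
      then show ?case
        using u_ge[of n] u_le[of n] by linarith
    qed
    then have "u \<longlonglongrightarrow> R"
      by (rule tendsto_eventually)
    then show "a = R"
      using uv(2) LIMSEQ_unique by blast
  next
    fix s :: "nat \<Rightarrow> nat"
    assume s: "strict_mono s" "filterlim (\<lambda>m. d (y (s m)) o') at_top sequentially"
    have "(\<lambda>m. min (d (x n) (y (s m))) R) \<longlonglongrightarrow> u n" for n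
      using LIMSEQ_subseq_LIMSEQ[OF uv(1) s(1)] by (simp add: comp_def)
    moreover have "(\<lambda>m. min (d (x n) (y (s m))) R) \<longlonglongrightarrow> R" for n
      using limR[OF s(2), of "x n"] by (simp add: ecart_sym)
    ultimately have "u = (\<lambda>_. R)"
      using LIMSEQ_unique by blast
    then show "a = R"
      using uv(2) by (simp add: LIMSEQ_const_iff)
  qed
  then show ?thesis
    using b by simp
qed

text \<open>If one of the sequences is unbounded, the escaping case applies, with the roles
  exchanged if necessary. If both are bounded, a subsequence has untruncated double limits;
  stability equates them and truncation is continuous.\<close>

lemma double_limits_truncated:
  assumes stable: "stable_ecart d" and k: "double_limits (\<lambda>n m. min (d (x n) (y m)) R) a b"
  shows "a = b"
proof (rule bounded_or_subseq_at_top[of "\<lambda>n. d (x n) undefined"])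
  fix r :: "nat \<Rightarrow> nat"
  assume r: "strict_mono r" "filterlim (\<lambda>n. d (x (r n)) undefined) at_top sequentially"
  then show "a = b"
    using double_limits_truncated_unbounded[OF r(2), of y R a b] double_limits_subseq[OF k r(1), of "\<lambda>m. m"]
    by (simp add: strict_mono_def)
next
  fix B
  assume B: "\<And>n. d (x n) undefined \<le> B"
  show "a = b"
  proof (rule bounded_or_subseq_at_top[of "\<lambda>n. d (y n) undefined"])
    fix s :: "nat \<Rightarrow> nat"
    assume s: "strict_mono s" "filterlim (\<lambda>n. d (y (s n)) undefined) at_top sequentially"
    have "double_limits (\<lambda>m n. min (d (y (s m)) (x n)) R) b a"
      using double_limits_swap[OF double_limits_subseq[OF k _ s(1), of "\<lambda>n. n"]] by (simp add: strict_mono_def ecart_sym)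
    then show "a = b"
      using double_limits_truncated_unbounded[OF s(2), of x R b a] by simp
  next
    fix C
    assume C: "\<And>n. d (y n) undefined \<le> C"
    have "\<bar>d (x n) (y m)\<bar> \<le> B + C" for n m
      using ecart_triangle[of "x n" "y m" undefined] ecart_sym[of undefined "y m"] B[of n] C[of m] ecart_nonneg[of "x n" "y m"]
      by linarith
    then obtain r s a' b' where rs: "strict_mono r" "strict_mono s" and k': "double_limits (\<lambda>n m. d (x (r n)) (y (s m))) a' b'"
      by (rule double_limits_subseq_exist)
    have "a' = b'"
    proof -
      obtain u v where uv: "\<And>n. (\<lambda>m. d (x (r n)) (y (s m))) \<longlonglongrightarrow> u n" "u \<longlonglongrightarrow> a'"
        "\<And>m. (\<lambda>n. d (x (r n)) (y (s m))) \<longlonglongrightarrow> v m" "v \<longlonglongrightarrow> b'"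
        using k' unfolding double_limits_def by auto
      show ?thesis
        by (rule stable[unfolded stable_ecart_def, rule_format, OF uv])
    qed
    moreover have "min a' R = a \<and> min b' R = b"
      by (rule double_limits_unique[OF double_limits_min[OF k'] double_limits_subseq[OF k rs]])
    ultimately show "a = b"
      by auto
  qed
qed

lemma truncated_diff_le: "\<bar>truncated_diff d x x' p\<bar> \<le> (1/8)^fst p * min (d x x') (16^fst p)"
proof -
  have "\<bar>min (d x z) R - min (d x' z) R\<bar> \<le> min (d x x') R" if "0 \<le> R" for z R
    using ecart_triangle_abs[of x z x'] ecart_nonneg[of x z] ecart_nonneg[of x' z] ecart_nonneg[of x x'] that
    by (auto simp: min_def abs_le_iff)
  from mult_left_mono[OF this[of "16^fst p" "snd p"], of "(1/8)^fst p"] show ?thesis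
    by (simp add: truncated_diff_def abs_mult)
qed

lemma truncated_diff_le_sqrt: "\<bar>truncated_diff d x x' p\<bar> \<le> (1/2)^fst p * sqrt (d x x')"
proof -
  \<comment> \<open>With \<open>R = 4^k\<close> and \<open>t\<close> the root of the distance,
    \<open>min (t\<^sup>2) (R\<^sup>2) \<le> t * R\<close>, and the weight turns \<open>R\<close>
    into \<open>(1/2)^k\<close>.\<close>
  define R :: real where "R = 4^fst p"
  have R: "0 < R" "16^fst p = R\<^sup>2"
    by (auto simp: R_def power2_eq_square simp flip: power_mult_distrib)
  define t where "t = sqrt (d x x')"
  have t: "0 \<le> t" "d x x' = t\<^sup>2"
    using ecart_nonneg by (auto simp: t_def)
  have "min (t\<^sup>2) (R\<^sup>2) \<le> t * R"
  proof (cases "t \<le> R")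
    case True
    then have "t * t \<le> t * R"
      using t by (intro mult_left_mono)
    then show ?thesis
      by (simp add: power2_eq_square min_le_iff_disj)
  next
    case False
    then have "R * R \<le> t * R"
      using R by (intro mult_right_mono) auto
    then show ?thesis
      by (simp add: power2_eq_square min_le_iff_disj)
  qed
  then have "(1/8)^fst p * min (d x x') (16^fst p) \<le> (1/8)^fst p * (t * R)"
    unfolding R t by (intro mult_left_mono) auto
  also have "\<dots> = (1/2)^fst p * t"
    by (simp add: R_def mult.commute mult.left_commute flip: power_mult_distrib)
  finally show ?thesis
    using truncated_diff_le[of x x' p] unfolding t_def by linarith
qed

text \<open>If the levels are unbounded, both limits are 0. Otherwise one level \<open>i\<close>
  recurs infinitely often. Along it, denominators that tend to 0 or to infinity again give 0 on both
  sides, and a positive limit of the denominators reduces the claim to two truncated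
  distances.\<close>

lemma double_limit_property_kernel:
  assumes stable: "stable_ecart d"
  shows "double_limit_property (\<lambda>(x, x') p. truncated_diff d x x' p / sqrt (d x x')) UNIV UNIV"
  unfolding double_limit_property_iff
proof (intro allI impI)
  fix z :: "nat \<Rightarrow> 'x \<times> 'x" and q :: "nat \<Rightarrow> nat \<times> 'x" and a b
  define x where "x n = fst (z n)" for n
  define x' where "x' n = snd (z n)" for n
  define t where "t n = sqrt (d (x n) (x' n))" for n
  assume "double_limits (\<lambda>n m. (\<lambda>(x, x') p. truncated_diff d x x' p / sqrt (d x x')) (z n) (q m)) a b"
  then have k: "double_limits (\<lambda>n m. truncated_diff d (x n) (x' n) (q m) / t n) a b"
    by (simp add: x_def x'_def t_def case_prod_beta)
  have t: "0 \<le> t n" for n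
    using ecart_nonneg by (simp add: t_def)
  \<comment> \<open>Where the denominator is 0 the quotient is 0 by convention, so the bound holds
    for all \<open>n\<close>.\<close>
  have le1: "\<bar>truncated_diff d (x n) (x' n) (q m) / t n\<bar> \<le> (1/2)^fst (q m)" for n m
    using truncated_diff_le_sqrt[of "x n" "x' n" "q m"] t[of n] by (cases "t n = 0") (auto simp: t_def abs_divide divide_le_eq)
  show "a = b"
  proof (rule bounded_or_subseq_at_top[of "\<lambda>m. real (fst (q m))"])
    fix s :: "nat \<Rightarrow> nat"
    assume s: "strict_mono s" "filterlim (\<lambda>m. real (fst (q (s m)))) at_top sequentially"
    have N: "double_limits (\<lambda>m n. truncated_diff d (x n) (x' n) (q (s m)) / t n) b a"
      using double_limits_swap[OF double_limits_subseq[OF k _ s(1), of "\<lambda>n. n"]] by (simp add: strict_mono_def)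
    have Z: "(\<lambda>m. (1/2::real)^fst (q (s m))) \<longlonglongrightarrow> 0"
    proof -
      have "filterlim (\<lambda>m. fst (q (s m))) at_top sequentially"
        using s(2) by (simp add: filterlim_sequentially_iff_filterlim_real)
      then show ?thesis
        using filterlim_compose[OF LIMSEQ_realpow_zero[of "1/2::real"]] by simp
    qed
    show "a = b"
      using double_limits_null[OF N le1 Z] by simp
  next
    fix B
    assume B: "\<And>m. real (fst (q m)) \<le> B"
    have "range (\<lambda>m. fst (q m)) \<subseteq> {..nat \<lfloor>B\<rfloor>}"
      using B by (auto simp: le_nat_floor)
    then have "finite (range (\<lambda>m. fst (q m)))"
      using finite_subset by blast
    then obtain j where "infinite {m. fst (q m) = fst (q j)}"
      using pigeonhole_infinite[of "UNIV :: nat set" "\<lambda>m. fst (q m)"] by auto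
    then obtain s where s: "strict_mono (s :: nat \<Rightarrow> nat)" "\<And>m. fst (q (s m)) = fst (q j)"
      using infinite_enumerate by blast
    define i where "i = fst (q j)"
    define y where "y m = snd (q (s m))" for m
    have k2: "double_limits (\<lambda>n m. truncated_diff d (x n) (x' n) (i, y m) / t n) a b"
      using double_limits_subseq[OF k _ s(1), of "\<lambda>n. n"] s(2)
      by (simp add: strict_mono_def i_def y_def truncated_diff_def)
    \<comment> \<open>The first bound is for denominators tending to 0, the second for denominators
      tending to infinity.\<close>
    have le: "\<bar>truncated_diff d (x n) (x' n) (i, y m) / t n\<bar> \<le> t n" "\<bar>truncated_diff d (x n) (x' n) (i, y m) / t n\<bar> \<le> 16^i / t n" for n m
    proof -
      have "(1/8)^i * min (d (x n) (x' n)) (16^i) \<le> 1 * min (d (x n) (x' n)) (16^i)"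
        using ecart_nonneg by (intro mult_right_mono power_le_one) auto
      then have "\<bar>truncated_diff d (x n) (x' n) (i, y m)\<bar> \<le> t n * t n" "\<bar>truncated_diff d (x n) (x' n) (i, y m)\<bar> \<le> 16^i"
        using truncated_diff_le[of "x n" "x' n" "(i, y m)"] ecart_nonneg by (auto simp: t_def)
      then show "\<bar>truncated_diff d (x n) (x' n) (i, y m) / t n\<bar> \<le> t n" "\<bar>truncated_diff d (x n) (x' n) (i, y m) / t n\<bar> \<le> 16^i / t n"
        using t[of n] by (auto simp: abs_divide intro: divide_right_mono) (cases "t n = 0"; simp add: divide_le_eq)
    qed
    show "a = b"
    proof (rule bounded_or_subseq_at_top[of t])
      fix r :: "nat \<Rightarrow> nat"
      assume r: "strict_mono r" "filterlim (\<lambda>n. t (r n)) at_top sequentially"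
      have N: "double_limits (\<lambda>n m. truncated_diff d (x (r n)) (x' (r n)) (i, y m) / t (r n)) a b"
        using double_limits_subseq[OF k2 r(1), of "\<lambda>m. m"] by (simp add: strict_mono_def)
      have Z: "(\<lambda>n. 16^i / t (r n)) \<longlonglongrightarrow> 0"
        using r(2) by (intro tendsto_divide_0[OF tendsto_const] filterlim_at_top_imp_at_infinity)
      show "a = b"
        using double_limits_null[OF N le(2) Z] by simp
    next
      fix C
      assume "\<And>n. t n \<le> C"
      then have "\<bar>t n\<bar> \<le> C" for n
        using t[of n] by simp
      then obtain r l where r: "strict_mono r" "(\<lambda>n. t (r n)) \<longlonglongrightarrow> l"
        by (rule convergent_subseq_bounded)
      have k3: "double_limits (\<lambda>n m. truncated_diff d (x (r n)) (x' (r n)) (i, y m) / t (r n)) a b"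
        using double_limits_subseq[OF k2 r(1), of "\<lambda>m. m"] by (simp add: strict_mono_def)
      show "a = b"
      proof (cases "l = 0")
        case True
        then have "(\<lambda>n. t (r n)) \<longlonglongrightarrow> 0"
          using r(2) by simp
        from double_limits_null[OF k3 le(1) this] show ?thesis
          by simp
      next
        case False
        have bdd: "\<bar>min (d w (y m)) (16^i)\<bar> \<le> 16^i" for w m
          using ecart_nonneg[of w "y m"] by (auto simp: min_def)
        obtain r1 s1 a1 b1 where 1: "strict_mono r1" "strict_mono s1"
          "double_limits (\<lambda>n m. min (d (x (r (r1 n))) (y (s1 m))) (16^i)) a1 b1"
          by (rule double_limits_subseq_exist[of "\<lambda>n m. min (d (x (r n)) (y m)) (16^i)"]) (rule bdd)
        obtain r2 s2 a2 b2 where 2: "strict_mono r2" "strict_mono s2"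
          "double_limits (\<lambda>n m. min (d (x' (r (r1 (r2 n)))) (y (s1 (s2 m)))) (16^i)) a2 b2"
          by (rule double_limits_subseq_exist[of "\<lambda>n m. min (d (x' (r (r1 n))) (y (s1 m))) (16^i)"]) (rule bdd)
        have eq: "a1 = b1" "a2 = b2"
          using double_limits_truncated[OF stable 1(3)] double_limits_truncated[OF stable 2(3)] by auto
        have r12: "strict_mono (\<lambda>n. r1 (r2 n))" "strict_mono (\<lambda>n. s1 (s2 n))"
          using 1 2 by (auto simp: strict_mono_def)
        have "(\<lambda>n. t (r (r1 (r2 n)))) \<longlonglongrightarrow> l"
          using LIMSEQ_subseq_LIMSEQ[OF r(2) r12(1)] by (simp add: comp_def)
        then have c: "(\<lambda>n. (1/8)^i / t (r (r1 (r2 n)))) \<longlonglongrightarrow> (1/8)^i / l"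
          using False by (intro tendsto_intros)
        have "double_limits (\<lambda>n m. (1/8)^i / t (r (r1 (r2 n))) *
            (min (d (x (r (r1 (r2 n)))) (y (s1 (s2 m)))) (16^i) - min (d (x' (r (r1 (r2 n)))) (y (s1 (s2 m)))) (16^i)))
            ((1/8)^i / l * (a1 - a2)) ((1/8)^i / l * (b1 - b2))"
          by (intro double_limits_mult_row[OF _ c] double_limits_diff 2 double_limits_subseq[OF 1(3) 2(1,2)])
        from double_limits_unique[OF this, of a b] double_limits_subseq[OF k3 r12] show ?thesis
          by (simp add: truncated_diff_def eq)
      qed
    qed
  qed
qed

end

section \<open>Bounded functions with point evaluations\<close>

instance bcontfun :: (metric_space, banach) banach ..

text \<open>Bounded functions are realised as bounded continuous functions on the discrete copy of
  the index type, where continuity is automatic. The abstraction is meaningful only for bounded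
  arguments.\<close>

definition bounded_fun :: "('y \<Rightarrow> real) \<Rightarrow> 'y discrete \<Rightarrow>\<^sub>C real" where
  "bounded_fun \<phi> = Bcontfun (\<lambda>y. \<phi> (of_discrete y))"

definition bev :: "'y \<Rightarrow> ('y discrete \<Rightarrow>\<^sub>C real) \<Rightarrow>\<^sub>L real" where
  "bev y = Blinfun (\<lambda>f. apply_bcontfun f (discrete y))"

lemma bev_apply:
  fixes y :: 'y
  shows "bev y f = apply_bcontfun f (discrete y)"
proof -
  have "bounded_linear (\<lambda>f :: 'y discrete \<Rightarrow>\<^sub>C real. apply_bcontfun f (discrete y))"
  proof (rule bounded_linear_intro[of _ 1])
    show "norm (apply_bcontfun f (discrete y)) \<le> norm f * 1" for f :: "'y discrete \<Rightarrow>\<^sub>C real"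
      using norm_bounded[of f "discrete y"] by simp
  qed (simp_all add: plus_bcontfun.rep_eq scaleR_bcontfun.rep_eq)
  then show ?thesis
    by (simp add: bev_def bounded_linear_Blinfun_apply)
qed

lemma bev_bounded_fun:
  assumes "\<And>y. \<bar>\<phi> y\<bar> \<le> c"
  shows "bev y (bounded_fun \<phi>) = \<phi> y"
proof -
  have "continuous_on UNIV (\<lambda>y :: 'a discrete. \<phi> (of_discrete y))"
    by (simp add: continuous_on_open_vimage open_discrete)
  then have "(\<lambda>y. \<phi> (of_discrete y)) \<in> bcontfun"
    by (rule bcontfun_normI[of _ c]) (simp add: assms)
  then show ?thesis
    by (simp add: bev_apply bounded_fun_def Bcontfun_inverse discrete_inverse)
qed

lemma bev_eqI:
  assumes "\<And>y. bev y f = bev y g"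
  shows "f = g"
proof (rule bcontfun_eqI)
  fix z :: "'a discrete"
  show "apply_bcontfun f z = apply_bcontfun g z"
    using assms[of "of_discrete z"] by (simp add: bev_apply of_discrete_inverse)
qed

interpretation bev: bounded_function_space bev
proof
  show "\<bar>bev y f\<bar> \<le> norm f" for y :: 'a and f
    using norm_bounded[of f "discrete y"] by (simp add: bev_apply)
  show "norm f \<le> c" if "\<And>y :: 'a. \<bar>bev y f\<bar> \<le> c" for f c
  proof (rule norm_bound)
    fix z :: "'a discrete"
    show "norm (apply_bcontfun f z) \<le> c"
      using that[of "of_discrete z"] by (simp add: bev_apply of_discrete_inverse)
  qed
  show "\<exists>f. \<forall>y :: 'a. bev y f = \<phi> y" if "\<And>y. \<bar>\<phi> y\<bar> \<le> c" for \<phi> c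
    using bev_bounded_fun[of \<phi>, OF that] by blast
qed

section \<open>The action\<close>

locale stable_group =
  fixes d :: "'g::topological_group_add \<Rightarrow> 'g \<Rightarrow> real"
  assumes cli: "continuous_left_invariant_ecart d" and stable: "stable_ecart d"
begin

lemma d: "ecart d"
  using cli by (simp add: continuous_left_invariant_ecart_def)

lemmas d_nonneg = ecart_nonneg[OF d] and d_refl = ecart_refl[OF d] and d_sym = ecart_sym[OF d]
  and d_triangle = ecart_triangle[OF d]

lemma d_left: "d (g + x) (g + y) = d x y"
  using cli by (simp add: continuous_left_invariant_ecart_def left_invariant_def)

lemma d_left_minus: "d x (- g + y) = d (g + x) y"
  using d_left[of g x "- g + y"] by (simp add: add.assoc[symmetric])

lemma truncated_diff_left: "truncated_diff d x x' (k, - g + y) = truncated_diff d (g + x) (g + x') (k, y)"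
  by (simp add: truncated_diff_def d_left_minus)

definition \<delta> :: "'g \<Rightarrow> 'g \<Rightarrow> (nat \<times> 'g) discrete \<Rightarrow>\<^sub>C real" where
  "\<delta> x x' = bounded_fun (truncated_diff d x x')"

definition kern :: "'g \<Rightarrow> 'g \<Rightarrow> (nat \<times> 'g) discrete \<Rightarrow>\<^sub>C real" where
  "kern x x' = (1 / sqrt (d x x')) *\<^sub>R \<delta> x x'"

definition K :: "((nat \<times> 'g) discrete \<Rightarrow>\<^sub>C real) set" where
  "K = {kern x x' |x x'. True}"

lemma kern_in_K: "kern x x' \<in> K"
  unfolding K_def by blast

lemma K_E:
  assumes "w \<in> K"
  obtains x x' where "w = kern x x'"
  using assms unfolding K_def by blast

lemma truncated_diff_le_sqrt': "\<bar>truncated_diff d x x' p\<bar> \<le> sqrt (d x x')"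
proof -
  have "(1/2)^fst p * sqrt (d x x') \<le> 1 * sqrt (d x x')"
    using d_nonneg by (intro mult_right_mono power_le_one) auto
  then show ?thesis
    using truncated_diff_le_sqrt[OF d, of x x' p] by linarith
qed

lemma bev_\<delta>: "bev p (\<delta> x x') = truncated_diff d x x' p"
  unfolding \<delta>_def by (rule bev_bounded_fun[OF truncated_diff_le_sqrt'])

lemma bev_kern: "bev p (kern x x') = truncated_diff d x x' p / sqrt (d x x')"
  by (simp add: kern_def blinfun.scaleR_right bev_\<delta>)

lemma \<delta>_add: "\<delta> x y + \<delta> y z = \<delta> x z"
  by (rule bev_eqI) (simp add: blinfun.add_right bev_\<delta> truncated_diff_def algebra_simps)

lemma \<delta>_refl [simp]: "\<delta> x x = 0"
  using \<delta>_add[of x x x] by simp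

lemma \<delta>_minus: "- \<delta> x y = \<delta> y x"
  using \<delta>_add[of x y x] by (simp add: add_eq_0_iff)

text \<open>For points at distance 0 the kernel is 0 because of division by 0; the square-root bound
  shows that \<open>\<delta> x y\<close> vanishes there too.\<close>

lemma \<delta>_eq_kern: "\<delta> x y = sqrt (d x y) *\<^sub>R kern x y"
proof (cases "d x y = 0")
  case True
  then have "\<delta> x y = 0"
    using truncated_diff_le_sqrt'[of x y] by (intro bev_eqI) (simp add: bev_\<delta>)
  then show ?thesis
    using True by simp
qed (simp add: kern_def)

sublocale reflexive_interpolation bev K
proof
  have minus: "- kern x y = kern y x" for x y
    by (simp add: kern_def \<delta>_minus d_sym flip: scaleR_minus_right)
  have "uminus ` K \<subseteq> K"
    by (auto simp: minus kern_in_K elim!: K_E)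
  then have K: "uminus ` K = K"
    by (force simp: image_iff dest: subsetD)
  show "- w \<in> convex hull K" if "w \<in> convex hull K" for w
  proof -
    have "linear (uminus :: _ \<Rightarrow> (nat \<times> 'g) discrete \<Rightarrow>\<^sub>C real)"
      by (intro linearI) auto
    from convex_hull_linear_image[OF this, of K] show ?thesis
      using that by (auto simp: K)
  qed
  show "0 \<in> convex hull K"
    using hull_inc[OF kern_in_K[of 0 0], of convex] by (simp add: kern_def)
  have "K \<subseteq> cball 0 1"
  proof
    fix w
    assume "w \<in> K"
    then obtain x x' where w: "w = kern x x'"
      by (rule K_E)
    have "norm (kern x x') \<le> 1"
      using truncated_diff_le_sqrt'[of x x'] d_nonneg[of x x']
      by (intro bev.norm_leI) (cases "d x x' = 0"; auto simp: bev_kern abs_divide divide_le_eq)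
    then show "w \<in> cball 0 1"
      by (simp add: w)
  qed
  then have "convex hull K \<subseteq> cball 0 1"
    by (intro hull_minimal) auto
  then show "norm w \<le> 1" if "w \<in> convex hull K" for w
    using that by auto
  show "dlp K (range bev)"
    unfolding double_limit_property_iff
  proof (intro allI impI)
    fix w and h :: "nat \<Rightarrow> ((nat \<times> 'g) discrete \<Rightarrow>\<^sub>C real) \<Rightarrow>\<^sub>L real" and a b
    assume w: "\<forall>n. w n \<in> K" and h: "\<forall>m. h m \<in> range bev" and k: "double_limits (\<lambda>n m. h m (w n)) a b"
    have "\<forall>n. \<exists>z. w n = (\<lambda>(x, x'). kern x x') z"
    proof
      fix n
      have "w n \<in> K"
        using w by simp
      then obtain x x' where "w n = kern x x'"
        by (rule K_E)
      then show "\<exists>z. w n = (\<lambda>(x, x'). kern x x') z"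
        by (intro exI[of _ "(x, x')"]) simp
    qed
    then obtain z where z: "\<And>n. w n = (\<lambda>(x, x'). kern x x') (z n)"
      by metis
    have "\<forall>m. \<exists>p. h m = bev p"
      using h by blast
    then obtain q where q: "\<And>m. h m = bev (q m)"
      by metis
    have "double_limits (\<lambda>n m. (\<lambda>(x, x') p. truncated_diff d x x' p / sqrt (d x x')) (z n) (q m)) a b"
      using k by (simp add: z q case_prod_beta bev_kern)
    then show "a = b"
      using double_limit_property_kernel[OF d stable] unfolding double_limit_property_iff by blast
  qed
qed simp

lemma \<delta>_E: "\<delta> x y \<in> E" "Enorm (\<delta> x y) \<le> 2 * sqrt (d x y)"
proof -
  have "kern x y \<in> convex hull K"
    by (rule hull_inc) (rule kern_in_K)
  from scaled_W_in_E[OF this, of "sqrt (d x y)"] show "\<delta> x y \<in> E" "Enorm (\<delta> x y) \<le> 2 * sqrt (d x y)"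
    using d_nonneg by (simp_all add: \<delta>_eq_kern)
qed

lemma Enorm_\<delta>_ge: "(1/8)^k * min (d x y) (16^k) \<le> Enorm (\<delta> x y)"
proof -
  have "(1/8)^k * min (d x y) (16^k) = bev (k, y) (\<delta> x y)"
    using d_nonneg by (simp add: bev_\<delta> truncated_diff_def d_refl)
  also have "\<dots> \<le> norm (\<delta> x y)"
    using bev.ev_le_norm[of "(k, y)" "\<delta> x y"] by linarith
  also have "\<dots> \<le> Enorm (\<delta> x y)"
    by (rule norm_le_Enorm[OF \<delta>_E(1)])
  finally show ?thesis .
qed

section \<open>Translations and their strong continuity\<close>

definition shift :: "'g \<Rightarrow> ((nat \<times> 'g) discrete \<Rightarrow>\<^sub>C real) \<Rightarrow> (nat \<times> 'g) discrete \<Rightarrow>\<^sub>C real" where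
  "shift g f = bounded_fun (\<lambda>(k, y). bev (k, - g + y) f)"

lemma bev_shift: "bev (k, y) (shift g f) = bev (k, - g + y) f"
  unfolding shift_def using bev.ev_le_norm[of _ f]
  by (subst bev_bounded_fun[of _ "norm f"]) (auto simp: case_prod_beta)

lemma shift_eqI: "(\<And>k y. bev (k, y) f = bev (k, y) g) \<Longrightarrow> f = (g :: (nat \<times> 'g) discrete \<Rightarrow>\<^sub>C real)"
  by (rule bev_eqI) auto

lemma shift_add: "shift g (f + h) = shift g f + shift g h"
  by (rule shift_eqI) (simp add: bev_shift blinfun.add_right)

lemma shift_scale: "shift g (c *\<^sub>R f) = c *\<^sub>R shift g f"
  by (rule shift_eqI) (simp add: bev_shift blinfun.scaleR_right)

lemma linear_shift: "linear (shift g)"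
  by (intro linearI shift_add shift_scale)

lemma shift_diff: "shift g (f - h) = shift g f - shift g h"
  by (rule linear_diff[OF linear_shift])

lemma shift_zero: "shift 0 f = f"
  by (rule shift_eqI) (simp add: bev_shift)

lemma shift_plus: "shift (g + h) f = shift g (shift h f)"
  by (rule shift_eqI) (simp only: bev_shift minus_add add.assoc)

lemma shift_\<delta>: "shift g (\<delta> x y) = \<delta> (g + x) (g + y)"
  by (rule shift_eqI) (simp add: bev_shift bev_\<delta> truncated_diff_left)

lemma shift_kern: "shift g (kern x y) = kern (g + x) (g + y)"
  by (simp add: kern_def shift_scale shift_\<delta> d_left)

lemma norm_shift: "norm (shift g f) \<le> norm f"
  using bev.ev_le_norm[of _ f] by (intro bev.norm_leI) (auto simp: bev_shift)

lemma shift_hull: "w \<in> convex hull K \<Longrightarrow> shift g w \<in> convex hull K"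
proof -
  have "shift g ` K \<subseteq> K"
    by (auto simp: shift_kern kern_in_K elim!: K_E)
  then have "shift g ` (convex hull K) \<subseteq> convex hull K"
    unfolding convex_hull_linear_image[OF linear_shift] by (rule hull_mono)
  then show "w \<in> convex hull K \<Longrightarrow> shift g w \<in> convex hull K"
    by blast
qed

text \<open>Translation maps the hull of \<open>K\<close> into itself and does not increase the
  ambient norm, so it carries decompositions to decompositions of no greater cost. The inverse
  translation gives equality.\<close>

lemma kfun_shift_le: "kfun n (shift g f) \<le> kfun n f"
proof (rule kfun_geI)
  fix t w
  assume tw: "0 \<le> (t::real)" "w \<in> convex hull K"
  have "kfun n (shift g f) \<le> t / 2^n + 2^n * norm (shift g f - t *\<^sub>R shift g w)"
    using tw by (intro kfun_le shift_hull)
  also have "shift g f - t *\<^sub>R shift g w = shift g (f - t *\<^sub>R w)"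
    by (simp add: shift_diff shift_scale)
  also have "t / 2^n + 2^n * norm \<dots> \<le> t / 2^n + 2^n * norm (f - t *\<^sub>R w)"
    by (intro add_left_mono mult_left_mono norm_shift) simp
  finally show "kfun n (shift g f) \<le> t / 2^n + 2^n * norm (f - t *\<^sub>R w)" .
qed

lemma kfun_shift: "kfun n (shift g f) = kfun n f"
proof (rule antisym[OF kfun_shift_le])
  have "shift (- g) (shift g f) = f"
    by (simp add: shift_zero flip: shift_plus)
  then show "kfun n f \<le> kfun n (shift g f)"
    using kfun_shift_le[of n "- g" "shift g f"] by simp
qed

lemma shift_E: "shift g f \<in> E \<longleftrightarrow> f \<in> E"
  by (simp add: E_def kfun_shift)

lemma Enorm_shift: "Enorm (shift g f) = Enorm f"
  by (simp add: Enorm_def kfun_shift)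

lemma d_tendsto: "((\<lambda>h. d h g) \<longlongrightarrow> 0) (at g)"
proof -
  have "continuous_on UNIV (\<lambda>(x, y). d x y)"
    using cli by (simp add: continuous_left_invariant_ecart_def)
  from continuous_on_compose2[OF this, of UNIV "\<lambda>h. (h, g)"] have "continuous_on UNIV (\<lambda>h. d h g)"
    by (simp add: continuous_on_Pair continuous_on_id continuous_on_const)
  then have "((\<lambda>h. d h g) \<longlongrightarrow> d g g) (at g)"
    by (simp add: continuous_on_def)
  then show ?thesis
    by (simp add: d_refl)
qed

lemma \<delta>_tendsto: "((\<lambda>h. Enorm (\<delta> h g)) \<longlongrightarrow> 0) (at g)"
proof (rule Lim_null_comparison)
  show "\<forall>\<^sub>F h in at g. norm (Enorm (\<delta> h g)) \<le> 2 * sqrt (d h g)"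
    using \<delta>_E Enorm_nonneg by simp
  show "((\<lambda>h. 2 * sqrt (d h g)) \<longlongrightarrow> 0) (at g)"
    using tendsto_mult[OF tendsto_const tendsto_real_sqrt[OF d_tendsto], of 2] by simp
qed

lemma shift_tendsto_subspace: "subspace {f \<in> E. ((\<lambda>h. Enorm (shift h f - shift g f)) \<longlongrightarrow> 0) (at g)}"
proof (rule subspaceI)
  show "0 \<in> {f \<in> E. ((\<lambda>h. Enorm (shift h f - shift g f)) \<longlongrightarrow> 0) (at g)}"
    using linear_0[OF linear_shift] by simp
next
  fix f f' and c :: real
  assume "f \<in> {f \<in> E. ((\<lambda>h. Enorm (shift h f - shift g f)) \<longlongrightarrow> 0) (at g)}"
  then have f: "f \<in> E" "((\<lambda>h. Enorm (shift h f - shift g f)) \<longlongrightarrow> 0) (at g)"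
    by auto
  have "Enorm (shift h (c *\<^sub>R f) - shift g (c *\<^sub>R f)) = \<bar>c\<bar> * Enorm (shift h f - shift g f)" for h
    using f(1) by (simp add: shift_scale Enorm_scale E_diff shift_E flip: scaleR_diff_right)
  then show "c *\<^sub>R f \<in> {f \<in> E. ((\<lambda>h. Enorm (shift h f - shift g f)) \<longlongrightarrow> 0) (at g)}"
    using f tendsto_mult_right_zero[OF f(2), of "\<bar>c\<bar>"] by (simp add: E_scale)
  assume "f' \<in> {f \<in> E. ((\<lambda>h. Enorm (shift h f - shift g f)) \<longlongrightarrow> 0) (at g)}"
  then have f': "f' \<in> E" "((\<lambda>h. Enorm (shift h f' - shift g f')) \<longlongrightarrow> 0) (at g)"
    by auto
  have "((\<lambda>h. Enorm (shift h (f + f') - shift g (f + f'))) \<longlongrightarrow> 0) (at g)"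
  proof (rule Lim_null_comparison)
    have "norm (Enorm (shift h (f + f') - shift g (f + f')))
        \<le> Enorm (shift h f - shift g f) + Enorm (shift h f' - shift g f')" for h
      using Enorm_triangle[of "shift h f - shift g f" "shift h f' - shift g f'"] f(1) f'(1)
      by (simp add: shift_add E_diff E_add shift_E Enorm_nonneg algebra_simps)
    then show "\<forall>\<^sub>F h in at g. norm (Enorm (shift h (f + f') - shift g (f + f')))
        \<le> Enorm (shift h f - shift g f) + Enorm (shift h f' - shift g f')"
      by simp
    show "((\<lambda>h. Enorm (shift h f - shift g f) + Enorm (shift h f' - shift g f')) \<longlongrightarrow> 0) (at g)"
      using tendsto_add[OF f(2) f'(2)] by simp
  qed
  then show "f + f' \<in> {f \<in> E. ((\<lambda>h. Enorm (shift h f - shift g f)) \<longlongrightarrow> 0) (at g)}"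
    using f f' by (simp add: E_add)
qed

text \<open>Vectors whose orbit is continuous at \<open>g\<close> form a subspace. It contains every
  \<open>\<delta> x 0\<close>, hence \<open>K\<close> and its hull; density and the isometry of
  translations extend this to \<open>E\<close>.\<close>

lemma shift_tendsto:
  assumes f: "f \<in> E"
  shows "((\<lambda>h. Enorm (shift h f - shift g f)) \<longlongrightarrow> 0) (at g)"
proof -
  let ?C = "{f \<in> E. ((\<lambda>h. Enorm (shift h f - shift g f)) \<longlongrightarrow> 0) (at g)}"
  have \<delta>0: "\<delta> x 0 \<in> ?C" for x
  proof -
    \<comment> \<open>\<open>d\<close> is invariant on the left only, so moving \<open>h + x\<close>
      to \<open>g + x\<close> and moving \<open>h\<close> to \<open>g\<close> are separate
      contributions, each small by continuity of \<open>d\<close>.\<close>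
    have eq: "shift h (\<delta> x 0) - shift g (\<delta> x 0) = \<delta> (h + x) (g + x) + \<delta> g h" for h
    proof -
      have "\<delta> (h + x) (g + x) + \<delta> g h = (\<delta> (h + x) h + \<delta> h g + \<delta> g (g + x)) + \<delta> g h"
        by (simp add: \<delta>_add)
      also have "\<dots> = \<delta> (h + x) h - \<delta> (g + x) g"
        using \<delta>_add[of h g h] \<delta>_minus[of "g + x" g] by simp
      finally show ?thesis
        by (simp add: shift_\<delta>)
    qed
    \<comment> \<open>Right translation is continuous, and being injective it also respects the
      punctured neighbourhoods.\<close>
    have "((\<lambda>h. h + x) \<longlongrightarrow> g + x) (at g)"
      by (intro tendsto_intros)
    then have "filterlim (\<lambda>h. h + x) (at (g + x)) (at g)"
      by (auto simp: filterlim_at eventually_at_filter)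
    then have lim: "((\<lambda>h. Enorm (\<delta> (h + x) (g + x))) \<longlongrightarrow> 0) (at g)"
      by (rule filterlim_compose[OF \<delta>_tendsto])
    have "((\<lambda>h. Enorm (shift h (\<delta> x 0) - shift g (\<delta> x 0))) \<longlongrightarrow> 0) (at g)"
    proof (rule Lim_null_comparison)
      have "norm (Enorm (\<delta> (h + x) (g + x) + \<delta> g h)) \<le> Enorm (\<delta> (h + x) (g + x)) + Enorm (\<delta> h g)" for h
        using Enorm_triangle[OF \<delta>_E(1) \<delta>_E(1), of "h + x" "g + x" g h] Enorm_uminus[OF \<delta>_E(1), of g h]
        by (simp add: \<delta>_minus Enorm_nonneg E_add \<delta>_E)
      then show "\<forall>\<^sub>F h in at g. norm (Enorm (shift h (\<delta> x 0) - shift g (\<delta> x 0)))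
          \<le> Enorm (\<delta> (h + x) (g + x)) + Enorm (\<delta> h g)"
        by (simp add: eq)
      show "((\<lambda>h. Enorm (\<delta> (h + x) (g + x)) + Enorm (\<delta> h g)) \<longlongrightarrow> 0) (at g)"
        using tendsto_add[OF lim \<delta>_tendsto] by simp
    qed
    then show ?thesis
      by (simp add: \<delta>_E)
  qed
  have "kern x y \<in> ?C" for x y
  proof -
    have "\<delta> x y = \<delta> x 0 - \<delta> y 0"
      using \<delta>_add[of x 0 y] unfolding \<delta>_minus[of y 0, symmetric] by simp
    then show ?thesis
      unfolding kern_def
      using subspace_scale[OF shift_tendsto_subspace[of g] subspace_diff[OF shift_tendsto_subspace[of g] \<delta>0 \<delta>0]] by simp
  qed
  then have "K \<subseteq> ?C"
    by (auto elim!: K_E)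
  then have hull: "convex hull K \<subseteq> ?C"
    by (intro hull_minimal subspace_imp_convex shift_tendsto_subspace)
  show ?thesis
  proof (rule tendstoI)
    fix e :: real
    assume "0 < e"
    then have "0 < e/3"
      by simp
    then obtain t w where tw: "0 \<le> t" "w \<in> convex hull K" "Enorm (f - t *\<^sub>R w) < e/3"
      by (rule W_dense[OF f])
    let ?w = "t *\<^sub>R w"
    have "?w \<in> ?C"
      using subspace_scale[OF shift_tendsto_subspace[of g]] hull tw(2) by blast
    then have w: "?w \<in> E" "((\<lambda>h. Enorm (shift h ?w - shift g ?w)) \<longlongrightarrow> 0) (at g)"
      by auto
    have "\<forall>\<^sub>F h in at g. Enorm (shift h ?w - shift g ?w) < e/3"
      using w(2) \<open>0 < e/3\<close> by (rule order_tendstoD)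
    then show "\<forall>\<^sub>F h in at g. dist (Enorm (shift h f - shift g f)) 0 < e"
    proof eventually_elim
      case (elim h)
      have eq: "shift h f - shift g f = shift h (f - ?w) + ((shift h ?w - shift g ?w) + shift g (?w - f))"
        by (simp add: shift_diff)
      have "Enorm (shift h f - shift g f) \<le> Enorm (shift h (f - ?w)) + (Enorm (shift h ?w - shift g ?w) + Enorm (shift g (?w - f)))"
        unfolding eq using f w(1)
        by (intro order_trans[OF Enorm_triangle] add_left_mono Enorm_triangle) (simp_all add: E_diff E_add shift_E)
      also have "\<dots> < e"
        using elim tw(3) Enorm_diff_commute[OF f w(1)] by (simp add: Enorm_shift)
      finally show ?case
        using f by (simp add: Enorm_nonneg E_diff shift_E)
    qed
  qed
qed

end

section \<open>Transport to the carrier type\<close>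

text \<open>The type of vectors is prescribed, while \<open>E\<close> lives in a type of bounded
  functions. Any injection suffices, since all operations are read back through
  \<open>J_inv\<close>.\<close>

locale transported_interpolation = reflexive_interpolation ev K
  for ev :: "'y \<Rightarrow> 'a::banach \<Rightarrow>\<^sub>L real" and K :: "'a set" +
  fixes J :: "'a \<Rightarrow> 'e"
  assumes inj_J: "inj J"
begin

definition J_inv :: "'e \<Rightarrow> 'a" where
  "J_inv = inv_into UNIV J"

lemma J_inv_J [simp]: "J_inv (J f) = f"
  unfolding J_inv_def by (rule inv_into_f_f[OF inj_J UNIV_I])

definition nsp :: "'e nspace" where
  "nsp = \<lparr>carrier = J ` E, mult = undefined, one = undefined, zero = J 0,
     add = (\<lambda>u v. J (J_inv u + J_inv v)), smult = (\<lambda>c u. J (c *\<^sub>R J_inv u)), nrm = (\<lambda>u. Enorm (J_inv u))\<rparr>"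

lemma nsp_simps [simp]:
  "carrier nsp = J ` E" "\<zero>\<^bsub>nsp\<^esub> = J 0" "J f \<oplus>\<^bsub>nsp\<^esub> J g = J (f + g)" "c \<odot>\<^bsub>nsp\<^esub> J f = J (c *\<^sub>R f)"
  "nrm nsp (J f) = Enorm f"
  by (simp_all add: nsp_def)

lemma module_nsp: "Module.module (ring_of_type_algebra :: real ring) nsp"
proof (rule moduleI)
  show "cring (ring_of_type_algebra :: real ring)"
    by (rule cring_from_type_algebra)
  show "abelian_group nsp"
  proof (rule abelian_groupI)
    fix u
    assume "u \<in> carrier nsp"
    then obtain f where f: "u = J f" "f \<in> E"
      by auto
    then show "\<exists>v\<in>carrier nsp. v \<oplus>\<^bsub>nsp\<^esub> u = \<zero>\<^bsub>nsp\<^esub>"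
      using subspace_neg[OF subspace_E, of f] by (intro bexI[of _ "J (- f)"]) auto
  qed (auto intro: E_add simp: add_ac)
qed (auto simp: ring_of_type_algebra_def E_scale scaleR_add_left scaleR_add_right)

lemma normed_space_nsp: "normed_space nsp"
  unfolding normed_space_def using module_nsp inj_J
  by (auto simp: Enorm_nonneg Enorm_eq_0_iff Enorm_triangle Enorm_scale inj_eq)

lemma ndist_nsp: "f \<in> E \<Longrightarrow> g \<in> E \<Longrightarrow> ndist nsp (J f) (J g) = Enorm (f - g)"
proof -
  assume f: "f \<in> E" and g: "g \<in> E"
  interpret Module.module "ring_of_type_algebra :: real ring" nsp
    by (rule module_nsp)
  have "\<ominus>\<^bsub>nsp\<^esub> J g = J (- g)"
    using g subspace_neg[OF subspace_E g] by (intro M.minus_equality) auto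
  then show ?thesis
    using f g by (simp add: ndist_def a_minus_def)
qed

sublocale nsp: Metric_space "carrier nsp" "ndist nsp"
  by (rule Metric_space_ndist[OF normed_space_nsp])

lemma banach_space_nsp: "banach_space nsp"
  unfolding banach_space_def nsp.mcomplete_def
proof (intro conjI allI impI normed_space_nsp)
  fix \<sigma>
  assume \<sigma>: "nsp.MCauchy \<sigma>"
  then have "range \<sigma> \<subseteq> carrier nsp"
    unfolding nsp.MCauchy_def by blast
  then have "\<forall>k. \<exists>f\<in>E. \<sigma> k = J f"
    by (simp add: image_subset_iff image_iff)
  then obtain s where s: "\<And>k. s k \<in> E" "\<And>k. \<sigma> k = J (s k)"
    by metis
  have "\<exists>n. \<forall>j\<ge>n. \<forall>k\<ge>n. Enorm (s j - s k) < e" if "0 < e" for e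
    using \<sigma> that unfolding nsp.MCauchy_def by (simp add: s ndist_nsp)
  then obtain f where f: "f \<in> E" "(\<lambda>k. Enorm (s k - f)) \<longlonglongrightarrow> 0"
    by (rule E_complete[OF s(1)])
  have "limitin nsp.mtopology \<sigma> (J f) sequentially"
    unfolding nsp.limit_metric_sequentially
  proof (intro conjI allI impI)
    fix e :: real
    assume "0 < e"
    then obtain n where "\<forall>k\<ge>n. norm (Enorm (s k - f) - 0) < e"
      using LIMSEQ_D[OF f(2)] by blast
    then show "\<exists>n. \<forall>k\<ge>n. \<sigma> k \<in> carrier nsp \<and> ndist nsp (\<sigma> k) (J f) < e"
      using s f(1) by (intro exI[of _ n]) (auto simp: ndist_nsp abs_less_iff)
  qed (simp add: f)
  then show "\<exists>x. limitin nsp.mtopology \<sigma> x sequentially" ..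
qed

lemma continuous_map_nsp:
  fixes \<phi> :: "'t::topological_space \<Rightarrow> 'a"
  assumes E: "\<And>g. \<phi> g \<in> E" and lim: "\<And>g. ((\<lambda>h. Enorm (\<phi> h - \<phi> g)) \<longlongrightarrow> 0) (at g)"
  shows "continuous_map euclidean (norm_topology nsp) (\<lambda>g. J (\<phi> g))"
  unfolding nsp.continuous_map_to_metric
proof (intro ballI allI impI)
  fix g and e :: real
  assume "0 < e"
  then have "\<forall>\<^sub>F h in at g. Enorm (\<phi> h - \<phi> g) < e"
    using lim by (intro order_tendstoD)
  then obtain S where S: "open S" "g \<in> S" "\<And>h. h \<in> S \<Longrightarrow> h \<noteq> g \<Longrightarrow> Enorm (\<phi> h - \<phi> g) < e"
    by (auto simp: eventually_at_topological)
  have "J (\<phi> h) \<in> nsp.mball (J (\<phi> g)) e" if "h \<in> S" for h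
    using S(3)[OF that] E \<open>0 < e\<close> Enorm_diff_commute[OF E E, of g h]
    unfolding nsp.in_mball by (cases "h = g") (auto simp: ndist_nsp)
  then show "\<exists>U. openin euclidean U \<and> g \<in> U \<and> (\<forall>h\<in>U. J (\<phi> h) \<in> nsp.mball (J (\<phi> g)) e)"
    using S by auto
qed

section \<open>Dual and bidual of the transported space\<close>

text \<open>Restriction to the carrier discards the arbitrary values outside \<open>E\<close>, so
  two members of \<open>Edual\<close> that agree on \<open>E\<close> become the same
  functional.\<close>

definition pull :: "('a \<Rightarrow> real) \<Rightarrow> 'e \<Rightarrow> real" where
  "pull F = (\<lambda>u\<in>carrier nsp. F (J_inv u))"

lemma pull_J: "f \<in> E \<Longrightarrow> pull F (J f) = F f"
  by (simp add: pull_def)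

lemma pull_in_dual: "F \<in> Edual \<Longrightarrow> pull F \<in> bounded_functionals nsp"
proof -
  assume F: "F \<in> Edual"
  then obtain C where C: "\<forall>f\<in>E. \<bar>F f\<bar> \<le> C * Enorm f"
    unfolding Edual_def by blast
  have "\<exists>C. \<forall>u\<in>carrier nsp. \<bar>pull F u\<bar> \<le> C * nrm nsp u"
    using C by (intro exI[of _ C]) (auto simp: pull_J)
  then show ?thesis
    using F by (auto simp: bounded_functionals_def pull_J E_add E_scale Edual_def) (simp add: pull_def)
qed

lemma dual_eq_pull:
  assumes "\<phi> \<in> bounded_functionals nsp"
  shows "(\<lambda>f. \<phi> (J f)) \<in> Edual" "pull (\<lambda>f. \<phi> (J f)) = \<phi>"
proof -
  obtain C where "\<forall>u\<in>carrier nsp. \<bar>\<phi> u\<bar> \<le> C * nrm nsp u"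
    using assms unfolding bounded_functionals_def by blast
  then have "\<forall>f\<in>E. \<bar>\<phi> (J f)\<bar> \<le> C * Enorm f"
    by simp
  moreover have "\<phi> (J (f + g)) = \<phi> (J f) + \<phi> (J g)" if "f \<in> E" "g \<in> E" for f g
    using assms that by (force simp: bounded_functionals_def)
  moreover have "\<phi> (J (c *\<^sub>R f)) = c * \<phi> (J f)" if "f \<in> E" for c f
    using assms that by (force simp: bounded_functionals_def)
  ultimately show "(\<lambda>f. \<phi> (J f)) \<in> Edual"
    unfolding Edual_def by blast
  show "pull (\<lambda>f. \<phi> (J f)) = \<phi>"
  proof
    fix u
    have "\<phi> \<in> extensional (carrier nsp)"
      using assms by (simp add: bounded_functionals_def)
    then show "pull (\<lambda>f. \<phi> (J f)) u = \<phi> u"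
      by (cases "u \<in> carrier nsp") (auto simp: pull_def extensional_def)
  qed
qed

lemma dual_norm_le:
  assumes C: "0 \<le> C" "\<And>f. f \<in> E \<Longrightarrow> \<bar>F f\<bar> \<le> C * Enorm f"
  shows "nrm (dual_space nsp) (pull F) \<le> C" "0 \<le> nrm (dual_space nsp) (pull F)"
proof -
  let ?B = "{x \<in> carrier nsp. nrm nsp x \<le> 1}"
  have J0: "J 0 \<in> ?B"
    by auto
  have le: "\<bar>pull F u\<bar> \<le> C" if u: "u \<in> ?B" for u
  proof -
    obtain f where f: "u = J f" "f \<in> E" "Enorm f \<le> 1"
      using u by auto
    have "\<bar>F f\<bar> \<le> C * 1"
      using C(2)[OF f(2)] mult_left_mono[OF f(3) C(1)] by linarith
    then show ?thesis
      using f by (simp add: pull_J)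
  qed
  show "nrm (dual_space nsp) (pull F) \<le> C"
  proof -
    have "(SUP u\<in>?B. \<bar>pull F u\<bar>) \<le> C"
    proof (rule cSUP_least)
      show "?B \<noteq> {}"
        using J0 by blast
    qed (rule le)
    then show ?thesis
      by (simp add: dual_space_def)
  qed
  have "\<bar>pull F (J 0)\<bar> \<le> (SUP u\<in>?B. \<bar>pull F u\<bar>)"
    using le by (intro cSUP_upper[OF J0] bdd_aboveI2)
  then show "0 \<le> nrm (dual_space nsp) (pull F)"
    by (simp add: dual_space_def)
qed

text \<open>Normalise \<open>f\<close>. The supremum is an upper bound only for a bounded set of
  values, and this is where boundedness of \<open>F\<close> enters.\<close>

lemma le_dual_norm:
  assumes F: "F \<in> Edual" and f: "f \<in> E"
  shows "\<bar>F f\<bar> \<le> nrm (dual_space nsp) (pull F) * Enorm f"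
proof (cases "f = 0")
  case True
  have "F (0 *\<^sub>R f) = 0 * F f"
    using F f unfolding Edual_def by blast
  then show ?thesis
    using True by simp
next
  case False
  let ?B = "{x \<in> carrier nsp. nrm nsp x \<le> 1}"
  have pos: "0 < Enorm f"
    using False Enorm_eq_0_iff[OF f] Enorm_nonneg[OF f] by simp
  obtain C where C: "\<forall>f\<in>E. \<bar>F f\<bar> \<le> C * Enorm f"
    using F unfolding Edual_def by blast
  have "\<bar>pull F u\<bar> \<le> \<bar>C\<bar>" if u: "u \<in> ?B" for u
  proof -
    obtain h where h: "u = J h" "h \<in> E" "Enorm h \<le> 1"
      using u by auto
    have "\<bar>F h\<bar> \<le> C * Enorm h"
      using C h(2) by simp
    also have "\<dots> \<le> \<bar>C\<bar> * 1"
      using h Enorm_nonneg by (intro mult_mono) auto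
    finally show ?thesis
      using h by (simp add: pull_J)
  qed
  then have bdd: "bdd_above ((\<lambda>u. \<bar>pull F u\<bar>) ` ?B)"
    by (intro bdd_aboveI2)
  have "J ((1 / Enorm f) *\<^sub>R f) \<in> ?B"
    using f pos by (auto simp: E_scale Enorm_scale)
  then have "\<bar>pull F (J ((1 / Enorm f) *\<^sub>R f))\<bar> \<le> nrm (dual_space nsp) (pull F)"
    using cSUP_upper[OF _ bdd] by (simp add: dual_space_def)
  moreover have "F ((1 / Enorm f) *\<^sub>R f) = (1 / Enorm f) * F f"
    using F f unfolding Edual_def by blast
  ultimately show ?thesis
    using f pos by (simp add: pull_J E_scale abs_mult divide_le_eq)
qed

lemma carrier_dual: "carrier (dual_space nsp) = bounded_functionals nsp"
  by (simp add: dual_space_def)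

lemma pull_add: "pull F \<oplus>\<^bsub>dual_space nsp\<^esub> pull G = pull (\<lambda>f. F f + G f)"
  by (auto simp: dual_space_def pull_def)

lemma pull_scale: "c \<odot>\<^bsub>dual_space nsp\<^esub> pull F = pull (\<lambda>f. c * F f)"
  by (auto simp: dual_space_def pull_def)

text \<open>That evaluations are bounded functionals on the dual is the inequality
  \<open>le_dual_norm\<close>. Conversely, an element of the bidual is composed with
  \<open>pull\<close>, represented by a vector through \<open>bidual_representation\<close>, and
  extensionality turns agreement into equality.\<close>

lemma reflexive_space_nsp: "reflexive_space nsp"
  unfolding reflexive_space_def
proof (intro equalityI subsetI)
  fix \<Psi>
  assume "\<Psi> \<in> canonical_embedding nsp ` carrier nsp"
  then obtain f where f: "f \<in> E" "\<Psi> = (\<lambda>\<phi>\<in>bounded_functionals nsp. \<phi> (J f))"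
    by (auto simp: canonical_embedding_def carrier_dual)
  have app: "pull F \<in> bounded_functionals nsp" "\<Psi> (pull F) = F f" if "F \<in> Edual" for F
    using pull_in_dual[OF that] f by (simp_all add: pull_J)
  have ex_pull: "\<exists>F\<in>Edual. \<phi> = pull F" if "\<phi> \<in> bounded_functionals nsp" for \<phi>
    using dual_eq_pull[OF that] by metis
  have "\<Psi> (\<phi> \<oplus>\<^bsub>dual_space nsp\<^esub> \<psi>) = \<Psi> \<phi> + \<Psi> \<psi>" 
    if "\<phi> \<in> bounded_functionals nsp" "\<psi> \<in> bounded_functionals nsp" for \<phi> \<psi>
    using ex_pull[OF that(1)] ex_pull[OF that(2)] by (auto simp: pull_add app Edual_add)
  moreover have "\<Psi> (c \<odot>\<^bsub>dual_space nsp\<^esub> \<phi>) = c * \<Psi> \<phi>" if "\<phi> \<in> bounded_functionals nsp" for c \<phi>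
    using ex_pull[OF that] by (auto simp: pull_scale app Edual_scale)
  moreover have "\<bar>\<Psi> \<phi>\<bar> \<le> Enorm f * nrm (dual_space nsp) \<phi>" if "\<phi> \<in> bounded_functionals nsp" for \<phi>
    using ex_pull[OF that] le_dual_norm[OF _ f(1)] by (auto simp: app mult.commute)
  moreover have "\<Psi> \<in> extensional (bounded_functionals nsp)"
    by (simp add: f)
  ultimately have "\<Psi> \<in> bounded_functionals (dual_space nsp)"
    unfolding bounded_functionals_def[of "dual_space nsp"] carrier_dual by blast
  then show "\<Psi> \<in> carrier (dual_space (dual_space nsp))"
    by (simp add: dual_space_def[of "dual_space nsp"])
next
  fix \<Psi>
  assume "\<Psi> \<in> carrier (dual_space (dual_space nsp))"
  then have \<Psi>: "\<Psi> \<in> bounded_functionals (dual_space nsp)"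
    by (simp add: dual_space_def[of "dual_space nsp"])
  then obtain M where M: "\<forall>\<phi>\<in>bounded_functionals nsp. \<bar>\<Psi> \<phi>\<bar> \<le> M * nrm (dual_space nsp) \<phi>"
    unfolding bounded_functionals_def[of "dual_space nsp"] carrier_dual by blast
  have "\<exists>f\<in>E. \<forall>F\<in>Edual. \<Psi> (pull F) = F f"
  proof (rule bidual_representation[of "\<lambda>F. \<Psi> (pull F)"])
    show "\<Psi> (pull (\<lambda>f. F f + G f)) = \<Psi> (pull F) + \<Psi> (pull G)" if "F \<in> Edual" "G \<in> Edual" for F G
      using \<Psi> pull_in_dual that unfolding pull_add[symmetric] bounded_functionals_def[of "dual_space nsp"] carrier_dual by blast
    show "\<Psi> (pull (\<lambda>f. c * F f)) = c * \<Psi> (pull F)" if "F \<in> Edual" for c F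
      using \<Psi> pull_in_dual that unfolding pull_scale[symmetric] bounded_functionals_def[of "dual_space nsp"] carrier_dual by blast
    show "\<bar>\<Psi> (pull F)\<bar> \<le> \<bar>M\<bar> * C" if "F \<in> Edual" "0 \<le> C" "\<And>f. f \<in> E \<Longrightarrow> \<bar>F f\<bar> \<le> C * Enorm f" for C F
    proof -
      have "\<bar>\<Psi> (pull F)\<bar> \<le> M * nrm (dual_space nsp) (pull F)"
        using M pull_in_dual[OF that(1)] by blast
      also have "\<dots> \<le> \<bar>M\<bar> * C"
        using dual_norm_le[OF that(2,3)] by (intro mult_mono) auto
      finally show ?thesis .
    qed
  qed
  then obtain f where f: "f \<in> E" "\<And>F. F \<in> Edual \<Longrightarrow> \<Psi> (pull F) = F f"
    by blast
  have "\<Psi> = canonical_embedding nsp (J f)"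
  proof
    fix \<phi>
    have "\<Psi> \<in> extensional (bounded_functionals nsp)"
      using \<Psi> unfolding bounded_functionals_def[of "dual_space nsp"] carrier_dual by blast
    moreover have "\<Psi> \<phi> = \<phi> (J f)" if "\<phi> \<in> bounded_functionals nsp"
      using f(2)[OF dual_eq_pull(1)[OF that]] by (simp only: dual_eq_pull(2)[OF that])
    ultimately show "\<Psi> \<phi> = canonical_embedding nsp (J f) \<phi>"
      by (auto simp: canonical_embedding_def carrier_dual extensional_def)
  qed
  then show "\<Psi> \<in> canonical_embedding nsp ` carrier nsp"
    using f(1) by auto
qed

end

section \<open>The affine action on the transported space\<close>

context stable_group
begin

text \<open>A bounded function on pairs is recorded by its curried values, which have exactly the
  prescribed type of vectors.\<close>

definition as_vector :: "((nat \<times> 'g) discrete \<Rightarrow>\<^sub>C real) \<Rightarrow> 'g vectors" where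
  "as_vector f = (\<lambda>k y. bev (k, y) f)"

lemma inj_as_vector: "inj as_vector"
proof (rule injI)
  fix f g
  assume "as_vector f = as_vector g"
  then have "bev (k, y) f = bev (k, y) g" for k y
    unfolding as_vector_def by metis
  then show "f = g"
    by (rule shift_eqI)
qed

sublocale transported_interpolation bev K as_vector
  by unfold_locales (rule inj_as_vector)

definition rep :: "'g \<Rightarrow> 'g vectors \<Rightarrow> 'g vectors" where
  "rep g u = as_vector (shift g (J_inv u))"

definition cocycle :: "'g \<Rightarrow> 'g vectors" where
  "cocycle g = as_vector (\<delta> g 0)"

lemma rep_simp [simp]: "rep g (as_vector f) = as_vector (shift g f)"
  by (simp add: rep_def)

lemma \<delta>_diff: "\<delta> x 0 - \<delta> y 0 = \<delta> x y"
  using \<delta>_add[of x 0 y] unfolding \<delta>_minus[of y 0, symmetric] by simp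

text \<open>The cocycle identity is additivity of \<open>\<delta>\<close> along
  \<open>g + h\<close>, \<open>g\<close>, \<open>0\<close>, as translation by \<open>g\<close>
  carries \<open>\<delta> h 0\<close> to \<open>\<delta> (g + h) g\<close>. Continuity of the
  cocycle follows because its differences are again of the form \<open>\<delta> x y\<close>.\<close>

lemma affine_action:
  "continuous_affine_isometric_action nsp (\<lambda>g u. rep g u \<oplus>\<^bsub>nsp\<^esub> cocycle g) rep cocycle"
  unfolding continuous_affine_isometric_action_def
proof (intro conjI allI ballI refl)
  show "linear_isometric_representation nsp rep"
    unfolding linear_isometric_representation_def
    by (auto simp: shift_E shift_add shift_scale Enorm_shift shift_zero shift_plus)
  show "strongly_continuous nsp rep"
    unfolding strongly_continuous_def
  proof
    fix u
    assume "u \<in> carrier nsp"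
    then obtain f where f: "u = as_vector f" "f \<in> E"
      by auto
    have "continuous_map euclidean (norm_topology nsp) (\<lambda>g. as_vector (shift g f))"
      by (intro continuous_map_nsp shift_tendsto) (simp_all add: shift_E f)
    then show "continuous_map euclidean (norm_topology nsp) (\<lambda>g. rep g u)"
      by (simp add: f)
  qed
  have "continuous_map euclidean (norm_topology nsp) cocycle"
    unfolding cocycle_def by (intro continuous_map_nsp) (simp_all add: \<delta>_E \<delta>_diff \<delta>_tendsto)
  moreover have "cocycle (g + h) = rep g (cocycle h) \<oplus>\<^bsub>nsp\<^esub> cocycle g" for g h
    by (simp add: cocycle_def shift_\<delta> \<delta>_add)
  ultimately show "continuous_cocycle nsp rep cocycle"
    by (simp add: continuous_cocycle_def)
qed

lemma ndist_cocycle: "ndist nsp (cocycle x) (cocycle y) = Enorm (\<delta> x y)"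
  by (simp add: cocycle_def ndist_nsp \<delta>_E \<delta>_diff)

text \<open>Coarse properness reduces membership in the coarse structure to boundedness of
  \<open>d\<close>. The upper and lower estimates of \<open>Enorm (\<delta> x y)\<close> then give
  one condition each.\<close>

lemma coarse_embedding_cocycle:
  assumes "coarsely_proper_ecart d"
  shows "coarse_embedding (carrier nsp) (ndist nsp) cocycle"
proof -
  have coarse: "A \<in> left_coarse_structure \<longleftrightarrow> bdd_above ((\<lambda>(x, y). d x y) ` A)" for A
  proof -
    have eq: "left_coarse_structure = ecart_coarse_structure d"
      using assms by (simp add: coarsely_proper_ecart_def)
    show ?thesis
      unfolding eq ecart_coarse_structure_def by simp
  qed
  have upper: "bdd_above ((\<lambda>(x, y). ndist nsp (cocycle x) (cocycle y)) ` A)" if A: "A \<in> left_coarse_structure" for A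
  proof -
    obtain B where B: "\<And>x y. (x, y) \<in> A \<Longrightarrow> d x y \<le> B"
      using A unfolding coarse bdd_above_def by fastforce
    have "ndist nsp (cocycle x) (cocycle y) \<le> 2 * sqrt B" if "(x, y) \<in> A" for x y
      using \<delta>_E(2)[of x y] real_sqrt_le_mono[OF B[OF that]] unfolding ndist_cocycle by linarith
    then show ?thesis
      by (intro bdd_aboveI2[of _ _ "2 * sqrt B"]) auto
  qed
  have lower: "{(x, y). ndist nsp (cocycle x) (cocycle y) \<le> C} \<in> left_coarse_structure" for C
  proof -
    \<comment> \<open>A distance above \<open>16^k\<close> would force a norm of at least
      \<open>(1/8)^k * 16^k = 2^k\<close>, which exceeds \<open>C\<close>.\<close>
    obtain k :: nat where k: "C < 2^k"
      using real_arch_pow[of 2 C] by auto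
    have "d x y \<le> 16^k" if "Enorm (\<delta> x y) \<le> C" for x y
    proof (rule ccontr)
      assume "\<not> d x y \<le> 16^k"
      then have "(1/8)^k * min (d x y) (16^k) = 2^k"
        by (simp flip: power_mult_distrib)
      then show False
        using Enorm_\<delta>_ge[of k x y] that k by linarith
    qed
    then show ?thesis
      unfolding coarse by (intro bdd_aboveI2[of _ _ "16^k"]) (auto simp: ndist_cocycle)
  qed
  have range: "range cocycle \<subseteq> carrier nsp"
    by (auto simp: cocycle_def \<delta>_E)
  show ?thesis
    unfolding coarse_embedding_def by (intro conjI ballI allI nsp.Metric_space_axioms range upper lower)
qed

end

theorem theorem10:
  fixes d :: "'g::topological_group_add \<Rightarrow> 'g \<Rightarrow> real"
  assumes "continuous_left_invariant_ecart d"
    and "coarsely_proper_ecart d"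
    and "stable_ecart d"
  shows "\<exists>(E :: 'g vectors nspace) (\<alpha> :: 'g \<Rightarrow> 'g vectors \<Rightarrow> 'g vectors).
           banach_space E \<and> reflexive_space E \<and> coarsely_proper_action E \<alpha>"
proof -
  interpret stable_group d
    using assms by unfold_locales
  have "coarsely_proper_action nsp (\<lambda>g u. rep g u \<oplus>\<^bsub>nsp\<^esub> cocycle g)"
    unfolding coarsely_proper_action_def using affine_action coarse_embedding_cocycle[OF assms(2)] by blast
  with banach_space_nsp reflexive_space_nsp show ?thesis
    by (intro exI conjI)
qed

end
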